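(* Let $G$ denote one of the two types $O$ or $Sp$. Let $N\ge 1$, $M\ge 0$ be integers (both even in the case $Sp$), and let $\lambda,\mu$ be partitions with $\lambda_i\ge\mu_i$ for all $i$, such that $\lambda$ is admissible for $G_{N+M}$ and $\mu$ is admissible for $G_M$. Let $\Omega$ be a standard tableau of shape $\lambda/\mu$ with $n$ boxes, and put $d_k(\Omega)=c_k(\Omega)+\frac M2\mp\frac12$ for $k=1,\dots,n$ (upper sign for $O$, lower sign for $Sp$). Then the operator $F_\Omega(M)$ on $(\mathbb C^N)^{\otimes n}$ is an intertwining operator of modules over the twisted Yangian $\mathrm Y(\mathfrak{gl}_N,\sigma)$ (restricting the $\mathrm Y(\mathfrak{gl}_N)$-modules to this subalgebra) $$\widetilde V(d_1(\Omega))\otimes\dots\otimes\widetilde V(d_n(\Omega))\longrightarrow V(d_1(\Omega))\otimes\dots\otimes V(d_n(\Omega)).$$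
   Context: **Groups and tableaux.** $\mathbb C^N$ carries a non-degenerate bilinear form $\langle\,,\rangle$, symmetric for type $O$, alternating for type $Sp$; $G_N=O_N$ or $Sp_N$ is the group preserving it. A partition $\nu$ is *admissible* for $G_K$ if $\nu_1'+\nu_2'\le K$ for $O_K$, and $2\nu'_1\le K$ for $Sp_K$ ($\nu'$ the conjugate). $\lambda/\mu=\{(i,j): i\ge1,\ \lambda_i\ge j>\mu_i\}$ has $n$ elements. A standard tableau is a bijection $\Omega:\lambda/\mu\to\{1,\dots,n\}$ increasing along rows and down columns; $c_k(\Omega)=j-i$ if $k=\Omega(i,j)$. **The operator $F_\Omega(M)$.** $P_{kl}$ exchanges the $k$th and $l$th factors of $(\mathbb C^N)^{\otimes n}$. With $u_i$ a basis of $\mathbb C^N$ and $v_i$ the dual basis, $\langle u_i,v_j\rangle=\delta_{ij}$, put $Q(N):u\otimes v\mapsto\langle u,v\rangle\sum_i u_i\otimes v_i$; $Q_{kl}$ is $Q(N)$ acting in the $k$th and $l$th factors. $F_\Omega(M)$ is the value at $t_1=\dots=t_n=\mp\frac12$ of $$\prod_{1\le k<l\le n}^{\longrightarrow}\Bigl(1-\frac{Q_{kl}}{c_k(\Omega)+c_l(\Omega)+t_k+t_l+N+M}\Bigr)\cdot\prod_{1\le k<l\le n}^{\longrightarrow}\Bigl(1-\frac{P_{kl}}{c_k(\Omega)-c_l(\Omega)+t_k-t_l}\Bigr)$$ (pairs ordered lexicographically), regarded as a rational function of variables $t_1,\dots,t_n$ constrained by $t_k=t_l$ whenever $k,l$ are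 in the same column of $\Omega$ (case $O$), or in the same row of $\Omega$ (case $Sp$); this constrained function is regular at the indicated point. **Yangian.** $\mathrm Y(\mathfrak{gl}_N)$ is the unital associative algebra with generators $T_{ij}^{(a)}$, $a\ge1$, $1\le i,j\le N$, and relations $(x-y)[T_{ij}(x),T_{kl}(y)]=T_{kj}(x)T_{il}(y)-T_{kj}(y)T_{il}(x)$, where $T_{ij}(x)=\delta_{ij}+\sum_{a\ge1}T_{ij}^{(a)}x^{-a}$; coproduct $\Delta(T_{ij}(x))=\sum_kT_{ik}(x)\otimes T_{kj}(x)$. Put $T(x)=\sum_{i,j}E_{ij}\otimes T_{ij}(x)$. Let $A\mapsto A^{t}$ be conjugation on $\mathrm{End}(\mathbb C^N)$ with respect to $\langle\,,\rangle$ ($\langle Au,v\rangle=\langle u,A^tv\rangle$), and $\sigma(A)=-A^t$. Let $\widetilde T(x)$ be obtained from $T(x)$ by applying $t$ to the first tensor factor and replacing $x$ by $-x$. The twisted Yangian $\mathrm Y(\mathfrak{gl}_N,\sigma)\subset\mathrm Y(\mathfrak{gl}_N)$ is the subalgebra generated by the coefficients of all series that appear when $\widetilde T(x)T(x)$ is expanded in the basis $E_{ij}$ of $\mathrm{End}(\mathbb C^N)$. **Modules.** For $z\in\mathbb C$, the evaluation module $V(z)$ is $\mathbb C^N$ with $T_{ij}(x)$ acting as $\delta_{ij}-E_{ji}(x-z)^{-1}$, and the twisted evaluation module $\widetilde V(z)$ is $\mathbb C^N$ with $T_{ij}(x)$ acting as $\delta_{ij}-\sigma(E_{ji})(x+z)^{-1}$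 (expanded in $x^{-1}$). Tensor products are formed using $\Delta$. *)

theory Defs
  imports
    "HOL-Analysis.Analysis"
    "HOL-Library.Poly_Mapping"
    "HOL-Computational_Algebra.Formal_Power_Series"
begin

section \<open>Bilinear forms\<close>

datatype group_type = Orth | Symp

definition bilinear_form :: "(complex^'N \<Rightarrow> complex^'N \<Rightarrow> complex) \<Rightarrow> bool" where
  "bilinear_form B \<longleftrightarrow>
     (\<forall>u. Vector_Spaces.linear (*s) (*) (B u)) \<and>
     (\<forall>v. Vector_Spaces.linear (*s) (*) (\<lambda>u. B u v))"

definition nondegenerate :: "(complex^'N \<Rightarrow> complex^'N \<Rightarrow> complex) \<Rightarrow> bool" where
  "nondegenerate B \<longleftrightarrow>
     (\<forall>u. (\<forall>v. B u v = 0) \<longrightarrow> u = 0) \<and> (\<forall>v. (\<forall>u. B u v = 0) \<longrightarrow> v = 0)"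

definition form_of_type :: "group_type \<Rightarrow> (complex^'N \<Rightarrow> complex^'N \<Rightarrow> complex) \<Rightarrow> bool" where
  "form_of_type G B \<longleftrightarrow> bilinear_form B \<and> nondegenerate B \<and>
     (case G of Orth \<Rightarrow> (\<forall>u v. B u v = B v u) | Symp \<Rightarrow> (\<forall>u. B u u = 0))"

definition dual_bases ::
  "(complex^'N \<Rightarrow> complex^'N \<Rightarrow> complex) \<Rightarrow> ('N \<Rightarrow> complex^'N) \<Rightarrow> ('N \<Rightarrow> complex^'N) \<Rightarrow> bool" where
  "dual_bases B us vs \<longleftrightarrow>
     inj us \<and> vec.independent (range us) \<and> vec.span (range us) = UNIV \<and>
     (\<forall>i j. B (us i) (vs j) = (if i = j then 1 else 0))"

definition conjugate_op ::
  "(complex^'N \<Rightarrow> complex^'N \<Rightarrow> complex) \<Rightarrow> complex^'N^'N \<Rightarrow> complex^'N^'N" where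
  "conjugate_op B A = (THE A'. \<forall>u v. B (A *v u) v = B u (A' *v v))"

definition sigma ::
  "(complex^'N \<Rightarrow> complex^'N \<Rightarrow> complex) \<Rightarrow> complex^'N^'N \<Rightarrow> complex^'N^'N" where
  "sigma B A = - conjugate_op B A"

definition matrix_unit :: "'N \<Rightarrow> 'N \<Rightarrow> complex^'N^'N" where
  "matrix_unit i j = (\<chi> a b. if a = i \<and> b = j then 1 else 0)"


section \<open>Partitions and standard tableaux\<close>

text \<open>Parts are indexed from 1; the value at 0 plays no role.\<close>

definition is_partition :: "(nat \<Rightarrow> nat) \<Rightarrow> bool" where
  "is_partition p \<longleftrightarrow> (\<forall>i\<ge>1. p (Suc i) \<le> p i) \<and> finite {i. 1 \<le> i \<and> p i \<noteq> 0}"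

definition conjugate_partition :: "(nat \<Rightarrow> nat) \<Rightarrow> nat \<Rightarrow> nat" where
  "conjugate_partition p j = card {i. 1 \<le> i \<and> j \<le> p i}"

definition admissible :: "group_type \<Rightarrow> nat \<Rightarrow> (nat \<Rightarrow> nat) \<Rightarrow> bool" where
  "admissible G K p \<longleftrightarrow>
     (case G of
        Orth \<Rightarrow> conjugate_partition p 1 + conjugate_partition p 2 \<le> K
      | Symp \<Rightarrow> 2 * conjugate_partition p 1 \<le> K)"

definition skew_diagram :: "(nat \<Rightarrow> nat) \<Rightarrow> (nat \<Rightarrow> nat) \<Rightarrow> (nat \<times> nat) set" where
  "skew_diagram lam mu = {(i, j). 1 \<le> i \<and> j \<le> lam i \<and> mu i < j}"

definition standard_tableau :: "(nat \<times> nat) set \<Rightarrow> nat \<Rightarrow> (nat \<times> nat \<Rightarrow> nat) \<Rightarrow> bool" where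
  "standard_tableau D n \<Omega> \<longleftrightarrow> bij_betw \<Omega> D {1..n} \<and>
     (\<forall>i j j'. (i, j) \<in> D \<and> (i, j') \<in> D \<and> j < j' \<longrightarrow> \<Omega> (i, j) < \<Omega> (i, j')) \<and>
     (\<forall>i i' j. (i, j) \<in> D \<and> (i', j) \<in> D \<and> i < i' \<longrightarrow> \<Omega> (i, j) < \<Omega> (i', j))"

definition box :: "(nat \<times> nat) set \<Rightarrow> (nat \<times> nat \<Rightarrow> nat) \<Rightarrow> nat \<Rightarrow> nat \<times> nat" where
  "box D \<Omega> k = inv_into D \<Omega> k"

definition content :: "(nat \<times> nat) set \<Rightarrow> (nat \<times> nat \<Rightarrow> nat) \<Rightarrow> nat \<Rightarrow> int" where
  "content D \<Omega> k = int (snd (box D \<Omega> k)) - int (fst (box D \<Omega> k))"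

definition half_shift :: "group_type \<Rightarrow> complex" where
  "half_shift G = (case G of Orth \<Rightarrow> - 1 / 2 | Symp \<Rightarrow> 1 / 2)"

definition d_param ::
  "group_type \<Rightarrow> nat \<Rightarrow> (nat \<times> nat) set \<Rightarrow> (nat \<times> nat \<Rightarrow> nat) \<Rightarrow> nat \<Rightarrow> complex" where
  "d_param G M D \<Omega> k = of_int (content D \<Omega> k) + of_nat M / 2 + half_shift G"


section \<open>Operators on tensor powers\<close>

text \<open>The standard basis of the n-th tensor power of \<open>complex^'N\<close> is indexed by the lists of
  length n over \<open>'N\<close>.  An operator from the p-th to the q-th tensor power is given by its matrix
  in these bases; only the entries at (row of length q, column of length p) are meaningful.\<close>

type_synonym 'N tensor_op = "'N list \<Rightarrow> 'N list \<Rightarrow> complex"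

definition words :: "nat \<Rightarrow> 'N list set" where
  "words n = {w. length w = n}"

definition op_id :: "'N tensor_op" where
  "op_id u w = (if u = w then 1 else 0)"

definition op_mult :: "nat \<Rightarrow> 'N tensor_op \<Rightarrow> 'N tensor_op \<Rightarrow> 'N tensor_op" where
  "op_mult n X Y u w = (\<Sum>m\<in>words n. X u m * Y m w)"

text \<open>Tensor product of an operator X on the p-th tensor power with an operator on a further
  tensor power.\<close>

definition op_tensor :: "nat \<Rightarrow> 'N tensor_op \<Rightarrow> 'N tensor_op \<Rightarrow> 'N tensor_op" where
  "op_tensor p X Y u w = X (take p u) (take p w) * Y (drop p u) (drop p w)"

definition op_of_matrix :: "complex^'N^'N \<Rightarrow> 'N tensor_op" where
  "op_of_matrix A u w = A $ hd u $ hd w"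

text \<open>Operators on the tensor square, and their action in the k-th and l-th factors
  (factors are counted from 1, list positions from 0).\<close>

type_synonym 'N square_op = "'N \<times> 'N \<Rightarrow> 'N \<times> 'N \<Rightarrow> complex"

definition act_in_factors :: "nat \<Rightarrow> nat \<Rightarrow> 'N square_op \<Rightarrow> 'N tensor_op" where
  "act_in_factors k l X u w =
     (if \<forall>m < length w. m \<noteq> k - 1 \<and> m \<noteq> l - 1 \<longrightarrow> u ! m = w ! m
      then X (u ! (k - 1), u ! (l - 1)) (w ! (k - 1), w ! (l - 1)) else 0)"

definition P_square :: "'N square_op" where
  "P_square = (\<lambda>(a, b) (c, d). if a = d \<and> b = c then 1 else 0)"

definition Q_square ::
  "(complex^'N \<Rightarrow> complex^'N \<Rightarrow> complex) \<Rightarrow> ('N \<Rightarrow> complex^'N) \<Rightarrow> ('N \<Rightarrow> complex^'N)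
     \<Rightarrow> 'N square_op" where
  "Q_square B us vs =
     (\<lambda>(a, b) (c, d). B (axis c 1) (axis d 1) * (\<Sum>i\<in>UNIV. us i $ a * vs i $ b))"


section \<open>The operator F\<close>

definition lex_pairs :: "nat \<Rightarrow> (nat \<times> nat) list" where
  "lex_pairs n = concat (map (\<lambda>k. map (\<lambda>l. (k, l)) [Suc k..<Suc n]) [1..<Suc n])"

definition op_factor :: "'N tensor_op \<Rightarrow> complex \<Rightarrow> 'N tensor_op" where
  "op_factor X c u w = op_id u w - X u w / c"

definition ordered_prod :: "nat \<Rightarrow> 'N tensor_op list \<Rightarrow> 'N tensor_op" where
  "ordered_prod n Xs = foldr (op_mult n) Xs op_id"

definition Q_denominator ::
  "nat \<Rightarrow> nat \<Rightarrow> (nat \<times> nat) set \<Rightarrow> (nat \<times> nat \<Rightarrow> nat) \<Rightarrow> (nat \<Rightarrow> complex) \<Rightarrow> nat \<Rightarrow> nat \<Rightarrow> complex"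
  where
  "Q_denominator N M D \<Omega> t k l =
     of_int (content D \<Omega> k + content D \<Omega> l) + t k + t l + of_nat N + of_nat M"

definition P_denominator ::
  "(nat \<times> nat) set \<Rightarrow> (nat \<times> nat \<Rightarrow> nat) \<Rightarrow> (nat \<Rightarrow> complex) \<Rightarrow> nat \<Rightarrow> nat \<Rightarrow> complex" where
  "P_denominator D \<Omega> t k l = of_int (content D \<Omega> k - content D \<Omega> l) + t k - t l"

definition F_function ::
  "(complex^'N \<Rightarrow> complex^'N \<Rightarrow> complex) \<Rightarrow> ('N \<Rightarrow> complex^'N) \<Rightarrow> ('N \<Rightarrow> complex^'N) \<Rightarrow> nat \<Rightarrow> nat
     \<Rightarrow> (nat \<times> nat) set \<Rightarrow> (nat \<times> nat \<Rightarrow> nat) \<Rightarrow> (nat \<Rightarrow> complex) \<Rightarrow> 'N tensor_op" where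
  "F_function B us vs M n D \<Omega> t =
     op_mult n
       (ordered_prod n
         (map (\<lambda>(k, l). op_factor (act_in_factors k l (Q_square B us vs))
                          (Q_denominator CARD('N) M D \<Omega> t k l)) (lex_pairs n)))
       (ordered_prod n
         (map (\<lambda>(k, l). op_factor (act_in_factors k l P_square)
                          (P_denominator D \<Omega> t k l)) (lex_pairs n)))"

definition constraint_space ::
  "group_type \<Rightarrow> nat \<Rightarrow> (nat \<times> nat) set \<Rightarrow> (nat \<times> nat \<Rightarrow> nat) \<Rightarrow> (nat \<Rightarrow> complex) set" where
  "constraint_space G n D \<Omega> =
     {t. \<forall>k\<in>{1..n}. \<forall>l\<in>{1..n}.
           (case G of
              Orth \<Rightarrow> snd (box D \<Omega> k) = snd (box D \<Omega> l)
            | Symp \<Rightarrow> fst (box D \<Omega> k) = fst (box D \<Omega> l)) \<longrightarrow> t k = t l}"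

text \<open>The points of the constraint space at which no denominator vanishes.  None of the
  denominators vanishes identically on the constraint space, so these points are Zariski dense
  in it.\<close>

definition F_domain ::
  "group_type \<Rightarrow> nat \<Rightarrow> nat \<Rightarrow> nat \<Rightarrow> (nat \<times> nat) set \<Rightarrow> (nat \<times> nat \<Rightarrow> nat) \<Rightarrow> (nat \<Rightarrow> complex) set"
  where
  "F_domain G N M n D \<Omega> =
     {t \<in> constraint_space G n D \<Omega>.
        \<forall>k l. 1 \<le> k \<and> k < l \<and> l \<le> n \<longrightarrow>
          Q_denominator N M D \<Omega> t k l \<noteq> 0 \<and> P_denominator D \<Omega> t k l \<noteq> 0}"

inductive polynomial_fun :: "((nat \<Rightarrow> complex) \<Rightarrow> complex) \<Rightarrow> bool" where
  const: "polynomial_fun (\<lambda>t. c)"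
| coord: "polynomial_fun (\<lambda>t. t k)"
| add: "polynomial_fun p \<Longrightarrow> polynomial_fun q \<Longrightarrow> polynomial_fun (\<lambda>t. p t + q t)"
| mult: "polynomial_fun p \<Longrightarrow> polynomial_fun q \<Longrightarrow> polynomial_fun (\<lambda>t. p t * q t)"

text \<open>The rational function f, given by its values on the dense set S of a linear space, is a
  quotient p / q of polynomials with q not vanishing at the point t0, and y is its value there.\<close>

definition regular_value ::
  "(nat \<Rightarrow> complex) set \<Rightarrow> ((nat \<Rightarrow> complex) \<Rightarrow> complex) \<Rightarrow> (nat \<Rightarrow> complex) \<Rightarrow> complex \<Rightarrow> bool" where
  "regular_value S f t0 y \<longleftrightarrow>
     (\<exists>p q. polynomial_fun p \<and> polynomial_fun q \<and> q t0 \<noteq> 0 \<and>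
            (\<forall>t\<in>S. f t * q t = p t) \<and> y = p t0 / q t0)"

text \<open>For admissible shapes the constrained function is regular at the point in question; the
  value 0 in the other case is the usual convention for a total function (as in \<open>infsum\<close>).\<close>

definition F_op ::
  "group_type \<Rightarrow> (complex^'N \<Rightarrow> complex^'N \<Rightarrow> complex) \<Rightarrow> ('N \<Rightarrow> complex^'N) \<Rightarrow> ('N \<Rightarrow> complex^'N)
     \<Rightarrow> nat \<Rightarrow> nat \<Rightarrow> (nat \<times> nat) set \<Rightarrow> (nat \<times> nat \<Rightarrow> nat) \<Rightarrow> 'N tensor_op" where
  "F_op G B us vs M n D \<Omega> =
     (let value_at = (\<lambda>u w. regular_value (F_domain G CARD('N) M n D \<Omega>)
                        (\<lambda>t. F_function B us vs M n D \<Omega> t u w) (\<lambda>_. half_shift G))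
      in if \<forall>u\<in>words n. \<forall>w\<in>words n. \<exists>y. value_at u w y
         then (\<lambda>u w. THE y. value_at u w y)
         else (\<lambda>u w. 0))"


section \<open>The Yangian\<close>

text \<open>The free algebra on a set of letters is the monoid algebra of the free monoid.\<close>

datatype 'g free_word = Word (letters: "'g list")

instantiation free_word :: (type) monoid_add
begin

definition zero_free_word :: "'a free_word" where
  "zero_free_word = Word []"

definition plus_free_word :: "'a free_word \<Rightarrow> 'a free_word \<Rightarrow> 'a free_word" where
  "plus_free_word v w = Word (letters v @ letters w)"

instance
  by standard (simp_all add: zero_free_word_def plus_free_word_def)

end

text \<open>The letter (a, i, j) stands for the generator with upper index a + 1 and lower indices
  i, j; the coefficient with upper index 0 is the Kronecker delta.\<close>

type_synonym 'N free_algebra = "(nat \<times> 'N \<times> 'N) free_word \<Rightarrow>\<^sub>0 complex"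

definition free_T :: "nat \<Rightarrow> 'N \<Rightarrow> 'N \<Rightarrow> 'N free_algebra" where
  "free_T a i j =
     (case a of 0 \<Rightarrow> (if i = j then 1 else 0)
      | Suc b \<Rightarrow> Poly_Mapping.single (Word [(b, i, j)]) 1)"

text \<open>The coefficient at \<open>x^(-r) y^(-s)\<close> of the difference of the two sides of
  \<open>(x - y) [T\<^sub>i\<^sub>j(x), T\<^sub>k\<^sub>l(y)] = T\<^sub>k\<^sub>j(x) T\<^sub>i\<^sub>l(y) - T\<^sub>k\<^sub>j(y) T\<^sub>i\<^sub>l(x)\<close>.  The coefficients with a positive
  power of x or y vanish identically.\<close>

definition yangian_relator ::
  "nat \<Rightarrow> nat \<Rightarrow> 'N \<Rightarrow> 'N \<Rightarrow> 'N \<Rightarrow> 'N \<Rightarrow> 'N free_algebra" where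
  "yangian_relator r s i j k l =
     (free_T (Suc r) i j * free_T s k l - free_T s k l * free_T (Suc r) i j)
     - (free_T r i j * free_T (Suc s) k l - free_T (Suc s) k l * free_T r i j)
     - (free_T r k j * free_T s i l - free_T s k j * free_T r i l)"

inductive_set yangian_ideal :: "'N free_algebra set" where
  relator: "yangian_relator r s i j k l \<in> yangian_ideal"
| zero: "0 \<in> yangian_ideal"
| add: "x \<in> yangian_ideal \<Longrightarrow> y \<in> yangian_ideal \<Longrightarrow> x + y \<in> yangian_ideal"
| mult: "x \<in> yangian_ideal \<Longrightarrow> a * x * b \<in> yangian_ideal"

definition yangian_eq :: "'N free_algebra \<Rightarrow> 'N free_algebra \<Rightarrow> bool" where
  "yangian_eq x y \<longleftrightarrow> x - y \<in> yangian_ideal"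

lemma yangian_ideal_left: "x \<in> yangian_ideal \<Longrightarrow> a * x \<in> yangian_ideal"
  using yangian_ideal.mult[of x a 1] by simp

lemma yangian_ideal_right: "x \<in> yangian_ideal \<Longrightarrow> x * b \<in> yangian_ideal"
  using yangian_ideal.mult[of x 1 b] by simp

lemma yangian_ideal_uminus: "x \<in> yangian_ideal \<Longrightarrow> - x \<in> yangian_ideal"
  using yangian_ideal_left[of x "- 1"] by simp

lemma yangian_ideal_diff: "x \<in> yangian_ideal \<Longrightarrow> y \<in> yangian_ideal \<Longrightarrow> x - y \<in> yangian_ideal"
  using yangian_ideal.add[of x "- y"] yangian_ideal_uminus[of y] by simp

lemma equivp_yangian_eq: "equivp (yangian_eq :: 'N free_algebra \<Rightarrow> _)"
proof (rule equivpI)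
  show "reflp (yangian_eq :: 'N free_algebra \<Rightarrow> _)"
    by (simp add: reflp_def yangian_eq_def yangian_ideal.zero)
  show "symp (yangian_eq :: 'N free_algebra \<Rightarrow> _)"
  proof (rule sympI)
    fix x y :: "'N free_algebra"
    assume "yangian_eq x y"
    then show "yangian_eq y x"
      using yangian_ideal_uminus[of "x - y"] by (simp add: yangian_eq_def)
  qed
  show "transp (yangian_eq :: 'N free_algebra \<Rightarrow> _)"
  proof (rule transpI)
    fix x y z :: "'N free_algebra"
    assume "yangian_eq x y" "yangian_eq y z"
    then show "yangian_eq x z"
      using yangian_ideal.add[of "x - y" "y - z"] by (simp add: yangian_eq_def)
  qed
qed

quotient_type 'N yangian = "'N free_algebra" / yangian_eq
  by (rule equivp_yangian_eq)

lemma lookup_times_zero: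
  fixes x y :: "'N free_algebra"
  shows "Poly_Mapping.lookup (x * y) 0 = Poly_Mapping.lookup x 0 * Poly_Mapping.lookup y 0"
proof -
  have eq: "(0 = l + q) \<longleftrightarrow> l = 0 \<and> q = 0" for l q :: "(nat \<times> 'N \<times> 'N) free_word"
    by (cases l; cases q) (auto simp: zero_free_word_def plus_free_word_def)
  have "Poly_Mapping.lookup (x * y) 0 =
      (\<Sum>l. Poly_Mapping.lookup x l * (\<Sum>q. Poly_Mapping.lookup y q when 0 = l + q))"
    by (rule lookup_mult)
  also have "\<dots> = (\<Sum>l. Poly_Mapping.lookup x l * (Poly_Mapping.lookup y 0 when l = 0))"
  proof (rule Sum_any.cong)
    fix l :: "(nat \<times> 'N \<times> 'N) free_word"
    have "(\<Sum>q. Poly_Mapping.lookup y q when 0 = l + q) = (\<Sum>q. (Poly_Mapping.lookup y q when l = 0) when q = 0)"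
      by (rule Sum_any.cong) (auto simp: eq when_def)
    then show "Poly_Mapping.lookup x l * (\<Sum>q. Poly_Mapping.lookup y q when 0 = l + q) =
        Poly_Mapping.lookup x l * (Poly_Mapping.lookup y 0 when l = 0)"
      by simp
  qed
  also have "\<dots> = (\<Sum>l. (Poly_Mapping.lookup x l * Poly_Mapping.lookup y 0) when l = 0)"
    by (rule Sum_any.cong) (auto simp: when_def)
  finally show ?thesis by simp
qed

lemma yangian_ideal_lookup_zero:
  "x \<in> yangian_ideal \<Longrightarrow> Poly_Mapping.lookup x 0 = 0"
proof (induction rule: yangian_ideal.induct)
  case (relator r s i j k l)
  have T: "Poly_Mapping.lookup (free_T a i j) 0 = (if a = 0 \<and> i = j then 1 else 0)"
    for a and i j :: 'a
    by (auto simp: free_T_def lookup_one lookup_single zero_free_word_def split: nat.split)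
  show ?case
    by (simp add: yangian_relator_def lookup_minus lookup_times_zero T)
qed (simp_all add: lookup_add lookup_times_zero)

lemma one_notin_yangian_ideal: "1 \<notin> yangian_ideal"
  using yangian_ideal_lookup_zero[of 1] by (auto simp: lookup_one)

instantiation yangian :: (type) ring_1
begin

lift_definition zero_yangian :: "'a yangian" is 0 .
lift_definition one_yangian :: "'a yangian" is 1 .

lift_definition plus_yangian :: "'a yangian \<Rightarrow> 'a yangian \<Rightarrow> 'a yangian" is "(+)"
proof -
  fix x x' y y' :: "'a free_algebra"
  assume "yangian_eq x x'" "yangian_eq y y'"
  then have "(x - x') + (y - y') \<in> yangian_ideal"
    unfolding yangian_eq_def by (rule yangian_ideal.add)
  then show "yangian_eq (x + y) (x' + y')"
    by (simp add: yangian_eq_def algebra_simps)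
qed

lift_definition uminus_yangian :: "'a yangian \<Rightarrow> 'a yangian" is uminus
proof -
  fix x y :: "'a free_algebra"
  assume "yangian_eq x y"
  then show "yangian_eq (- x) (- y)"
    using yangian_ideal_uminus[of "x - y"] by (simp add: yangian_eq_def)
qed

lift_definition minus_yangian :: "'a yangian \<Rightarrow> 'a yangian \<Rightarrow> 'a yangian" is "(-)"
proof -
  fix x x' y y' :: "'a free_algebra"
  assume "yangian_eq x x'" "yangian_eq y y'"
  then have "(x - x') - (y - y') \<in> yangian_ideal"
    unfolding yangian_eq_def by (rule yangian_ideal_diff)
  then show "yangian_eq (x - y) (x' - y')"
    by (simp add: yangian_eq_def algebra_simps)
qed

lift_definition times_yangian :: "'a yangian \<Rightarrow> 'a yangian \<Rightarrow> 'a yangian" is "(*)"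
proof -
  fix x x' y y' :: "'a free_algebra"
  assume "yangian_eq x x'" "yangian_eq y y'"
  then have "(x - x') * y + x' * (y - y') \<in> yangian_ideal"
    unfolding yangian_eq_def
    by (intro yangian_ideal.add yangian_ideal_left yangian_ideal_right)
  then show "yangian_eq (x * y) (x' * y')"
    by (simp add: yangian_eq_def algebra_simps)
qed

instance
proof
  show "(0 :: 'a yangian) \<noteq> 1"
  proof (transfer, rule notI)
    assume "yangian_eq (0 :: 'a free_algebra) 1"
    then have "- (0 - 1 :: 'a free_algebra) \<in> yangian_ideal"
      unfolding yangian_eq_def by (rule yangian_ideal_uminus)
    then show False
      by (simp add: one_notin_yangian_ideal)
  qed
  fix a b c :: "'a yangian"
  show "a + b + c = a + (b + c)" "a + b = b + a" "0 + a = a" "- a + a = 0"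
    "a - b = a + - b" "a * b * c = a * (b * c)" "1 * a = a" "a * 1 = a"
    "(a + b) * c = a * c + b * c" "a * (b + c) = a * b + a * c"
    by (transfer, simp add: yangian_eq_def yangian_ideal.zero algebra_simps)+
qed

end

lift_definition yangian_scale :: "complex \<Rightarrow> 'N yangian \<Rightarrow> 'N yangian"
  is "\<lambda>c x. Poly_Mapping.single 0 c * x"
proof -
  fix c and x y :: "'N free_algebra"
  assume "yangian_eq x y"
  then show "yangian_eq (Poly_Mapping.single 0 c * x) (Poly_Mapping.single 0 c * y)"
    using yangian_ideal_left[of "x - y" "Poly_Mapping.single 0 c"]
    by (simp add: yangian_eq_def right_diff_distrib)
qed

lift_definition yangian_T :: "nat \<Rightarrow> 'N \<Rightarrow> 'N \<Rightarrow> 'N yangian" is free_T .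


section \<open>The twisted Yangian\<close>

text \<open>A series in \<open>x^(-1)\<close> is represented by the formal power series with the same coefficients.
  The matrix entries of \<open>T_series\<close> are the \<open>T\<^sub>i\<^sub>j(x)\<close>.\<close>

definition T_series :: "'N yangian fps ^ 'N ^ 'N" where
  "T_series = (\<chi> i j. Abs_fps (\<lambda>a. yangian_T a i j))"

definition T_tilde_series ::
  "(complex^'N \<Rightarrow> complex^'N \<Rightarrow> complex) \<Rightarrow> 'N yangian fps ^ 'N ^ 'N" where
  "T_tilde_series B = (\<chi> k l. Abs_fps (\<lambda>a. \<Sum>i\<in>UNIV. \<Sum>j\<in>UNIV.
     yangian_scale (conjugate_op B (matrix_unit i j) $ k $ l * (- 1) ^ a) (yangian_T a i j)))"

inductive_set twisted_yangian ::
  "(complex^'N \<Rightarrow> complex^'N \<Rightarrow> complex) \<Rightarrow> 'N yangian set"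
  for B :: "complex^'N \<Rightarrow> complex^'N \<Rightarrow> complex" where
  generator: "fps_nth ((T_tilde_series B ** T_series) $ i $ j) a \<in> twisted_yangian B"
| one: "1 \<in> twisted_yangian B"
| scale: "x \<in> twisted_yangian B \<Longrightarrow> yangian_scale c x \<in> twisted_yangian B"
| add: "x \<in> twisted_yangian B \<Longrightarrow> y \<in> twisted_yangian B \<Longrightarrow> x + y \<in> twisted_yangian B"
| mult: "x \<in> twisted_yangian B \<Longrightarrow> y \<in> twisted_yangian B \<Longrightarrow> x * y \<in> twisted_yangian B"


section \<open>Modules\<close>

text \<open>A module is a tensor power of \<open>complex^'N\<close>, given by its degree, with an action of the
  Yangian.\<close>

type_synonym 'N yangian_module = "nat \<times> ('N yangian \<Rightarrow> 'N tensor_op)"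

text \<open>The module of degree n in which \<open>yangian_T a i j\<close>, for a at least 1, acts as \<open>g a i j\<close>.  When
  the operators \<open>g a i j\<close> satisfy the defining relations of the Yangian, this extends uniquely to an
  algebra homomorphism, and the value does not depend on the representative chosen by
  \<open>rep_yangian\<close>.  This is the case for the evaluation modules and their tensor products.\<close>

definition word_action ::
  "nat \<Rightarrow> (nat \<Rightarrow> 'N \<Rightarrow> 'N \<Rightarrow> 'N tensor_op) \<Rightarrow> (nat \<times> 'N \<times> 'N) free_word \<Rightarrow> 'N tensor_op" where
  "word_action n g m = ordered_prod n (map (\<lambda>(b, i, j). g (Suc b) i j) (letters m))"

definition module_by_generators ::
  "nat \<Rightarrow> (nat \<Rightarrow> 'N \<Rightarrow> 'N \<Rightarrow> 'N tensor_op) \<Rightarrow> 'N yangian_module" where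
  "module_by_generators n g =
     (n, \<lambda>y u w. let r = rep_yangian y in
           \<Sum>m\<in>Poly_Mapping.keys r. Poly_Mapping.lookup r m * word_action n g m u w)"

text \<open>The coefficients at \<open>x^(-a)\<close>, for a at least 1, of \<open>\<delta>\<^sub>i\<^sub>j - E\<^sub>j\<^sub>i / (x - z)\<close> and
  \<open>\<delta>\<^sub>i\<^sub>j - \<sigma>(E\<^sub>j\<^sub>i) / (x + z)\<close>.\<close>

definition evaluation_module :: "complex \<Rightarrow> 'N::finite yangian_module" where
  "evaluation_module z = module_by_generators 1
     (\<lambda>a i j u w. - (z ^ (a - 1)) * op_of_matrix (matrix_unit j i) u w)"

definition twisted_evaluation_module ::
  "(complex^'N \<Rightarrow> complex^'N \<Rightarrow> complex) \<Rightarrow> complex \<Rightarrow> 'N yangian_module" where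
  "twisted_evaluation_module B z = module_by_generators 1
     (\<lambda>a i j u w. - ((- z) ^ (a - 1)) * op_of_matrix (sigma B (matrix_unit j i)) u w)"

text \<open>Tensor products via the coproduct
  \<open>\<Delta>(T\<^sub>i\<^sub>j(x)) = \<Sum>\<^sub>k T\<^sub>i\<^sub>k(x) \<otimes> T\<^sub>k\<^sub>j(x)\<close>; the empty tensor product is the module of the counit
  \<open>T\<^sub>i\<^sub>j(x) \<mapsto> \<delta>\<^sub>i\<^sub>j\<close>.\<close>

definition tensor_module ::
  "'N::finite yangian_module \<Rightarrow> 'N yangian_module \<Rightarrow> 'N yangian_module" where
  "tensor_module V W = module_by_generators (fst V + fst W)
     (\<lambda>a i j u w. \<Sum>b\<le>a. \<Sum>k\<in>UNIV.
        op_tensor (fst V) (snd V (yangian_T b i k)) (snd W (yangian_T (a - b) k j)) u w)"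

definition trivial_module :: "'N yangian_module" where
  "trivial_module = module_by_generators 0 (\<lambda>a i j u w. 0)"

definition tensor_modules :: "'N::finite yangian_module list \<Rightarrow> 'N yangian_module" where
  "tensor_modules Vs = foldr tensor_module Vs trivial_module"

text \<open>The operator F is a homomorphism from V to W over the subalgebra A.\<close>

definition intertwining ::
  "'N yangian set \<Rightarrow> 'N yangian_module \<Rightarrow> 'N yangian_module \<Rightarrow> 'N tensor_op \<Rightarrow> bool" where
  "intertwining A V W F \<longleftrightarrow>
     (\<forall>x\<in>A. \<forall>u\<in>words (fst W). \<forall>w\<in>words (fst V).
        op_mult (fst V) F (snd V x) u w = op_mult (fst W) (snd W x) F u w)"

end

theory Submission
  imports Defs
begin

text \<open>
  Put \<open>z\<^sub>k = c\<^sub>k + t\<^sub>k + M/2\<close>.  The factors of the product defining \<open>F\<close> become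
  \<open>1 - Q\<^sub>k\<^sub>l / (z\<^sub>k + z\<^sub>l + N)\<close> and \<open>1 - P\<^sub>k\<^sub>l / (z\<^sub>k - z\<^sub>l)\<close>.  With an auxiliary factor 0 and
  \<open>L\<^sub>k = 1 - P\<^sub>0\<^sub>k / (x - z\<^sub>k)\<close>, \<open>M\<^sub>k = 1 + Q\<^sub>0\<^sub>k / (x + z\<^sub>k)\<close>, the generating matrix of the twisted Yangian acts
  on the tensor product of the \<open>V(z\<^sub>k)\<close> as \<open>M\<^sub>n \<dots> M\<^sub>1 L\<^sub>1 \<dots> L\<^sub>n\<close>, and on that of the twisted modules as
  \<open>L\<^sub>n \<dots> L\<^sub>1 M\<^sub>1 \<dots> M\<^sub>n\<close>.  By the Yang-Baxter equation and its partial transposes, the product of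
  the P-factors reverses the order of the \<open>L\<^sub>k\<close> and of the \<open>M\<^sub>k\<close>, and the product of the Q-factors
  then moves the \<open>M\<^sub>k\<close> past the \<open>L\<^sub>k\<close>.  So \<open>F\<close> intertwines the two actions wherever no denominator
  vanishes.  The value of \<open>F\<close> at the special point is the limit along a line in the constraint
  space on which the denominators vanish at finitely many points only, and the action depends
  continuously on the \<open>z\<^sub>k\<close>.
\<close>

section \<open>The ring of length-preserving operators on words\<close>

text \<open>The exchange relations concern single factors of \<open>F\<close>, but at the special
  point single factors may not exist: boxes on one diagonal have equal contents, so
  \<open>z_k = z_l\<close> there and the P-factor has a pole, even when the whole product is
  regular. Hence the algebra is done off the poles, and only the finished identity is carried to the
  limit. The variable x, in contrast, stays formal: entries are power series in 1/x, so no value of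
  x has to be avoided. The summand N in the Q-denominator comes from Q^2 = N Q. Moving Q_kl past L_k
  and M_l produces a cubic term containing this square, while \<open>z_k + z_l\<close> comes from
  the difference of the poles at \<open>z_k\<close> and \<open>- z_l\<close>. Splitting M evenly
  among the two parameters turns both denominators into functions of the \<open>z_k\<close>, and at
  the special point \<open>z_k\<close> is \<open>d_k\<close>. In the relations between P and Q the
  sign of the form occurs only squared, so the two types share the algebra. They differ in the half
  shift and in the line along which the limit is taken.\<close>

text \<open>All tensor powers are treated at once: an operator preserving the degree is a block diagonal
  matrix over all words.\<close>

typedef (overloaded) ('n, 'c::zero) gop =
  "{f :: 'n list \<Rightarrow> 'n list \<Rightarrow> 'c. \<forall>u w. length u \<noteq> length w \<longrightarrow> f u w = 0}"
  morphisms entry Gop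
  by (rule exI[of _ "\<lambda>_ _. 0"]) auto

setup_lifting type_definition_gop

lemma gop_eqI: "(\<And>u w. length u = length w \<Longrightarrow> entry X u w = entry Y u w) \<Longrightarrow> X = Y"
  by transfer (auto simp: fun_eq_iff, metis)

lemma entry_eq_0: "length u \<noteq> length w \<Longrightarrow> entry X u w = 0"
  by transfer auto

lemma finite_words [simp, intro]: "finite (words n :: 'n::finite list set)"
  using finite_lists_length_eq[of "UNIV :: 'n set" n] by (simp add: words_def)

lemma in_words [simp]: "w \<in> words n \<longleftrightarrow> length w = n"
  by (simp add: words_def)

instantiation gop :: (finite, comm_ring_1) ring_1
begin

lift_definition zero_gop :: "('a, 'b) gop" is "\<lambda>_ _. 0" by simp
lift_definition one_gop :: "('a, 'b) gop" is "\<lambda>u w. if u = w then 1 else 0" by auto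
lift_definition plus_gop :: "('a, 'b) gop \<Rightarrow> ('a, 'b) gop \<Rightarrow> ('a, 'b) gop"
  is "\<lambda>X Y u w. X u w + Y u w" by simp
lift_definition uminus_gop :: "('a, 'b) gop \<Rightarrow> ('a, 'b) gop" is "\<lambda>X u w. - X u w" by simp
lift_definition minus_gop :: "('a, 'b) gop \<Rightarrow> ('a, 'b) gop \<Rightarrow> ('a, 'b) gop"
  is "\<lambda>X Y u w. X u w - Y u w" by simp
lift_definition times_gop :: "('a, 'b) gop \<Rightarrow> ('a, 'b) gop \<Rightarrow> ('a, 'b) gop"
  is "\<lambda>X Y u w. \<Sum>m\<in>words (length u). X u m * Y m w"
  by (auto intro!: sum.neutral)

instance
proof
  fix a b c :: "('a, 'b) gop"
  show "a * b * c = a * (b * c)"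
  proof (transfer, intro ext)
    fix a b c :: "'a list \<Rightarrow> 'a list \<Rightarrow> 'b" and u w
    have "(\<Sum>m\<in>words (length u). (\<Sum>k\<in>words (length u). a u k * b k m) * c m w)
        = (\<Sum>m\<in>words (length u). \<Sum>k\<in>words (length u). a u k * (b k m * c m w))"
      by (simp add: sum_distrib_right mult.assoc)
    also have "\<dots> = (\<Sum>k\<in>words (length u). \<Sum>m\<in>words (length u). a u k * (b k m * c m w))"
      by (rule sum.swap)
    also have "\<dots> = (\<Sum>k\<in>words (length u). a u k * (\<Sum>m\<in>words (length k). b k m * c m w))"
      by (simp add: sum_distrib_left)
    finally show "(\<Sum>m\<in>words (length u). (\<Sum>k\<in>words (length u). a u k * b k m) * c m w)
        = (\<Sum>k\<in>words (length u). a u k * (\<Sum>m\<in>words (length k). b k m * c m w))" .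
  qed
  show "a + b + c = a + (b + c)" "a + b = b + a" "0 + a = a" "- a + a = 0" "a - b = a + - b"
    by (transfer, simp add: algebra_simps)+
  have delta: "(if m = k then (1 :: 'b) else 0) * x = (if k = m then x else 0)"
    "x * (if m = k then 1 else 0) = (if m = k then x else 0)" for m k :: "'a list" and x
    by auto
  show "1 * a = a"
    by transfer (simp add: fun_eq_iff delta)
  show "a * 1 = a"
  proof (transfer, intro ext)
    fix a :: "'a list \<Rightarrow> 'a list \<Rightarrow> 'b" and u w
    assume "\<forall>u w. length u \<noteq> length w \<longrightarrow> a u w = 0"
    then show "(\<Sum>m\<in>words (length u). a u m * (if m = w then 1 else 0)) = a u w"
      by (simp add: delta)
  qed
  show "(a + b) * c = a * c + b * c" "a * (b + c) = a * b + a * c"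
    by (transfer, simp add: algebra_simps sum.distrib)+
  show "(0 :: ('a, 'b) gop) \<noteq> 1"
    by transfer (metis zero_neq_one)
qed

end

lemmas entry_simps [simp] =
  zero_gop.rep_eq one_gop.rep_eq plus_gop.rep_eq uminus_gop.rep_eq minus_gop.rep_eq
lemmas entry_mult = times_gop.rep_eq

lemma entry_sum: "entry (sum f A) u w = (\<Sum>x\<in>A. entry (f x) u w)"
  by (induction A rule: infinite_finite_induct) auto

lift_definition gscale :: "'c::comm_ring_1 \<Rightarrow> ('n::finite, 'c) gop \<Rightarrow> ('n, 'c) gop"
  is "\<lambda>c X u w. c * X u w" by simp

lemmas entry_gscale [simp] = gscale.rep_eq

lemma gscale_mult_left: "gscale c X * Y = gscale c (X * Y)"
  by (rule gop_eqI) (simp add: entry_mult sum_distrib_left mult.assoc)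

lemma gscale_mult_right: "X * gscale c Y = gscale c (X * Y)"
  by (rule gop_eqI) (simp add: entry_mult sum_distrib_left mult_ac)

lemma gscale_gscale: "gscale c (gscale d X) = gscale (c * d) X"
  by (rule gop_eqI) (simp add: mult.assoc)

lemma gscale_add_right: "gscale c (X + Y) = gscale c X + gscale c Y"
  and gscale_add_left: "gscale (c + d) X = gscale c X + gscale d X"
  and gscale_diff_right: "gscale c (X - Y) = gscale c X - gscale c Y"
  and gscale_minus_left: "gscale (- c) X = - gscale c X"
  and gscale_minus_right: "gscale c (- X) = - gscale c X"
  and gscale_one: "gscale 1 X = X"
  and gscale_zero_left: "gscale 0 X = 0"
  and gscale_zero_right: "gscale c 0 = 0"
  by (rule gop_eqI, simp add: algebra_simps)+

section \<open>Operators acting in two factors\<close>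

text \<open>Positions are counted from 0, so that in words with an auxiliary first letter the k-th factor
  of the tensor product has position k.  The operator is 0 on words too short to have the
  positions k and l; the quadratic relations below then hold in all degrees.\<close>

lift_definition act ::
  "nat \<Rightarrow> nat \<Rightarrow> ('n \<times> 'n \<Rightarrow> 'n \<times> 'n \<Rightarrow> 'c) \<Rightarrow> ('n::finite, 'c::comm_ring_1) gop"
  is "\<lambda>k l X u w. if length u = length w \<and> k < length w \<and> l < length w \<and>
        (\<forall>m < length w. m \<noteq> k \<and> m \<noteq> l \<longrightarrow> u ! m = w ! m)
      then X (u ! k, u ! l) (w ! k, w ! l) else 0"
  by auto

lemmas entry_act = act.rep_eq

text \<open>A word that agrees with \<open>u\<close> off two positions is \<open>u\<close> with two
  letters rewritten, so the sum over intermediate words in a product with \<open>act\<close>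
  collapses to two letters.\<close>

lemma sum_two_positions:
  fixes f :: "'n::finite list \<Rightarrow> 'c::comm_ring_1"
  assumes "k \<noteq> l" "k < length u" "l < length u"
  shows "(\<Sum>m | length m = length u \<and> (\<forall>i<length u. i \<noteq> k \<and> i \<noteq> l \<longrightarrow> u ! i = m ! i). f m)
    = (\<Sum>c\<in>UNIV. \<Sum>d\<in>UNIV. f (u[k := c, l := d]))"
proof -
  have "(\<Sum>c\<in>UNIV. \<Sum>d\<in>UNIV. f (u[k := c, l := d]))
      = (\<Sum>p\<in>UNIV. f (u[k := fst p, l := snd p]))"
    by (simp add: sum.cartesian_product case_prod_unfold)
  also have "\<dots> = (\<Sum>m | length m = length u \<and> (\<forall>i<length u. i \<noteq> k \<and> i \<noteq> l \<longrightarrow> u ! i = m ! i). f m)"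
  proof (rule sum.reindex_bij_witness[where j = "\<lambda>p. u[k := fst p, l := snd p]" and i = "\<lambda>m. (m ! k, m ! l)"])
    fix m assume m: "m \<in> {m. length m = length u \<and> (\<forall>i<length u. i \<noteq> k \<and> i \<noteq> l \<longrightarrow> u ! i = m ! i)}"
    then have "u[k := m ! k, l := m ! l] ! i = m ! i" if "i < length u" for i
      using assms that by (auto simp: nth_list_update)
    then show "u[k := fst (m ! k, m ! l), l := snd (m ! k, m ! l)] = m"
      using m by (intro nth_equalityI) auto
  qed (use assms in \<open>auto simp: nth_list_update\<close>)
  finally show ?thesis by simp
qed

lemma entry_act_mult:
  assumes "k \<noteq> l" "k < length u" "l < length u"
  shows "entry (act k l X * Y) u w =
    (\<Sum>c\<in>UNIV. \<Sum>d\<in>UNIV. X (u ! k, u ! l) (c, d) * entry Y (u[k := c, l := d]) w)"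
proof -
  have "entry (act k l X * Y) u w = (\<Sum>m\<in>words (length u). entry (act k l X) u m * entry Y m w)"
    by (simp add: entry_mult)
  also have "\<dots> = (\<Sum>m | length m = length u \<and> (\<forall>i<length u. i \<noteq> k \<and> i \<noteq> l \<longrightarrow> u ! i = m ! i).
      X (u ! k, u ! l) (m ! k, m ! l) * entry Y m w)"
    by (rule sum.mono_neutral_cong_right) (use assms in \<open>auto simp: entry_act\<close>)
  also have "\<dots> = (\<Sum>c\<in>UNIV. \<Sum>d\<in>UNIV. X (u ! k, u ! l) (c, d) * entry Y (u[k := c, l := d]) w)"
    by (subst sum_two_positions) (use assms in \<open>auto simp: nth_list_update\<close>)
  finally show ?thesis .
qed

lemma entry_act_short: "\<not> (k < length u \<and> l < length u) \<Longrightarrow> entry (act k l X) u w = 0"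
  "\<not> (k < length w \<and> l < length w) \<Longrightarrow> entry (act k l X) u w = 0"
  by (auto simp: entry_act)

lemma entry_act_mult_short:
  "\<not> (k < length u \<and> l < length u) \<Longrightarrow> entry (act k l X * Y) u w = 0"
  by (simp add: entry_mult entry_act_short)

lemma entry_mult_act_short:
  assumes "\<not> (k < length u \<and> l < length u)"
  shows "entry (Y * act k l X) u w = 0"
  unfolding entry_mult
proof (rule sum.neutral, rule ballI)
  fix m :: "'a list" assume "m \<in> words (length u)"
  then show "entry Y u m * entry (act k l X) m w = 0" using assms by (auto simp: entry_act)
qed

definition agree_off :: "nat set \<Rightarrow> 'n list \<Rightarrow> 'n list \<Rightarrow> bool" where
  "agree_off S u w \<longleftrightarrow> length u = length w \<and> (\<forall>m<length w. m \<notin> S \<longrightarrow> u ! m = w ! m)"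

lemma entry_act_agree:
  "entry (act k l X) u w =
    (if agree_off {k, l} u w \<and> k < length u \<and> l < length u then X (u ! k, u ! l) (w ! k, w ! l) else 0)"
  by (auto simp: entry_act agree_off_def)

text \<open>In a sum over the rewritten letter \<open>c\<close> this leaves a single term, the one
  with the letter of \<open>w\<close>.\<close>

lemma agree_off_update:
  assumes "k < length u" "k \<notin> S"
  shows "agree_off S (u[k := c]) w \<longleftrightarrow> agree_off (insert k S) u w \<and> c = w ! k"
proof
  assume L: "agree_off S (u[k := c]) w"
  then have len: "length u = length w" by (simp add: agree_off_def)
  have "u[k := c] ! m = w ! m" if "m < length w" "m \<notin> S" for m
    using L that by (simp add: agree_off_def)
  from this[of k] this show "agree_off (insert k S) u w \<and> c = w ! k"
    using assms len unfolding agree_off_def by (metis insert_iff nth_list_update_eq nth_list_update_neq)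
next
  assume "agree_off (insert k S) u w \<and> c = w ! k"
  then show "agree_off S (u[k := c]) w"
    unfolding agree_off_def using assms by (metis insert_iff length_list_update nth_list_update_eq nth_list_update_neq)
qed

text \<open>The intermediate word is determined: it has the letters of \<open>w\<close> at
  \<open>k\<close>, \<open>l\<close> and those of \<open>u\<close> elsewhere. The result is
  symmetric in the two operators, which gives \<open>act_commute\<close>.\<close>

lemma entry_act_act:
  assumes d: "distinct [k, l, k', l']"
  shows "entry (act k l X * act k' l' Y) u w =
     (if agree_off {k, l, k', l'} u w \<and> k < length u \<and> l < length u \<and> k' < length u \<and> l' < length u
      then X (u!k, u!l) (w!k, w!l) * Y (u!k', u!l') (w!k', w!l') else 0)"
proof -
  consider "k < length u \<and> l < length u" "k' < length u \<and> l' < length u"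
    | "\<not> (k < length u \<and> l < length u)" | "\<not> (k' < length u \<and> l' < length u)"
    by blast
  then show ?thesis
  proof cases
    case 1
    have ag: "agree_off {k', l'} (u[k := c, l := d']) w \<longleftrightarrow> agree_off {k, l, k', l'} u w \<and> d' = w ! l \<and> c = w ! k"
      for c d'
    proof -
      have "{l, k', l'} = insert l {k', l'}" "{k, l, k', l'} = insert k {l, k', l'}" by auto
      moreover have "k \<notin> {l, k', l'}" "l \<notin> {k', l'}" using d by auto
      ultimately show ?thesis
        using 1 agree_off_update[of l "u[k := c]" "{k', l'}" d' w] agree_off_update[of k u "{l, k', l'}" c w]
        by auto
    qed
    have "entry (act k l X * act k' l' Y) u w =
        (\<Sum>c\<in>UNIV. \<Sum>d\<in>UNIV. X (u ! k, u ! l) (c, d) * entry (act k' l' Y) (u[k := c, l := d]) w)"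
      by (rule entry_act_mult) (use d 1 in auto)
    also have "\<dots> = (\<Sum>c\<in>UNIV. \<Sum>d\<in>UNIV. if d = w ! l then if c = w ! k then
       (if agree_off {k, l, k', l'} u w
        then X (u!k, u!l) (w!k, w!l) * Y (u!k', u!l') (w!k', w!l') else 0) else 0 else 0)"
      by (intro sum.cong refl) (use d 1 in \<open>simp add: entry_act_agree ag\<close>)
    finally show ?thesis using 1 by simp
  next
    case 2
    then show ?thesis by (auto simp: entry_act_mult_short)
  next
    case 3
    then show ?thesis using entry_mult_act_short[OF 3] by auto
  qed
qed

lemma act_commute:
  assumes "distinct [k, l, k', l']"
  shows "act k l X * act k' l' Y = act k' l' Y * act k l X"
proof (rule gop_eqI)
  fix u w :: "'a list"
  have d: "distinct [k', l', k, l]" using assms by auto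
  have "{k', l', k, l} = {k, l, k', l'}" by auto
  then show "entry (act k l X * act k' l' Y) u w = entry (act k' l' Y * act k l X) u w"
    unfolding entry_act_act[OF assms] entry_act_act[OF d] by (intro if_cong) (auto simp only: mult.commute conj_ac)
qed

section \<open>The permutation operators P\<close>

definition P_sq :: "'n \<times> 'n \<Rightarrow> 'n \<times> 'n \<Rightarrow> 'c::zero_neq_one" where
  "P_sq p q = (if p = (snd q, fst q) then 1 else 0)"

text \<open>An operator of rank one: \<open>g\<close> contracts the two input letters, and
  \<open>h\<close> is the tensor inserted in their place.\<close>

definition Q_sq :: "('n \<Rightarrow> 'n \<Rightarrow> 'c::times) \<Rightarrow> ('n \<Rightarrow> 'n \<Rightarrow> 'c) \<Rightarrow> 'n \<times> 'n \<Rightarrow> 'n \<times> 'n \<Rightarrow> 'c" where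
  "Q_sq h g p q = h (fst p) (snd p) * g (fst q) (snd q)"

abbreviation "Pop k l \<equiv> act k l P_sq"

definition swap_at :: "nat \<Rightarrow> nat \<Rightarrow> 'n list \<Rightarrow> 'n list" where
  "swap_at a b u = u[a := u ! b, b := u ! a]"

lemma length_swap_at [simp]: "length (swap_at a b u) = length u"
  by (simp add: swap_at_def)

lemma nth_swap_at:
  assumes "a < length u" "b < length u"
  shows "swap_at a b u ! m = u ! Transposition.transpose a b m"
proof (cases "m = a \<or> m = b")
  case True
  then show ?thesis using assms by (auto simp: swap_at_def nth_list_update)
next
  case False
  then show ?thesis by (auto simp: swap_at_def)
qed

lemma transpose_less: "a < (n::nat) \<Longrightarrow> b < n \<Longrightarrow> Transposition.transpose a b m < n \<longleftrightarrow> m < n"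
  by (simp add: Transposition.transpose_def)

lemma swap_at_swap_at:
  assumes "a < length u" "b < length u"
  shows "swap_at a b (swap_at a b u) = u"
  using assms by (intro nth_equalityI) (simp_all add: nth_swap_at)

lemma entry_P:
  assumes "k \<noteq> l"
  shows "entry (Pop k l) u w = (if k < length u \<and> l < length u \<and> w = swap_at k l u then 1 else 0)"
proof (cases "length u = length w \<and> k < length u \<and> l < length u")
  case True
  have "(agree_off {k, l} u w \<and> (u ! k, u ! l) = (w ! l, w ! k)) \<longleftrightarrow> w = swap_at k l u" (is "?A \<longleftrightarrow> ?B")
  proof
    assume A: ?A
    show ?B
    proof (rule nth_equalityI)
      show "w ! m = swap_at k l u ! m" if "m < length w" for m
        using A that True by (cases "m = k"; cases "m = l") (auto simp: swap_at_def agree_off_def nth_list_update)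
    qed (use True in simp)
  next
    assume B: ?B
    show ?A unfolding B using True assms by (auto simp: swap_at_def agree_off_def)
  qed
  then show ?thesis using True by (auto simp: entry_act_agree P_sq_def)
next
  case False
  then show ?thesis by (auto simp: entry_act_agree agree_off_def)
qed

lemma entry_P_mult:
  assumes "k \<noteq> l"
  shows "entry (Pop k l * Y) u w = (if k < length u \<and> l < length u then entry Y (swap_at k l u) w else 0)"
proof -
  have "entry (Pop k l * Y) u w = (\<Sum>m\<in>words (length u). if m = swap_at k l u then
     (if k < length u \<and> l < length u then entry Y m w else 0) else 0)"
    unfolding entry_mult by (intro sum.cong) (auto simp: entry_P[OF assms])
  then show ?thesis by simp
qed

lemma entry_P':
  assumes "k \<noteq> l"
  shows "entry (Pop k l) u w = (if k < length w \<and> l < length w \<and> u = swap_at k l w then 1 else 0)"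
proof -
  have "k < length u \<and> l < length u \<and> w = swap_at k l u \<longleftrightarrow> k < length w \<and> l < length w \<and> u = swap_at k l w"
    by (metis length_swap_at swap_at_swap_at)
  then show ?thesis unfolding entry_P[OF assms] by simp
qed

lemma entry_mult_P:
  assumes "k \<noteq> l"
  shows "entry (Y * Pop k l) u w = (if k < length w \<and> l < length w then entry Y u (swap_at k l w) else 0)"
proof (cases "length u = length w")
  case True
  have "entry (Y * Pop k l) u w = (\<Sum>m\<in>words (length u). if m = swap_at k l w then
     (if k < length w \<and> l < length w then entry Y u m else 0) else 0)"
    unfolding entry_mult using True
    by (intro sum.cong) (auto simp: entry_P'[OF assms])
  then show ?thesis using True by simp
qed (auto simp: entry_eq_0)

text \<open>P permutes the letters of a word, so passing it relabels the positions of any other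
  operator. With three positions in play this yields the relations in which P moves past P or
  Q.\<close>

lemma act_conj:
  assumes "a \<noteq> b" "k \<noteq> l"
  shows "Pop a b * act k l X = act (Transposition.transpose a b k) (Transposition.transpose a b l) X * Pop a b"
proof (rule gop_eqI)
  fix u w :: "'a list" assume len: "length u = length w"
  let ?t = "Transposition.transpose a b"
  show "entry (Pop a b * act k l X) u w = entry (act (?t k) (?t l) X * Pop a b) u w"
  proof (cases "a < length u \<and> b < length u")
    case True
    have "agree_off {k, l} (swap_at a b u) w \<longleftrightarrow> agree_off {?t k, ?t l} u (swap_at a b w)" (is "?A \<longleftrightarrow> ?B")
    proof
      assume A: ?A
      show ?B unfolding agree_off_def
      proof (intro conjI allI impI)
        fix m assume m: "m < length (swap_at a b w)" "m \<notin> {?t k, ?t l}"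
        then have "?t m \<notin> {k, l}" by (auto simp: transpose_eq_iff)
        moreover have "?t m < length w" using m True len by (simp add: transpose_less)
        ultimately have "swap_at a b u ! ?t m = w ! ?t m" using A by (simp add: agree_off_def)
        then show "u ! m = swap_at a b w ! m" using True len by (simp add: nth_swap_at)
      qed (use len in simp)
    next
      assume B: ?B
      show ?A unfolding agree_off_def
      proof (intro conjI allI impI)
        fix m assume m: "m < length w" "m \<notin> {k, l}"
        then have "?t m \<notin> {?t k, ?t l}" by (auto simp: transpose_eq_iff)
        moreover have "?t m < length w" using m True len by (simp add: transpose_less)
        ultimately have "u ! ?t m = swap_at a b w ! ?t m" using B by (simp add: agree_off_def)
        then show "swap_at a b u ! m = w ! m" using True len by (simp add: nth_swap_at)
      qed (use len in simp)
    qed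
    then show ?thesis using True len
      by (auto simp: entry_P_mult entry_mult_P assms entry_act_agree nth_swap_at transpose_less)
  next
    case False
    then show ?thesis using len by (auto simp: entry_P_mult entry_mult_P assms)
  qed
qed

lemma act_symmetric:
  assumes "\<And>a b c d. X (a, b) (c, d) = X (b, a) (d, c)"
  shows "act k l X = act l k X"
  by (rule gop_eqI) (auto simp: entry_act assms conj_ac)

lemma Pop_sym: "Pop k l = Pop l k"
  by (rule act_symmetric) (auto simp: P_sq_def)

lemma agree_off_update_in: "k \<in> S \<Longrightarrow> agree_off S (u[k := c]) w \<longleftrightarrow> agree_off S u w"
  by (auto simp: agree_off_def) (metis nth_list_update_neq)+

section \<open>The contraction operators Q\<close>

text \<open>\<open>g\<close> will be the Gram matrix of the form and \<open>h\<close> the array of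
  components of the sum of the u_i tensor v_i; \<open>gh\<close> says that they are inverse up to
  transposition. The ring is general because both complex numbers and power series occur.\<close>

locale dual_tensors =
  fixes g h :: "'n::finite \<Rightarrow> 'n \<Rightarrow> 'c::comm_ring_1" and \<epsilon> :: 'c
  assumes gh: "(\<Sum>d\<in>UNIV. g a d * h b d) = (if a = b then 1 else 0)"
    and g_sym: "g b a = \<epsilon> * g a b" and h_sym: "h b a = \<epsilon> * h a b"
    and eps: "\<epsilon> * \<epsilon> = 1"
begin

abbreviation "Qop k l \<equiv> act k l (Q_sq h g)"

text \<open>Exchanging the factors costs one sign from \<open>h\<close> and one from
  \<open>g\<close>, and these cancel.\<close>

lemma Qop_sym: "Qop k l = Qop l k"
proof (rule act_symmetric)
  fix a b c d
  have "h a b * g c d = (\<epsilon> * \<epsilon>) * (h a b * g c d)" by (simp add: eps)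
  also have "\<dots> = h b a * g d c" by (simp only: h_sym[of b a] g_sym[of d c] mult_ac)
  finally show "Q_sq h g (a, b) (c, d) = Q_sq h g (b, a) (d, c)"
    by (simp add: Q_sq_def)
qed

lemma entry_Q_mult:
  assumes "k \<noteq> l" "k < length u" "l < length u"
  shows "entry (Qop k l * Y) u w =
    h (u ! k) (u ! l) * (\<Sum>c\<in>UNIV. \<Sum>d\<in>UNIV. g c d * entry Y (u[k := c, l := d]) w)"
  by (simp add: entry_act_mult[OF assms] Q_sq_def sum_distrib_left mult.assoc)

text \<open>Contracting \<open>h\<close> with \<open>g\<close> is the trace of the identity matrix,
  hence the scalar N.\<close>

lemma Q_Q:
  assumes "k \<noteq> l"
  shows "Qop k l * Qop k l = gscale (of_nat CARD('n)) (Qop k l)"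
proof (rule gop_eqI)
  fix u w :: "'n list"
  show "entry (Qop k l * Qop k l) u w = entry (gscale (of_nat CARD('n)) (Qop k l)) u w"
  proof (cases "k < length u \<and> l < length u \<and> agree_off {k, l} u w")
    case True
    then have "entry (Qop k l * Qop k l) u w =
       (\<Sum>c\<in>UNIV. \<Sum>d\<in>UNIV. g c d * h c d) * (h (u ! k) (u ! l) * g (w ! k) (w ! l))"
      using assms by (simp add: entry_Q_mult entry_act_agree agree_off_update_in Q_sq_def
          sum_distrib_left sum_distrib_right mult_ac)
    then show ?thesis using True by (simp add: gh entry_act_agree Q_sq_def)
  next
    case False
    show ?thesis
    proof (cases "k < length u \<and> l < length u")
      case True
      with False show ?thesis
        using assms by (simp add: entry_Q_mult entry_act_agree agree_off_update_in Q_sq_def)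
    next
      case False
      then show ?thesis by (simp add: entry_act_mult_short entry_act_short)
    qed
  qed
qed

text \<open>Conjugation by \<open>Pop k l\<close> exchanges the two positions, to which
  \<open>Qop\<close> is indifferent. In fact P Q is \<open>\<epsilon>\<close> Q, but commutation
  avoids the sign.\<close>

lemma P_Q_commute: "k \<noteq> l \<Longrightarrow> Pop k l * Qop k l = Qop k l * Pop k l"
  using act_conj[of k l k l "Q_sq h g"] Qop_sym[of k l] by simp

text \<open>\<open>Qop k l\<close> leaves \<open>h\<close> in the factors k and l. Contracting its
  leg in l with the letter of factor i carries that letter into factor k, and a new \<open>h\<close>
  is inserted in i and l: this is the output of \<open>Qop k l\<close> with i and k
  exchanged.\<close>

lemma Q_Q_left:
  assumes "distinct [i, k, l]"
  shows "Qop i l * Qop k l = Pop i k * Qop k l"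
proof (rule gop_eqI)
  fix u w :: "'n list"
  consider "\<not> (k < length u \<and> l < length u)" | "\<not> (i < length u \<and> l < length u)"
    | "i < length u" "k < length u" "l < length u" by blast
  then show "entry (Qop i l * Qop k l) u w = entry (Pop i k * Qop k l) u w"
  proof cases
    case 1
    then show ?thesis by (simp add: entry_mult_act_short)
  next
    case 2
    then have "entry (Pop i k * Qop k l) u w = 0"
      using assms by (auto simp: entry_P_mult entry_act_short)
    with 2 show ?thesis by (simp add: entry_act_mult_short)
  next
    case 3
    have ag: "agree_off {k, l} (u[i := c, l := d]) w \<longleftrightarrow> agree_off {i, k, l} u w \<and> c = w ! i" for c d
      using assms 3 by (simp add: agree_off_update_in agree_off_update)
    have ag': "agree_off {k, l} (swap_at i k u) w \<longleftrightarrow> agree_off {i, k, l} u w \<and> u ! k = w ! i"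
      using assms 3 by (simp add: swap_at_def agree_off_update_in agree_off_update)
    have "entry (Qop i l * Qop k l) u w = h (u ! i) (u ! l) *
        (\<Sum>c\<in>UNIV. \<Sum>d\<in>UNIV. if c = w ! i then
            (if agree_off {i, k, l} u w then g c d * (h (u ! k) d * g (w ! k) (w ! l)) else 0) else 0)"
      using assms 3 by (simp add: entry_Q_mult entry_act_agree ag Q_sq_def if_distrib[of "\<lambda>x. _ * x"] if_if_eq_conj conj_ac cong: if_cong)
    also have "\<dots> = h (u ! i) (u ! l) *
            (if agree_off {i, k, l} u w then (\<Sum>d\<in>UNIV. g (w ! i) d * h (u ! k) d) * g (w ! k) (w ! l) else 0)"
      by (subst sum.swap) (simp add: sum_distrib_left sum_distrib_right mult_ac)
    also have "\<dots> = entry (Pop i k * Qop k l) u w"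
      using assms 3 by (auto simp: gh entry_P_mult entry_act_agree ag' Q_sq_def nth_swap_at Transposition.transpose_def)
    finally show ?thesis .
  qed
qed

text \<open>The mirror image on the input side: the \<open>h\<close> inserted in i and l is
  contracted in l with the letter of factor k, which is thereby carried into factor i.\<close>

lemma Q_Q_right:
  assumes "distinct [i, k, l]"
  shows "Qop k l * Qop i l = Qop k l * Pop i k"
proof (rule gop_eqI)
  fix u w :: "'n list"
  consider "\<not> (k < length u \<and> l < length u)" | "\<not> (i < length u)"
    | "i < length u" "k < length u" "l < length u" by blast
  then show "entry (Qop k l * Qop i l) u w = entry (Qop k l * Pop i k) u w"
  proof cases
    case 1
    then show ?thesis by (simp add: entry_act_mult_short)
  next
    case 2
    then show ?thesis by (simp add: entry_mult_act_short)
  next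
    case 3
    show ?thesis
    proof (cases "length u = length w")
    case len: True
    have ag: "agree_off {i, l} (u[k := c, l := d]) w \<longleftrightarrow> agree_off {i, k, l} u w \<and> c = w ! k" for c d
      using assms 3 by (simp add: agree_off_update_in agree_off_update insert_commute)
    have ag': "u[k := c, l := d] = swap_at i k w \<longleftrightarrow> agree_off {i, k, l} u w \<and> u ! i = w ! k \<and> c = w ! i \<and> d = w ! l"
       (is "?A \<longleftrightarrow> ?B") for c d
    proof -
      have "?A \<longleftrightarrow> (\<forall>m<length w. u[k := c, l := d] ! m = w ! Transposition.transpose i k m)"
        using len 3 by (auto simp: list_eq_iff_nth_eq nth_swap_at)
      also have "\<dots> \<longleftrightarrow> ?B"
      proof
        assume A: "\<forall>m<length w. u[k := c, l := d] ! m = w ! Transposition.transpose i k m"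
        have "u ! m = w ! m" if "m < length w" "m \<notin> {i, k, l}" for m
          using A[rule_format, of m] that by simp
        then show ?B using A[rule_format, of i] A[rule_format, of k] A[rule_format, of l] 3 assms len
          by (simp add: agree_off_def)
      next
        assume B: ?B
        show "\<forall>m<length w. u[k := c, l := d] ! m = w ! Transposition.transpose i k m"
        proof (intro allI impI)
          fix m assume "m < length w"
          then show "u[k := c, l := d] ! m = w ! Transposition.transpose i k m"
            using B 3 assms len by (cases "m = i"; cases "m = k"; cases "m = l") (auto simp: agree_off_def)
        qed
      qed
      finally show ?thesis .
    qed
    have "entry (Qop k l * Qop i l) u w = h (u ! k) (u ! l) *
        (\<Sum>c\<in>UNIV. \<Sum>d\<in>UNIV. if c = w ! k then
            (if agree_off {i, k, l} u w then g c d * (h (u ! i) d * g (w ! i) (w ! l)) else 0) else 0)"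
      using assms 3 by (simp add: entry_Q_mult entry_act_agree ag Q_sq_def if_distrib[of "\<lambda>x. _ * x"] if_if_eq_conj conj_ac cong: if_cong)
    also have "\<dots> = h (u ! k) (u ! l) *
            (if agree_off {i, k, l} u w then (\<Sum>d\<in>UNIV. g (w ! k) d * h (u ! i) d) * g (w ! i) (w ! l) else 0)"
      by (subst sum.swap) (simp add: sum_distrib_left sum_distrib_right mult_ac)
    also have "\<dots> = h (u ! k) (u ! l) * (\<Sum>c\<in>UNIV. \<Sum>d\<in>UNIV. if d = w ! l then if c = w ! i then
         (if agree_off {i, k, l} u w \<and> u ! i = w ! k then g c d else 0) else 0 else 0)"
      by (auto simp: gh)
    also have "\<dots> = h (u ! k) (u ! l) * (\<Sum>c\<in>UNIV. \<Sum>d\<in>UNIV. g c d * entry (Pop i k) (u[k := c, l := d]) w)"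
    proof -
      have e: "entry (Pop i k) (u[k := c, l := d]) w =
         (if agree_off {i, k, l} u w \<and> u ! i = w ! k \<and> c = w ! i \<and> d = w ! l then 1 else 0)" for c d
        using ag'[of c d] 3 assms len by (simp add: entry_P')
      show ?thesis unfolding e by (intro arg_cong2[of _ _ _ _ "(*)"] refl sum.cong) auto
    qed
    also have "\<dots> = entry (Qop k l * Pop i k) u w"
      using assms 3 by (simp add: entry_Q_mult)
    finally show ?thesis .
    qed (simp add: entry_eq_0)
  qed
qed

end

section \<open>Exchange relations\<close>

lemma expand_triple:
  "(1 + gscale a A) * (1 + gscale b B) * (1 + gscale c C) =
    1 + gscale a A + gscale b B + gscale c C + gscale (a * b) (A * B) + gscale (a * c) (A * C)
      + gscale (b * c) (B * C) + gscale (a * b * c) (A * (B * C))"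
  by (simp add: distrib_left distrib_right gscale_mult_left gscale_mult_right gscale_gscale
      mult.assoc gscale_add_right add_ac mult.commute mult.left_commute)

text \<open>In the next three lemmas \<open>A\<close>, \<open>B\<close> act in an auxiliary and a quantum factor and \<open>C\<close> acts in the
  two quantum factors; the relations are those of P and of its partial transpose Q.\<close>

lemma yang_baxter_P:
  fixes A B C :: "('n::finite, 'c::comm_ring_1) gop"
  assumes rel: "C * A = B * C" "C * B = A * C" "B * A = A * C" "A * B = B * C"
    and abc: "c * b + b * a = a * c"
  shows "(1 + gscale c C) * (1 + gscale b B) * (1 + gscale a A) =
    (1 + gscale a A) * (1 + gscale b B) * (1 + gscale c C)"
proof -
  \<comment> \<open>The cubic terms agree by the relations alone. All quadratic terms become
    \<open>A * C\<close> or \<open>B * C\<close>, and comparing the coefficient of either gives the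
    same condition \<open>abc\<close>.\<close>
  have cubic: "C * (A * C) = A * (B * C)"
    by (metis rel mult.assoc)
  have "gscale (c * b) X + gscale (c * a) Y + gscale (b * a) X =
    gscale (a * b) Y + gscale (a * c) X + gscale (b * c) Y" for X Y :: "('n, 'c) gop"
  proof -
    have "gscale (c * b) X + gscale (c * a) Y + gscale (b * a) X = gscale (c * b + b * a) X + gscale (a * c) Y"
      by (simp add: gscale_add_left mult.commute add_ac)
    also have "\<dots> = gscale (a * c) X + gscale (c * b + b * a) Y" by (simp add: abc)
    finally show ?thesis by (simp add: gscale_add_left mult.commute add_ac)
  qed
  then show ?thesis
    unfolding expand_triple rel cubic by (simp add: add_ac mult_ac)
qed

lemma yang_baxter_PQ:
  fixes A B C :: "('n::finite, 'c::comm_ring_1) gop"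
  assumes rel: "C * A = B * C" "C * B = A * C" "B * A = B * C" "A * B = A * C"
    and abc: "c * b + a * b = a * c"
  shows "(1 + gscale c C) * (1 + gscale a A) * (1 + gscale b B) =
    (1 + gscale b B) * (1 + gscale a A) * (1 + gscale c C)"
proof -
  have cubic: "C * (A * C) = B * (A * C)"
    by (metis rel mult.assoc)
  have "gscale (c * a) Y + gscale (c * b) X + gscale (a * b) X =
    gscale (b * a) Y + gscale (b * c) Y + gscale (a * c) X" for X Y :: "('n, 'c) gop"
  proof -
    have "gscale (c * a) Y + gscale (c * b) X + gscale (a * b) X = gscale (c * b + a * b) X + gscale (a * c) Y"
      by (simp add: gscale_add_left mult.commute add_ac)
    also have "\<dots> = gscale (a * c) X + gscale (c * b + a * b) Y" by (simp add: abc)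
    finally show ?thesis by (simp add: gscale_add_left mult.commute add_ac)
  qed
  then show ?thesis
    unfolding expand_triple rel cubic by (simp add: add_ac mult_ac)
qed

lemma reflection_exchange:
  fixes A P C :: "('n::finite, 'c::comm_ring_1) gop"
  assumes rel: "A * C = P * C" "C * A = C * P" "A * P = P * C" "P * A = C * P" "C * C = gscale d C"
    and abc: "c * p + c * b + p * b + d * (c * p * b) = 0"
  shows "(1 + gscale c C) * (1 + gscale p P) * (1 + gscale b A) =
    (1 + gscale b A) * (1 + gscale p P) * (1 + gscale c C)"
proof -
  \<comment> \<open>Beyond the linear terms, everything on the left is a multiple of
    \<open>C * P\<close> and everything on the right a multiple of \<open>P * C\<close>. These
    products differ, so both coefficients have to vanish; the square of \<open>C\<close> contributes
    the term with \<open>d\<close>.\<close>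
  have cubic: "C * (C * P) = gscale d (C * P)" "A * (P * C) = gscale d (P * C)"
    by (metis rel mult.assoc gscale_mult_left gscale_mult_right)+
  have "gscale (c * p) X + gscale (c * b) X + gscale (p * b) X + gscale (d * (c * p * b)) X = 0"
    for X :: "('n, 'c) gop"
    unfolding gscale_add_left[symmetric] abc by (rule gscale_zero_left)
  from this[of "C * P"] this[of "P * C"] show ?thesis
    unfolding expand_triple rel cubic by (simp add: add_ac mult_ac gscale_gscale)
qed

section \<open>Exchange of ordered products\<close>

lemma prod_list_commute:
  fixes a :: "'r::monoid_mult"
  assumes "\<And>x. x \<in> set xs \<Longrightarrow> a * x = x * a"
  shows "a * prod_list xs = prod_list xs * a"
  using assms
proof (induction xs)
  case (Cons x xs)
  then have "a * prod_list xs = prod_list xs * a" "a * x = x * a" by auto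
  then show ?case by (metis mult.assoc prod_list.Cons)
qed simp

text \<open>The reversed order puts the last \<open>a\<close> and the \<open>X\<close> of the same
  index on the two sides of \<open>Y\<close>. The exchange proceeds from there outwards, as factors
  with different indices commute.\<close>

lemma exchange_backward:
  fixes a X :: "'i \<Rightarrow> 'r::monoid_mult"
  assumes "distinct ks" "\<And>i. i \<in> set ks \<Longrightarrow> a i * Y * X i = X i * Y * a i"
    "\<And>i j. i \<in> set ks \<Longrightarrow> j \<in> set ks \<Longrightarrow> i \<noteq> j \<Longrightarrow> a i * X j = X j * a i"
  shows "prod_list (map a ks) * Y * prod_list (map X (rev ks)) =
    prod_list (map X (rev ks)) * Y * prod_list (map a ks)"
  using assms
proof (induction ks)
  case (Cons k ks)
  let ?A = "prod_list (map a ks)" and ?X = "prod_list (map X (rev ks))"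
  have IH: "?A * (Y * ?X) = ?X * (Y * ?A)"
    using Cons by (auto simp: mult.assoc)
  have 1: "a k * ?X = ?X * a k"
    by (rule prod_list_commute) (use Cons.prems in auto)
  have 2: "X k * ?A = ?A * X k"
    by (rule prod_list_commute) (use Cons.prems(1) in \<open>auto intro!: Cons.prems(3)[symmetric]\<close>)
  have 3: "a k * (Y * X k) = X k * (Y * a k)"
    using Cons.prems(2)[of k] by (simp add: mult.assoc)
  have "a k * ?A * Y * (?X * X k) = a k * (?A * (Y * ?X)) * X k" by (simp add: mult.assoc)
  also have "\<dots> = (a k * ?X) * Y * (?A * X k)" by (simp add: IH mult.assoc)
  also have "\<dots> = ?X * (a k * (Y * X k)) * ?A" by (simp add: 1 2[symmetric] mult.assoc)
  also have "\<dots> = ?X * X k * Y * (a k * ?A)" by (simp add: 3 mult.assoc)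
  finally show ?case by (simp add: mult.assoc)
qed simp

text \<open>Regrouped into pairs \<open>a i * X i\<close>, the factors pass \<open>Y\<close> one
  pair after another, starting from the last index.\<close>

lemma exchange_forward:
  fixes a X :: "'i \<Rightarrow> 'r::monoid_mult"
  assumes "distinct ks" "\<And>i. i \<in> set ks \<Longrightarrow> a i * X i * Y = Y * X i * a i"
    "\<And>i j. i \<in> set ks \<Longrightarrow> j \<in> set ks \<Longrightarrow> i \<noteq> j \<Longrightarrow> a i * X j = X j * a i"
  shows "prod_list (map a ks) * prod_list (map X ks) * Y =
    Y * prod_list (map X ks) * prod_list (map a ks)"
  using assms
proof (induction ks)
  case (Cons k ks)
  let ?A = "prod_list (map a ks)" and ?X = "prod_list (map X ks)"
  have IH: "?A * (?X * Y) = Y * (?X * ?A)"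
    using Cons by (auto simp: mult.assoc)
  have 1: "a k * ?X = ?X * a k"
    by (rule prod_list_commute) (use Cons.prems in auto)
  have 2: "X k * ?A = ?A * X k"
    by (rule prod_list_commute) (use Cons.prems(1) in \<open>auto intro!: Cons.prems(3)[symmetric]\<close>)
  have 3: "a k * (X k * Y) = Y * (X k * a k)"
    using Cons.prems(2)[of k] by (simp add: mult.assoc)
  have "a k * ?A * (X k * ?X) * Y = a k * (?A * X k) * (?X * Y)" by (simp add: mult.assoc)
  also have "\<dots> = a k * X k * (?A * (?X * Y))" by (simp add: 2[symmetric] mult.assoc)
  also have "\<dots> = a k * (X k * Y) * ?X * ?A" by (simp add: IH mult.assoc)
  also have "\<dots> = Y * X k * (a k * ?X) * ?A" by (simp add: 3 mult.assoc)
  also have "\<dots> = Y * (X k * ?X) * (a k * ?A)" by (simp add: 1 mult.assoc)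
  finally show ?case by simp
qed simp

text \<open>The recursion splits off the row of pairs that start with the first index, as the
  inductions below require; \<open>lex_pairs\<close> is the case of an interval.\<close>

fun ordered_pairs :: "'i list \<Rightarrow> ('i \<times> 'i) list" where
  "ordered_pairs [] = []"
| "ordered_pairs (k # ks) = map (Pair k) ks @ ordered_pairs ks"

lemma set_ordered_pairs_subset: "set (ordered_pairs ks) \<subseteq> set ks \<times> set ks"
  by (induction ks) auto

lemma map_case_prod_Pair: "map (case_prod f) (map (Pair k) ks) = map (f k) ks"
  by (induction ks) auto

text \<open>\<open>r k l\<close>, \<open>q k l\<close> are the R-matrices in the quantum factors k and l, and \<open>L k\<close>, \<open>M k\<close>
  the Lax operators of \<open>T\<close> and \<open>T~\<close> in the auxiliary factor and the factor k.\<close>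

locale exchange_relations =
  fixes I :: "'i set" and r q :: "'i \<Rightarrow> 'i \<Rightarrow> 'r::monoid_mult" and L M :: "'i \<Rightarrow> 'r"
  assumes r_commute: "\<lbrakk>k \<in> I; l \<in> I; m \<in> I; distinct [k, l, m]\<rbrakk> \<Longrightarrow> r k l * L m = L m * r k l"
      "\<lbrakk>k \<in> I; l \<in> I; m \<in> I; distinct [k, l, m]\<rbrakk> \<Longrightarrow> r k l * M m = M m * r k l"
    and q_commute: "\<lbrakk>k \<in> I; l \<in> I; m \<in> I; distinct [k, l, m]\<rbrakk> \<Longrightarrow> q k l * L m = L m * q k l"
      "\<lbrakk>k \<in> I; l \<in> I; m \<in> I; distinct [k, l, m]\<rbrakk> \<Longrightarrow> q k l * M m = M m * q k l"
    and LM: "k \<in> I \<Longrightarrow> L k * M k = M k * L k"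
    and rL: "\<lbrakk>k \<in> I; l \<in> I; k \<noteq> l\<rbrakk> \<Longrightarrow> r k l * L l * L k = L k * L l * r k l"
    and rM: "\<lbrakk>k \<in> I; l \<in> I; k \<noteq> l\<rbrakk> \<Longrightarrow> r k l * M k * M l = M l * M k * r k l"
    and qLM: "\<lbrakk>k \<in> I; l \<in> I; k \<noteq> l\<rbrakk> \<Longrightarrow> q k l * L k * M l = M l * L k * q k l"
      "\<lbrakk>k \<in> I; l \<in> I; k \<noteq> l\<rbrakk> \<Longrightarrow> q k l * L l * M k = M k * L l * q k l"
begin

definition Rprod :: "'i list \<Rightarrow> 'r" where "Rprod ks = prod_list (map (case_prod r) (ordered_pairs ks))"
definition Qprod :: "'i list \<Rightarrow> 'r" where "Qprod ks = prod_list (map (case_prod q) (ordered_pairs ks))"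
abbreviation "Lf ks \<equiv> prod_list (map L ks)"
abbreviation "Lb ks \<equiv> prod_list (map L (rev ks))"
abbreviation "Mf ks \<equiv> prod_list (map M ks)"
abbreviation "Mb ks \<equiv> prod_list (map M (rev ks))"

lemma Rprod_Cons: "Rprod (k # ks) = prod_list (map (r k) ks) * Rprod ks"
  and Qprod_Cons: "Qprod (k # ks) = prod_list (map (q k) ks) * Qprod ks"
  by (simp_all add: Rprod_def Qprod_def map_case_prod_Pair del: map_map)

lemma pair_prod_commute:
  assumes "\<And>k l. k \<in> set ks \<Longrightarrow> l \<in> set ks \<Longrightarrow> k \<noteq> l \<Longrightarrow> x * f k l = f k l * x" "distinct ks"
  shows "x * prod_list (map (case_prod f) (ordered_pairs ks)) = prod_list (map (case_prod f) (ordered_pairs ks)) * x"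
proof (rule prod_list_commute, goal_cases)
  case (1 y)
  have "k \<in> set ks \<and> l \<in> set ks \<and> k \<noteq> l" if "(k, l) \<in> set (ordered_pairs ks)" for k l
    using that \<open>distinct ks\<close>
  proof (induction ks)
    case (Cons a ks)
    then show ?case using set_ordered_pairs_subset[of ks] by auto
  qed simp
  with 1 assms(1) show ?case by auto
qed

text \<open>The first index \<open>k\<close> stands last in \<open>Lb\<close>. Its factor commutes
  with the product over the remaining pairs, which does not involve \<open>k\<close>, and then
  passes the row of the \<open>r k l\<close> by \<open>exchange_forward\<close>.\<close>

lemma Rprod_L: "distinct ks \<Longrightarrow> set ks \<subseteq> I \<Longrightarrow> Rprod ks * Lb ks = Lf ks * Rprod ks"
proof (induction ks)
  case (Cons k ks)
  have IH: "Rprod ks * Lb ks = Lf ks * Rprod ks" using Cons by simp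
  have 1: "L k * Rprod ks = Rprod ks * L k"
    unfolding Rprod_def by (rule pair_prod_commute) (use Cons.prems in \<open>auto intro!: r_commute[symmetric]\<close>)
  have 2: "prod_list (map (r k) ks) * Lf ks * L k = L k * Lf ks * prod_list (map (r k) ks)"
    by (rule exchange_forward) (use Cons.prems in \<open>auto intro!: rL r_commute\<close>)
  have "Rprod (k # ks) * Lb (k # ks) = prod_list (map (r k) ks) * (Rprod ks * Lb ks) * L k"
    by (simp add: Rprod_Cons mult.assoc)
  also have "\<dots> = prod_list (map (r k) ks) * Lf ks * (Rprod ks * L k)"
    unfolding IH by (simp add: mult.assoc)
  also have "\<dots> = (prod_list (map (r k) ks) * Lf ks * L k) * Rprod ks"
    unfolding 1[symmetric] by (simp add: mult.assoc)
  also have "\<dots> = Lf (k # ks) * Rprod (k # ks)"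
    unfolding 2 by (simp add: Rprod_Cons mult.assoc)
  finally show ?case .
qed (simp add: Rprod_def)

text \<open>Compared with \<open>rL\<close>, the indices in \<open>rM\<close> are interchanged, so
  the same product turns forward order into backward order. Here \<open>M k\<close> stands between
  the row of the \<open>r k l\<close> and the other factors, which calls for
  \<open>exchange_backward\<close>.\<close>

lemma Rprod_M: "distinct ks \<Longrightarrow> set ks \<subseteq> I \<Longrightarrow> Rprod ks * Mf ks = Mb ks * Rprod ks"
proof (induction ks)
  case (Cons k ks)
  have IH: "Rprod ks * Mf ks = Mb ks * Rprod ks" using Cons by simp
  have 1: "M k * Rprod ks = Rprod ks * M k"
    unfolding Rprod_def by (rule pair_prod_commute) (use Cons.prems in \<open>auto intro!: r_commute[symmetric]\<close>)
  have 2: "prod_list (map (r k) ks) * M k * Mb ks = Mb ks * M k * prod_list (map (r k) ks)"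
    by (rule exchange_backward) (use Cons.prems in \<open>auto intro!: rM r_commute\<close>)
  have "Rprod (k # ks) * Mf (k # ks) = prod_list (map (r k) ks) * (Rprod ks * M k) * Mf ks"
    by (simp add: Rprod_Cons mult.assoc)
  also have "\<dots> = prod_list (map (r k) ks) * M k * (Rprod ks * Mf ks)"
    unfolding 1[symmetric] by (simp add: mult.assoc)
  also have "\<dots> = (prod_list (map (r k) ks) * M k * Mb ks) * Rprod ks"
    unfolding IH by (simp add: mult.assoc)
  also have "\<dots> = Mb (k # ks) * Rprod (k # ks)"
    unfolding 2 by (simp add: Rprod_Cons mult.assoc)
  finally show ?case .
qed (simp add: Rprod_def)

text \<open>The row of the \<open>q k l\<close> first crosses \<open>L k\<close> against all
  \<open>M l\<close>, then all \<open>L l\<close> against \<open>M k\<close>; these are the two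
  cases of \<open>qLM\<close>. The pair with equal indices never meets a \<open>q\<close> and is
  reordered by \<open>LM\<close>.\<close>

lemma Qprod_LM: "distinct ks \<Longrightarrow> set ks \<subseteq> I \<Longrightarrow>
  Qprod ks * (Lf ks * Mb ks) = Mb ks * Lf ks * Qprod ks"
proof (induction ks)
  case (Cons k ks)
  let ?A = "prod_list (map (q k) ks)"
  have IH: "Qprod ks * (Lf ks * Mb ks) = Mb ks * Lf ks * Qprod ks" using Cons by simp
  have 1: "L k * Qprod ks = Qprod ks * L k" "M k * Qprod ks = Qprod ks * M k"
    unfolding Qprod_def by (rule pair_prod_commute; use Cons.prems in \<open>auto intro!: q_commute[symmetric]\<close>)+
  have 2: "?A * L k * Mb ks = Mb ks * L k * ?A"
    by (rule exchange_backward) (use Cons.prems in \<open>auto intro!: qLM q_commute\<close>)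
  have 3: "?A * Lf ks * M k = M k * Lf ks * ?A"
    by (rule exchange_forward) (use Cons.prems in \<open>auto intro!: qLM q_commute\<close>)
  have "Qprod (k # ks) * (Lf (k # ks) * Mb (k # ks)) = ?A * (Qprod ks * L k) * Lf ks * Mb ks * M k"
    by (simp add: Qprod_Cons mult.assoc)
  also have "\<dots> = ?A * L k * (Qprod ks * (Lf ks * Mb ks)) * M k"
    unfolding 1[symmetric] by (simp add: mult.assoc)
  also have "\<dots> = (?A * L k * Mb ks) * Lf ks * (Qprod ks * M k)"
    unfolding IH by (simp add: mult.assoc)
  also have "\<dots> = Mb ks * L k * (?A * Lf ks * M k) * Qprod ks"
    unfolding 2 1(2)[symmetric] by (simp add: mult.assoc)
  also have "\<dots> = Mb ks * (L k * M k) * Lf ks * (?A * Qprod ks)"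
    unfolding 3 by (simp add: mult.assoc)
  also have "\<dots> = Mb (k # ks) * Lf (k # ks) * Qprod (k # ks)"
    using LM[of k] Cons.prems by (simp add: Qprod_Cons mult.assoc)
  finally show ?case .
qed (simp add: Qprod_def)

theorem Qprod_Rprod_intertwines:
  assumes "distinct ks" "set ks \<subseteq> I"
  shows "Qprod ks * Rprod ks * (Lb ks * Mf ks) = (Mb ks * Lf ks) * (Qprod ks * Rprod ks)"
proof -
  have "Qprod ks * Rprod ks * (Lb ks * Mf ks) = Qprod ks * (Rprod ks * Lb ks) * Mf ks"
    by (simp add: mult.assoc)
  also have "\<dots> = Qprod ks * (Lf ks * (Rprod ks * Mf ks))"
    unfolding Rprod_L[OF assms] by (simp add: mult.assoc)
  also have "\<dots> = Qprod ks * (Lf ks * Mb ks) * Rprod ks"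
    unfolding Rprod_M[OF assms] by (simp add: mult.assoc)
  finally show ?thesis unfolding Qprod_LM[OF assms] by (simp add: mult.assoc)
qed

end

text \<open>The expansion of \<open>1 / (x - z)\<close> in \<open>x^(-1)\<close>.\<close>

definition pole :: "complex \<Rightarrow> complex fps" where
  "pole z = Abs_fps (\<lambda>a. if a = 0 then 0 else z ^ (a - 1))"

lemma pole_mult: "pole z * (1 - fps_const z * fps_X) = fps_X"
proof (rule fps_ext)
  fix a
  have "pole z * (1 - fps_const z * fps_X) = pole z - fps_const z * (pole z * fps_X)"
    by (simp add: algebra_simps)
  then show "fps_nth (pole z * (1 - fps_const z * fps_X)) a = fps_nth fps_X a"
    by (cases a; cases "a - 1") (simp_all add: pole_def)
qed

text \<open>The resolvent identity, from which the scalar conditions of all three exchange lemmas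
  follow. Denominators may be cleared because complex power series have no zero divisors.\<close>

lemma pole_diff: "pole z - pole w = fps_const (z - w) * (pole z * pole w)"
proof -
  let ?p = "\<lambda>z :: complex. 1 - fps_const z * fps_X"
  have nz: "?p x \<noteq> 0" for x
  proof
    assume "?p x = 0"
    then have "fps_nth (?p x) 0 = 0" by simp
    then show False by simp
  qed
  have alg: "(a - b) * (p * q) = (a * p) * q - (b * q) * p" "c * ((a * p) * (b * q)) = c * (a * b) * (p * q)"
    for a b c p q :: "complex fps"
    by (simp_all add: algebra_simps)
  have "(pole z - pole w) * (?p z * ?p w) = (pole z * ?p z) * ?p w - (pole w * ?p w) * ?p z"
    by (rule alg)
  also have "\<dots> = fps_X * ?p w - fps_X * ?p z"
    by (simp only: pole_mult)
  also have "\<dots> = fps_const (z - w) * (fps_X * fps_X)"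
    by (simp add: algebra_simps flip: fps_const_sub)
  also have "\<dots> = fps_const (z - w) * ((pole z * ?p z) * (pole w * ?p w))"
    by (simp only: pole_mult)
  also have "\<dots> = fps_const (z - w) * (pole z * pole w) * (?p z * ?p w)"
    by (rule alg)
  finally show ?thesis using nz by simp
qed

section \<open>Lax operators and R-matrices\<close>

locale lax_setup = dual_tensors g h \<epsilon>
  for g h :: "'n::finite \<Rightarrow> 'n \<Rightarrow> complex fps" and \<epsilon> +
  fixes z :: "nat \<Rightarrow> complex"
begin

definition "L k = 1 - gscale (pole (z k)) (Pop 0 k)"
definition "M k = 1 + gscale (pole (- z k)) (Qop 0 k)"
definition "r k l = 1 - gscale (fps_const (1 / (z k - z l))) (Pop k l)"
definition "q k l = 1 - gscale (fps_const (1 / (z k + z l + of_nat CARD('n)))) (Qop k l)"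

lemma q_sym: "q k l = q l k"
  by (simp add: q_def Qop_sym[of k l] add.commute)

lemma one_plus_gscale_commute:
  "X * Y = Y * X \<Longrightarrow> (1 + gscale c X) * (1 + gscale d Y) = (1 + gscale d Y) * (1 + gscale c X)"
  by (simp add: algebra_simps gscale_mult_left gscale_mult_right gscale_gscale gscale_add_right mult.commute[of d c])

lemma diff_gscale: "X - gscale c Y = X + gscale (- c) Y"
  by (simp add: gscale_minus_left)

lemmas factors_as_sums = L_def M_def r_def q_def diff_gscale

end

text \<open>Division by zero gives 0, and the scalar conditions of the exchange lemmas fail for such
  a coefficient; the assumptions keep the parameters off the poles.\<close>

locale twisted_setup = lax_setup g h \<epsilon> z
  for g h :: "'n::finite \<Rightarrow> 'n \<Rightarrow> complex fps" and \<epsilon> z +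
  fixes n :: nat
  assumes z_diff: "\<lbrakk>k \<in> {1..n}; l \<in> {1..n}; k \<noteq> l\<rbrakk> \<Longrightarrow> z k - z l \<noteq> 0"
    and z_sum: "\<lbrakk>k \<in> {1..n}; l \<in> {1..n}; k \<noteq> l\<rbrakk> \<Longrightarrow> z k + z l + of_nat CARD('n) \<noteq> 0"
begin

lemma r_exchange_L:
  assumes "k \<in> {1..n}" "l \<in> {1..n}" "k \<noteq> l"
  shows "r k l * L l * L k = L k * L l * r k l"
  unfolding factors_as_sums
proof (rule yang_baxter_P)
  show "Pop k l * Pop 0 k = Pop 0 l * Pop k l" "Pop k l * Pop 0 l = Pop 0 k * Pop k l"
    using act_conj[of k l 0 k P_sq] act_conj[of k l 0 l P_sq] assms by (auto simp: Transposition.transpose_def)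
  have "Pop 0 k * Pop k l = Pop 0 l * Pop 0 k" "Pop 0 l * Pop k l = Pop k 0 * Pop 0 l"
    using act_conj[of 0 k k l P_sq] act_conj[of 0 l k l P_sq] assms
    by (auto simp: Transposition.transpose_def)
  then show "Pop 0 l * Pop 0 k = Pop 0 k * Pop k l" "Pop 0 k * Pop 0 l = Pop 0 l * Pop k l"
    by (metis Pop_sym)+
  have alg: "- c * - b + - b * - a = - a * - c" if "c * (a - b) = fps_const 1 * (a * b)"
    for a b c :: "complex fps"
    using that by (simp add: algebra_simps)
  have "fps_const (1 / (z k - z l)) * (pole (z k) - pole (z l)) =
      fps_const (1 / (z k - z l) * (z k - z l)) * (pole (z k) * pole (z l))"
    unfolding pole_diff mult.assoc[symmetric] by simp
  also have "1 / (z k - z l) * (z k - z l) = 1" using z_diff[OF assms] by simp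
  finally show "- fps_const (1 / (z k - z l)) * - pole (z l) + - pole (z l) * - pole (z k) =
      - pole (z k) * - fps_const (1 / (z k - z l))"
    by (rule alg)
qed

text \<open>This is \<open>r_exchange_L\<close> conjugated in the auxiliary factor, with
  \<open>- x\<close> for x: P_0k becomes Q_0k, and the order of the auxiliary products is
  reversed.\<close>

lemma r_exchange_M:
  assumes "k \<in> {1..n}" "l \<in> {1..n}" "k \<noteq> l"
  shows "r k l * M k * M l = M l * M k * r k l"
  unfolding factors_as_sums
proof (rule yang_baxter_PQ)
  show 1: "Pop k l * Qop 0 k = Qop 0 l * Pop k l" and 2: "Pop k l * Qop 0 l = Qop 0 k * Pop k l"
    using act_conj[of k l 0 k "Q_sq h g"] act_conj[of k l 0 l "Q_sq h g"] assms by (auto simp: Transposition.transpose_def)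
  have "Qop l 0 * Qop k 0 = Pop l k * Qop k 0" "Qop k 0 * Qop l 0 = Pop k l * Qop l 0"
    using Q_Q_left[of l k 0] Q_Q_left[of k l 0] assms by auto
  then have "Qop 0 l * Qop 0 k = Pop k l * Qop 0 k" "Qop 0 k * Qop 0 l = Pop k l * Qop 0 l"
    by (simp_all only: Qop_sym[of l 0] Qop_sym[of k 0] Pop_sym[of l k])
  then show "Qop 0 l * Qop 0 k = Qop 0 l * Pop k l" "Qop 0 k * Qop 0 l = Qop 0 k * Pop k l"
    using 1 2 by simp_all
  have alg: "- c * b + a * b = a * - c" if "c * (a - b) = - fps_const 1 * (a * b)"
    for a b c :: "complex fps"
    using that by (simp add: algebra_simps)
  have "pole (- z k) - pole (- z l) = - fps_const (z k - z l) * (pole (- z k) * pole (- z l))"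
    unfolding pole_diff by simp
  then have "fps_const (1 / (z k - z l)) * (pole (- z k) - pole (- z l)) =
      - (fps_const (1 / (z k - z l)) * fps_const (z k - z l)) * (pole (- z k) * pole (- z l))"
    by (simp only: mult.assoc mult_minus_left mult_minus_right)
  also have "fps_const (1 / (z k - z l)) * fps_const (z k - z l) = fps_const (1 / (z k - z l) * (z k - z l))"
    by (rule fps_const_mult)
  also have "1 / (z k - z l) * (z k - z l) = 1" using z_diff[OF assms] by simp
  finally show "- fps_const (1 / (z k - z l)) * pole (- z l) + pole (- z k) * pole (- z l) =
      pole (- z k) * - fps_const (1 / (z k - z l))"
    by (rule alg)
qed

lemma q_exchange_LM:
  assumes "k \<in> {1..n}" "l \<in> {1..n}" "k \<noteq> l"
  shows "q k l * L k * M l = M l * L k * q k l"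
  unfolding factors_as_sums
proof (rule reflection_exchange)
  let ?s = "z k + z l" and ?N = "of_nat CARD('n) :: complex"
  show "Qop 0 l * Qop k l = Pop 0 k * Qop k l" "Qop k l * Qop 0 l = Qop k l * Pop 0 k"
    using Q_Q_left[of 0 k l] Q_Q_right[of 0 k l] assms by auto
  show "Qop 0 l * Pop 0 k = Pop 0 k * Qop k l" "Pop 0 k * Qop 0 l = Qop k l * Pop 0 k"
    using act_conj[of 0 k k l "Q_sq h g"] act_conj[of 0 k 0 l "Q_sq h g"] assms
    by (auto simp: Transposition.transpose_def)
  show "Qop k l * Qop k l = gscale (fps_const ?N) (Qop k l)"
    using Q_Q[of k l] assms by (simp add: fps_of_nat)
  let ?c = "1 / (?s + ?N)"
  have a: "pole (z k) - pole (- z l) = fps_const ?s * (pole (z k) * pole (- z l))"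
    by (simp add: pole_diff)
  \<comment> \<open>Here the Q-denominator is forced: \<open>?s\<close> arises from the difference
    of the two poles and \<open>?N\<close> from the square of \<open>Qop k l\<close>.\<close>
  have "?c * ?s + ?N * ?c = 1"
    using z_sum[OF assms] by (simp only: mult_1 times_divide_eq_left times_divide_eq_right mult_1_right
        add_divide_distrib[symmetric] divide_self simp_thms)
  then have b: "fps_const ?c * fps_const ?s + fps_const ?N * fps_const ?c = 1" by simp
  have alg: "- c * - a + - c * b + - a * b + N * (- c * - a * b) = 0"
    if "c * (a - b) + N * (c * (a * b)) = a * b" for a b c N :: "complex fps"
    using that by (simp add: algebra_simps)
  have "fps_const ?c * (pole (z k) - pole (- z l)) + fps_const ?N * (fps_const ?c * (pole (z k) * pole (- z l)))
    = (fps_const ?c * fps_const ?s + fps_const ?N * fps_const ?c) * (pole (z k) * pole (- z l))"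
    unfolding a by (simp only: distrib_right mult.assoc)
  also have "\<dots> = pole (z k) * pole (- z l)" unfolding b by simp
  finally show "- fps_const ?c * - pole (z k) + - fps_const ?c * pole (- z l) + - pole (z k) * pole (- z l)
     + fps_const ?N * (- fps_const ?c * - pole (z k) * pole (- z l)) = 0"
    by (rule alg)
qed

sublocale exchange_relations "{1..n}" r q L M
proof
  show "L k * M k = M k * L k" if "k \<in> {1..n}" for k
    unfolding factors_as_sums by (rule one_plus_gscale_commute) (use that in \<open>simp add: P_Q_commute\<close>)
  show "q k l * L l * M k = M k * L l * q k l" if "k \<in> {1..n}" "l \<in> {1..n}" "k \<noteq> l" for k l
    using q_exchange_LM[of l k] that by (simp add: q_sym)
  fix k l m assume klm: "k \<in> {1..n}" "l \<in> {1..n}" "m \<in> {1..n}" "distinct [k, l, m]"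
  then have d: "distinct [k, l, 0, m]" by auto
  show "r k l * L m = L m * r k l" "r k l * M m = M m * r k l"
    "q k l * L m = L m * q k l" "q k l * M m = M m * q k l"
    unfolding factors_as_sums by (rule one_plus_gscale_commute, rule act_commute[OF d])+
qed (rule r_exchange_L r_exchange_M q_exchange_LM; assumption)+

end

section \<open>RTT relations\<close>

text \<open>The Yangian relation at x^(-r) y^(-s) for any family in a ring. \<open>A 0\<close> is
  left general, since in the ring of all degrees the identity of a single degree is only an
  idempotent.\<close>

definition rtt :: "(nat \<Rightarrow> 'n \<Rightarrow> 'n \<Rightarrow> 'r::ring) \<Rightarrow> bool" where
  "rtt A \<longleftrightarrow> (\<forall>r s i j k l.
     (A (Suc r) i j * A s k l - A s k l * A (Suc r) i j)
     - (A r i j * A (Suc s) k l - A (Suc s) k l * A r i j)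
     - (A r k j * A s i l - A s k j * A r i l) = 0)"

text \<open>Series in two variables are series in \<open>x^(-1)\<close> whose coefficients are series in \<open>y^(-1)\<close>.\<close>

definition ser_x :: "(nat \<Rightarrow> 'r::ring_1) \<Rightarrow> 'r fps fps" where
  "ser_x a = Abs_fps (\<lambda>r. fps_const (a r))"

definition ser_y :: "(nat \<Rightarrow> 'r::ring_1) \<Rightarrow> 'r fps fps" where
  "ser_y a = fps_const (Abs_fps a)"

abbreviation var_x :: "'r::ring_1 fps fps" where "var_x \<equiv> fps_X"
abbreviation var_y :: "'r::ring_1 fps fps" where "var_y \<equiv> fps_const fps_X"

lemma var_y_commute: "var_y * f = f * var_y"
  by (simp add: fps_eq_iff)

lemma ser_nth:
  "fps_nth (fps_nth (ser_x a * ser_y b) r) s = a r * b s"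
  "fps_nth (fps_nth (ser_y b * ser_x a) r) s = b s * a r"
  by (simp_all add: ser_x_def ser_y_def)

text \<open>The relation divided by x y, so that x - y becomes 1/y - 1/x and only nonnegative powers
  of 1/x and 1/y remain.\<close>

definition rtt_series :: "(nat \<Rightarrow> 'n \<Rightarrow> 'n \<Rightarrow> 'r::ring_1) \<Rightarrow> bool" where
  "rtt_series A \<longleftrightarrow> (\<forall>i j k l.
     (var_y - var_x) * (ser_x (\<lambda>a. A a i j) * ser_y (\<lambda>a. A a k l) - ser_y (\<lambda>a. A a k l) * ser_x (\<lambda>a. A a i j))
     = (var_x * var_y) * (ser_x (\<lambda>a. A a k j) * ser_y (\<lambda>a. A a i l) - ser_y (\<lambda>a. A a k j) * ser_x (\<lambda>a. A a i l)))"

text \<open>Dividing by x y shifts both indices by one. The additional coefficients, at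
  \<open>r = 0\<close> or \<open>s = 0\<close>, are commutators with \<open>A 0\<close>, which the
  assumption makes vanish.\<close>

lemma rtt_series_iff:
  fixes A :: "nat \<Rightarrow> 'n \<Rightarrow> 'n \<Rightarrow> 'r::ring_1"
  assumes "\<And>i j s k l. A 0 i j * A s k l = A s k l * A 0 i j"
  shows "rtt_series A \<longleftrightarrow> rtt A"
proof -
  have *: "(var_y - var_x) * (ser_x (\<lambda>a. A a i j) * ser_y (\<lambda>a. A a k l) - ser_y (\<lambda>a. A a k l) * ser_x (\<lambda>a. A a i j))
     = (var_x * var_y) * (ser_x (\<lambda>a. A a k j) * ser_y (\<lambda>a. A a i l) - ser_y (\<lambda>a. A a k j) * ser_x (\<lambda>a. A a i l))
     \<longleftrightarrow> (\<forall>r s. (A (Suc r) i j * A s k l - A s k l * A (Suc r) i j)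
     - (A r i j * A (Suc s) k l - A (Suc s) k l * A r i j)
     - (A r k j * A s i l - A s k j * A r i l) = 0)" (is "?L = ?R \<longleftrightarrow> ?P") for i j k l
  proof -
    have L: "fps_nth (fps_nth ?L r) s =
       (if s = 0 then 0 else A r i j * A (s - 1) k l - A (s - 1) k l * A r i j)
       - (if r = 0 then 0 else A (r - 1) i j * A s k l - A s k l * A (r - 1) i j)" for r s
      by (simp add: left_diff_distrib ser_nth del: fps_mult_nth_0 fps_mult_nth_1')
    have R: "fps_nth (fps_nth ?R r) s = (if r = 0 \<or> s = 0 then 0 else
        A (r - 1) k j * A (s - 1) i l - A (s - 1) k j * A (r - 1) i l)" for r s
      by (simp add: ser_nth mult.assoc del: fps_mult_nth_0 fps_mult_nth_1')
    have "?L = ?R \<longleftrightarrow> (\<forall>r s. fps_nth (fps_nth ?L r) s = fps_nth (fps_nth ?R r) s)"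
      by (auto simp: fps_eq_iff)
    also have "\<dots> \<longleftrightarrow> (\<forall>r s. fps_nth (fps_nth ?L (Suc r)) (Suc s) = fps_nth (fps_nth ?R (Suc r)) (Suc s))"
    proof (intro iffI allI)
      fix r s assume *: "\<forall>r s. fps_nth (fps_nth ?L (Suc r)) (Suc s) = fps_nth (fps_nth ?R (Suc r)) (Suc s)"
      show "fps_nth (fps_nth ?L r) s = fps_nth (fps_nth ?R r) s"
      proof (cases "r = 0 \<or> s = 0")
        case True
        then show ?thesis unfolding L R using assms by auto
      next
        case False
        then obtain r' s' where "r = Suc r'" "s = Suc s'" by (metis not0_implies_Suc)
        then show ?thesis using * by blast
      qed
    qed blast
    also have "\<dots> \<longleftrightarrow> ?P"
      unfolding L R by (simp add: algebra_simps)
    finally show ?thesis .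
  qed
  show ?thesis unfolding rtt_series_def rtt_def * by blast
qed

lemma fps_const_sum: "fps_const (sum f A) = (\<Sum>x\<in>A. fps_const (f x))"
  by (induction A rule: infinite_finite_induct) (simp_all flip: fps_const_add)

lemma mult_exchange:
  fixes a b c d :: "'r::semigroup_mult"
  shows "b * c = c * b \<Longrightarrow> (a * b) * (c * d) = (a * c) * (b * d)"
  by (metis mult.assoc)

text \<open>Exchange the \<open>a\<close> first and the \<open>b\<close> afterwards. Each exchange
  yields two terms; two of the four form the right side, and the other two cancel once the summation
  indices \<open>p\<close> and \<open>q\<close> are interchanged in one of them.\<close>

lemma coproduct_ring_identity:
  fixes w t :: "'r::ring_1" and a a' b b' :: "'n::finite \<Rightarrow> 'n \<Rightarrow> 'r"
  assumes w: "\<And>x. w * x = x * w" and t: "\<And>x. t * x = x * t"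
    and A: "\<And>i j k l. w * (a i j * a' k l - a' k l * a i j) = t * (a k j * a' i l - a' k j * a i l)"
    and B: "\<And>i j k l. w * (b i j * b' k l - b' k l * b i j) = t * (b k j * b' i l - b' k j * b i l)"
    and ab: "\<And>i j k l. a i j * b k l = b k l * a i j" "\<And>i j k l. a i j * b' k l = b' k l * a i j"
      "\<And>i j k l. a' i j * b k l = b k l * a' i j" "\<And>i j k l. a' i j * b' k l = b' k l * a' i j"
    and c: "\<And>i j. c i j = (\<Sum>p\<in>UNIV. a i p * b p j)" "\<And>i j. c' i j = (\<Sum>p\<in>UNIV. a' i p * b' p j)"
  shows "w * (c i j * c' k l - c' k l * c i j) = t * (c k j * c' i l - c' k j * c i l)"
proof -
  have cc': "c i j * c' k l = (\<Sum>p\<in>UNIV. \<Sum>q\<in>UNIV. (a i p * a' k q) * (b p j * b' q l))" for i j k l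
  proof -
    have "c i j * c' k l = (\<Sum>p\<in>UNIV. \<Sum>q\<in>UNIV. (a i p * b p j) * (a' k q * b' q l))"
      unfolding c by (rule sum_product)
    moreover have "(a i p * b p j) * (a' k q * b' q l) = (a i p * a' k q) * (b p j * b' q l)" for p q
      by (rule mult_exchange) (simp add: ab)
    ultimately show ?thesis by simp
  qed
  have c'c: "c' k l * c i j = (\<Sum>p\<in>UNIV. \<Sum>q\<in>UNIV. (a' k q * a i p) * (b' q l * b p j))" for i j k l
  proof -
    have "c' k l * c i j = (\<Sum>q\<in>UNIV. \<Sum>p\<in>UNIV. (a' k q * b' q l) * (a i p * b p j))"
      unfolding c by (rule sum_product)
    also have "\<dots> = (\<Sum>p\<in>UNIV. \<Sum>q\<in>UNIV. (a' k q * b' q l) * (a i p * b p j))"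
      by (rule sum.swap)
    moreover have "(a' k q * b' q l) * (a i p * b p j) = (a' k q * a i p) * (b' q l * b p j)" for p q
      by (rule mult_exchange) (simp add: ab)
    ultimately show ?thesis by simp
  qed
  have summand: "w * ((a i p * a' k q) * (b p j * b' q l) - (a' k q * a i p) * (b' q l * b p j)) =
     t * ((a k p * a' i q) * (b p j * b' q l)) - t * ((a' k p * a i q) * (b p j * b' q l))
     + t * ((a' k q * a i p) * (b q j * b' p l)) - t * ((a' k q * a i p) * (b' q j * b p l))" for p q
  proof -
    have "w * ((a i p * a' k q) * (b p j * b' q l) - (a' k q * a i p) * (b' q l * b p j)) =
       (w * (a i p * a' k q - a' k q * a i p)) * (b p j * b' q l)
       + (a' k q * a i p) * (w * (b p j * b' q l - b' q l * b p j))"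
    proof -
      have "(a' k q * a i p) * (w * (b p j * b' q l - b' q l * b p j)) =
         w * ((a' k q * a i p) * (b p j * b' q l - b' q l * b p j))"
        using w by (metis mult.assoc)
      then show ?thesis by (simp add: algebra_simps)
    qed
    also have "\<dots> = (t * (a k p * a' i q - a' k p * a i q)) * (b p j * b' q l)
       + (a' k q * a i p) * (t * (b q j * b' p l - b' q j * b p l))"
      unfolding A B ..
    also have "(a' k q * a i p) * (t * (b q j * b' p l - b' q j * b p l)) =
         t * ((a' k q * a i p) * (b q j * b' p l - b' q j * b p l))"
      using t by (metis mult.assoc)
    finally show ?thesis by (simp add: algebra_simps)
  qed
  have "w * (c i j * c' k l - c' k l * c i j) =
     (\<Sum>p\<in>UNIV. \<Sum>q\<in>UNIV. w * ((a i p * a' k q) * (b p j * b' q l) - (a' k q * a i p) * (b' q l * b p j)))"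
    unfolding cc' c'c by (simp add: sum_subtractf sum_distrib_left right_diff_distrib)
  also have "\<dots> = t * (c k j * c' i l)
       - (\<Sum>p\<in>UNIV. \<Sum>q\<in>UNIV. t * ((a' k p * a i q) * (b p j * b' q l)))
       + (\<Sum>p\<in>UNIV. \<Sum>q\<in>UNIV. t * ((a' k q * a i p) * (b q j * b' p l)))
       - t * (c' k j * c i l)"
    unfolding summand cc' c'c by (simp add: sum_subtractf sum.distrib sum_distrib_left)
  also have "(\<Sum>p\<in>UNIV. \<Sum>q\<in>UNIV. t * ((a' k q * a i p) * (b q j * b' p l))) =
      (\<Sum>p\<in>UNIV. \<Sum>q\<in>UNIV. t * ((a' k p * a i q) * (b p j * b' q l)))"
    by (rule sum.swap)
  finally show ?thesis by (simp add: algebra_simps)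
qed

lemma rtt_coproduct:
  fixes A B :: "nat \<Rightarrow> 'n::finite \<Rightarrow> 'n \<Rightarrow> 'r::ring_1"
  assumes "rtt A" "rtt B"
    and A0: "\<And>i j s k l. A 0 i j * A s k l = A s k l * A 0 i j"
    and B0: "\<And>i j s k l. B 0 i j * B s k l = B s k l * B 0 i j"
    and AB: "\<And>r i j s k l. A r i j * B s k l = B s k l * A r i j"
  shows "rtt (\<lambda>a i j. \<Sum>b\<le>a. \<Sum>k\<in>UNIV. A b i k * B (a - b) k j)" (is "rtt ?C")
proof -
  \<comment> \<open>The condition of \<open>rtt_series_iff\<close> for the product family, needed to
    return from series to coefficients.\<close>
  have C0: "?C 0 i j * ?C s k l = ?C s k l * ?C 0 i j" for i j s k l
  proof -
    have "(A 0 i p * B 0 p j) * (A b k q * B (s - b) q l) = (A b k q * B (s - b) q l) * (A 0 i p * B 0 p j)" for p q b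
      using mult_exchange[of "B 0 p j" "A b k q" "A 0 i p" "B (s - b) q l"]
        mult_exchange[of "B (s - b) q l" "A 0 i p" "A b k q" "B 0 p j"] A0[of i p b k q] B0[of p j "s - b" q l]
      by (simp only: AB)
    then have e: "(\<Sum>p\<in>UNIV. A 0 i p * B 0 p j) * (A b k q * B (s - b) q l) =
        (A b k q * B (s - b) q l) * (\<Sum>p\<in>UNIV. A 0 i p * B 0 p j)" for q b
      by (simp add: sum_distrib_left sum_distrib_right)
    define X where "X = (\<Sum>p\<in>UNIV. A 0 i p * B 0 p j)"
    have "?C 0 i j = X" by (simp add: X_def)
    then show ?thesis using e unfolding X_def[symmetric] by (simp add: sum_distrib_left sum_distrib_right)
  qed
  have com: "ser_x (\<lambda>a. A a i j) * ser_x (\<lambda>a. B a k l) = ser_x (\<lambda>a. B a k l) * ser_x (\<lambda>a. A a i j)"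
    "ser_x (\<lambda>a. A a i j) * ser_y (\<lambda>a. B a k l) = ser_y (\<lambda>a. B a k l) * ser_x (\<lambda>a. A a i j)"
    "ser_y (\<lambda>a. A a i j) * ser_x (\<lambda>a. B a k l) = ser_x (\<lambda>a. B a k l) * ser_y (\<lambda>a. A a i j)"
    "ser_y (\<lambda>a. A a i j) * ser_y (\<lambda>a. B a k l) = ser_y (\<lambda>a. B a k l) * ser_y (\<lambda>a. A a i j)" for i j k l
  proof -
    have rv: "(\<Sum>b=0..a. X b * Y (a - b)) = (\<Sum>b=0..a. Y b * X (a - b))"
      if "\<And>r s. X r * Y s = Y s * X r" for a and X Y :: "nat \<Rightarrow> 'r"
      using that by (subst sum.atLeastAtMost_rev) (auto intro!: sum.cong)
    show "ser_x (\<lambda>a. A a i j) * ser_x (\<lambda>a. B a k l) = ser_x (\<lambda>a. B a k l) * ser_x (\<lambda>a. A a i j)"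
      by (rule fps_ext) (simp add: ser_x_def fps_mult_nth flip: fps_const_sum, rule rv, rule AB)
    show "ser_y (\<lambda>a. A a i j) * ser_y (\<lambda>a. B a k l) = ser_y (\<lambda>a. B a k l) * ser_y (\<lambda>a. A a i j)"
      unfolding ser_y_def fps_const_mult
      by (intro arg_cong[where f = fps_const] fps_ext) (simp add: fps_mult_nth, rule rv, rule AB)
    show "ser_x (\<lambda>a. A a i j) * ser_y (\<lambda>a. B a k l) = ser_y (\<lambda>a. B a k l) * ser_x (\<lambda>a. A a i j)"
      "ser_y (\<lambda>a. A a i j) * ser_x (\<lambda>a. B a k l) = ser_x (\<lambda>a. B a k l) * ser_y (\<lambda>a. A a i j)"
      by (intro fps_ext; simp add: ser_nth AB)+
  qed
  have C: "ser_x (\<lambda>a. ?C a i j) = (\<Sum>p\<in>UNIV. ser_x (\<lambda>a. A a i p) * ser_x (\<lambda>a. B a p j))"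
    "ser_y (\<lambda>a. ?C a i j) = (\<Sum>p\<in>UNIV. ser_y (\<lambda>a. A a i p) * ser_y (\<lambda>a. B a p j))" for i j
  proof -
    have s: "(\<Sum>b\<le>a. \<Sum>k\<in>UNIV. A b i k * B (a - b) k j) = (\<Sum>k\<in>UNIV. \<Sum>b=0..a. A b i k * B (a - b) k j)" for a
      by (subst sum.swap) (simp add: atMost_atLeast0)
    show "ser_x (\<lambda>a. ?C a i j) = (\<Sum>p\<in>UNIV. ser_x (\<lambda>a. A a i p) * ser_x (\<lambda>a. B a p j))"
      unfolding s by (rule fps_ext) (simp add: ser_x_def fps_sum_nth fps_mult_nth fps_const_sum)
    show "ser_y (\<lambda>a. ?C a i j) = (\<Sum>p\<in>UNIV. ser_y (\<lambda>a. A a i p) * ser_y (\<lambda>a. B a p j))"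
      unfolding s ser_y_def fps_const_mult fps_const_sum
      by (intro arg_cong[where f = fps_const] fps_ext) (simp add: fps_sum_nth fps_mult_nth)
  qed
  have "rtt_series A" "rtt_series B" using assms by (simp_all add: rtt_series_iff)
  then have "rtt_series ?C"
    unfolding rtt_series_def
  proof (intro allI, goal_cases)
    case (1 i j k l)
    have y: "var_y * x = x * var_y" for x :: "'r fps fps" by (rule var_y_commute)
    have x: "var_x * f = f * var_x" for f :: "'r fps fps" by (rule fps_mult_fps_X_commute)
    show ?case
    proof (rule coproduct_ring_identity[where w = "var_y - var_x" and t = "var_x * var_y"
          and a = "\<lambda>i j. ser_x (\<lambda>a. A a i j)" and a' = "\<lambda>i j. ser_y (\<lambda>a. A a i j)"
          and b = "\<lambda>i j. ser_x (\<lambda>a. B a i j)" and b' = "\<lambda>i j. ser_y (\<lambda>a. B a i j)"])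
      show "(var_y - var_x) * f = f * (var_y - var_x)" "var_x * var_y * f = f * (var_x * var_y)" for f :: "'r fps fps"
        using x[of f] y[of f] x[of "f * var_y"]
        by (simp_all only: left_diff_distrib right_diff_distrib mult.assoc) (metis mult.assoc x y)
    qed (use 1 in \<open>simp_all add: com C\<close>)
  qed
  then show ?thesis using rtt_series_iff[of ?C] C0 by blast
qed

text \<open>For positive \<open>r\<close> and \<open>s\<close> both commutators carry the same power
  of \<open>z\<close> and cancel, as do the two products in the last bracket. The commutation
  relations of the \<open>E i j\<close> enter only when exactly one index is 0.\<close>

lemma rtt_evaluation:
  fixes E :: "'n \<Rightarrow> 'n \<Rightarrow> ('m::finite, complex) gop"
  assumes gl: "\<And>i j k l. E i j * E k l - E k l * E i j = (if i = l then E k j else 0) - (if k = j then E i l else 0)"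
    and e: "\<And>i j. e * E i j = E i j" "\<And>i j. E i j * e = E i j" "e * e = e"
  shows "rtt (\<lambda>a i j. if a = 0 then if i = j then e else 0 else gscale (- (z ^ (a - 1))) (E i j))"
  unfolding rtt_def
proof (intro allI, goal_cases)
  case (1 r s i j k l)
  have gl': "E i j * E k l = E k l * E i j + (if i = l then E k j else 0) - (if k = j then E i l else 0)" for i j k l
    using gl[of i j k l] by (simp add: algebra_simps)
  show ?case
  proof (cases r; cases s)
    fix r' s' assume [simp]: "r = Suc r'" "s = Suc s'"
    show ?thesis
      by (simp add: gscale_mult_left gscale_mult_right gscale_gscale power_add mult_ac)
  next
    fix s' assume [simp]: "r = 0" "s = Suc s'"
    show ?thesis
      by (simp add: gscale_mult_left gscale_mult_right gscale_gscale e gl'[of i j k l]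
          gscale_minus_left gscale_add_right gscale_diff_right gscale_minus_right gscale_one gscale_zero_right)
  next
    fix r' assume [simp]: "r = Suc r'" "s = 0"
    show ?thesis
      by (simp add: gscale_mult_left gscale_mult_right gscale_gscale e gl'[of i j k l]
          gscale_minus_left gscale_add_right gscale_diff_right gscale_minus_right gscale_one gscale_zero_right)
  qed (simp add: e gscale_mult_left gscale_mult_right)
qed

section \<open>Modules over the Yangian\<close>

lift_definition gop_of :: "nat \<Rightarrow> ('n list \<Rightarrow> 'n list \<Rightarrow> 'c::zero) \<Rightarrow> ('n, 'c) gop"
  is "\<lambda>n X u w. if length u = n \<and> length w = n then X u w else 0"
  by auto

lemmas entry_gop_of [simp] = gop_of.rep_eq

text \<open>The identity of degree n, an idempotent: the 1 of the ring is the identity in every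
  degree at once.\<close>

definition unit_op :: "nat \<Rightarrow> ('n::finite, complex) gop" where
  "unit_op n = gop_of n op_id"

lemma gop_of_mult: "gop_of n (op_mult n X Y) = gop_of n X * gop_of n Y"
  by (rule gop_eqI) (simp add: entry_mult op_mult_def)

lemma of_bool_mult_left_right: "(if P then 1 else 0) * x = (if P then x else 0)"
  "x * (if P then 1 else 0) = (if P then x else 0)" for x :: "'a::semiring_1"
  by auto

lemma entry_unit_op: "entry (unit_op n) u w = (if length u = n \<and> u = w then 1 else 0)"
  by (auto simp: unit_op_def op_id_def)

lemma unit_op_gop_of [simp]:
  "unit_op n * gop_of n X = gop_of n X" "gop_of n X * unit_op n = gop_of n X"
proof -
  show "unit_op n * gop_of n X = gop_of n X"
    by (rule gop_eqI) (auto simp: entry_mult entry_unit_op of_bool_mult_left_right if_if_eq_conj[symmetric] intro: sum.neutral)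
  show "gop_of n X * unit_op n = gop_of n X"
    by (rule gop_eqI) (auto simp: entry_mult unit_op_def op_id_def of_bool_mult_left_right intro: sum.neutral)
qed

lemma unit_op_idem [simp]: "unit_op n * unit_op n = unit_op n"
  by (metis unit_op_def unit_op_gop_of(1))

lemma free_algebra_induct [case_names single add]:
  fixes x :: "'a \<Rightarrow>\<^sub>0 'b::comm_monoid_add"
  assumes single: "\<And>m c. P (Poly_Mapping.single m c)"
    and add: "\<And>x y. P x \<Longrightarrow> P y \<Longrightarrow> P (x + y)"
  shows "P x"
proof (induction x rule: update_induct)
  case const
  show ?case using single[of undefined 0] by simp
next
  case (update f a b)
  have "Poly_Mapping.update a b f = Poly_Mapping.single a b + f"
    using update(1) by (intro poly_mapping_eqI) (auto simp: lookup_update lookup_add lookup_single in_keys_iff when_def)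
  then show ?case using add single update by simp
qed

definition word_gop :: "nat \<Rightarrow> (nat \<Rightarrow> 'n \<Rightarrow> 'n \<Rightarrow> 'n tensor_op) \<Rightarrow> (nat \<times> 'n \<times> 'n) free_word \<Rightarrow> ('n::finite, complex) gop" where
  "word_gop n g m = gop_of n (word_action n g m)"

lemma gop_of_ordered_prod:
  "gop_of n (ordered_prod n Xs) = foldr (\<lambda>X Y. gop_of n X * Y) Xs (unit_op n)"
  by (induction Xs) (simp_all add: ordered_prod_def gop_of_mult unit_op_def)

lemma word_gop_0: "word_gop n g 0 = unit_op n"
  by (simp add: word_gop_def word_action_def zero_free_word_def ordered_prod_def unit_op_def)

lemma word_gop_plus: "word_gop n g (m + m') = word_gop n g m * word_gop n g m'"
proof -
  have "foldr (\<lambda>X Y. gop_of n X * Y) (Xs @ Ys) (unit_op n) =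
     foldr (\<lambda>X Y. gop_of n X * Y) Xs (unit_op n) * foldr (\<lambda>X Y. gop_of n X * Y) Ys (unit_op n)"
    for Xs Ys :: "'a tensor_op list"
  proof (induction Xs)
    case Nil
    show ?case by (simp flip: gop_of_ordered_prod)
  qed (simp add: mult.assoc)
  then show ?thesis
    by (simp add: word_gop_def word_action_def plus_free_word_def gop_of_ordered_prod)
qed

lemma word_gop_letter: "word_gop n g (Word [(b, i, j)]) = gop_of n (g (Suc b) i j)"
  by (simp add: word_gop_def word_action_def gop_of_ordered_prod)

section \<open>From the free algebra to the Yangian\<close>

definition free_action ::
  "nat \<Rightarrow> (nat \<Rightarrow> 'n \<Rightarrow> 'n \<Rightarrow> 'n tensor_op) \<Rightarrow> 'n free_algebra \<Rightarrow> ('n::finite, complex) gop" where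
  "free_action n g r = (\<Sum>m\<in>Poly_Mapping.keys r. gscale (Poly_Mapping.lookup r m) (word_gop n g m))"

lemma free_action_superset:
  assumes "finite K" "Poly_Mapping.keys r \<subseteq> K"
  shows "free_action n g r = (\<Sum>m\<in>K. gscale (Poly_Mapping.lookup r m) (word_gop n g m))"
  unfolding free_action_def using assms
  by (intro sum.mono_neutral_left) (auto simp: in_keys_iff gscale_zero_left)

lemma free_action_add: "free_action n g (x + y) = free_action n g x + free_action n g y"
proof -
  let ?K = "Poly_Mapping.keys x \<union> Poly_Mapping.keys y"
  have "Poly_Mapping.keys (x + y) \<subseteq> ?K" by (rule keys_add)
  then show ?thesis
    by (simp add: free_action_superset[of ?K] lookup_add gscale_add_left sum.distrib)
qed

lemma free_action_single: "free_action n g (Poly_Mapping.single m c) = gscale c (word_gop n g m)"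
  by (simp add: free_action_superset[of "{m}"])

lemma free_action_mult: "free_action n g (x * y) = free_action n g x * free_action n g y"
proof (induction x rule: free_algebra_induct)
  case (single m c)
  show ?case
  proof (induction y rule: free_algebra_induct)
    case (single m' c')
    show ?case
      by (simp add: mult_single free_action_single gscale_mult_left gscale_mult_right gscale_gscale word_gop_plus mult.commute[of c'])
  qed (simp add: distrib_left free_action_add)
qed (simp add: distrib_right free_action_add)

lemma free_action_uminus: "free_action n g (- x) = - free_action n g x"
proof -
  have "free_action n g (- x) + free_action n g x = 0"
    by (subst free_action_add[symmetric]) (simp add: free_action_def)
  then show ?thesis by (simp add: eq_neg_iff_add_eq_0)
qed

lemma free_action_diff: "free_action n g (x - y) = free_action n g x - free_action n g y"
  using free_action_add[of n g x "- y"] by (simp add: free_action_uminus)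

lemma free_action_one: "free_action n g 1 = unit_op n"
  using free_action_single[of n g 0 1] by (simp add: word_gop_0 gscale_one)

lemma free_action_zero: "free_action n g 0 = 0"
  by (simp add: free_action_def)

definition gen_op :: "nat \<Rightarrow> (nat \<Rightarrow> 'n \<Rightarrow> 'n \<Rightarrow> 'n tensor_op) \<Rightarrow> nat \<Rightarrow> 'n \<Rightarrow> 'n \<Rightarrow> ('n::finite, complex) gop" where
  "gen_op n g a i j = (if a = 0 then if i = j then unit_op n else 0 else gop_of n (g a i j))"

lemma free_action_T: "free_action n g (free_T a i j) = gen_op n g a i j"
  by (cases a) (auto simp: free_T_def gen_op_def free_action_one free_action_zero free_action_single
      word_gop_letter gscale_one)

text \<open>The action therefore depends only on the class in the Yangian, not on the representative
  that \<open>module_by_generators\<close> evaluates.\<close>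

lemma free_action_ideal:
  assumes "rtt (gen_op n g)" "x \<in> yangian_ideal"
  shows "free_action n g x = 0"
  using assms(2)
proof induction
  case (relator r s i j k l)
  show ?case using assms(1)
    by (simp add: yangian_relator_def free_action_diff free_action_mult free_action_T rtt_def)
qed (simp_all add: free_action_add free_action_mult free_action_zero)

definition yangian_hom :: "nat \<Rightarrow> ('n yangian \<Rightarrow> ('n::finite, complex) gop) \<Rightarrow> bool" where
  "yangian_hom n \<phi> \<longleftrightarrow> \<phi> 1 = unit_op n \<and> (\<forall>x y. \<phi> (x + y) = \<phi> x + \<phi> y) \<and>
     (\<forall>x y. \<phi> (x * y) = \<phi> x * \<phi> y) \<and> (\<forall>c x. \<phi> (yangian_scale c x) = gscale c (\<phi> x))"

definition module_gop :: "'n yangian_module \<Rightarrow> 'n yangian \<Rightarrow> ('n::finite, complex) gop" where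
  "module_gop V x = gop_of (fst V) (snd V x)"

definition is_module :: "'n::finite yangian_module \<Rightarrow> bool" where
  "is_module V \<longleftrightarrow> yangian_hom (fst V) (module_gop V)"

lemma fst_module_by_generators [simp]: "fst (module_by_generators n g) = n"
  by (simp add: module_by_generators_def)

lemma module_gop_by_generators:
  assumes "rtt (gen_op n g)"
  shows "module_gop (module_by_generators n g) (abs_yangian r) = free_action n g r"
proof -
  have "module_gop (module_by_generators n g) x = free_action n g (rep_yangian x)" for x
    by (rule gop_eqI) (auto simp: module_gop_def module_by_generators_def free_action_def entry_sum word_gop_def Let_def)
  moreover have "yangian_eq (rep_yangian (abs_yangian r)) r"
    by (metis Quotient_yangian Quotient_abs_rep yangian.abs_eq_iff)
  then have "free_action n g (rep_yangian (abs_yangian r) - r) = 0"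
    unfolding yangian_eq_def by (rule free_action_ideal[OF assms])
  ultimately show ?thesis by (simp add: free_action_diff)
qed

lemma module_by_generators:
  assumes "rtt (gen_op n g)"
  shows "is_module (module_by_generators n g)"
    and "module_gop (module_by_generators n g) (yangian_T a i j) = gen_op n g a i j"
proof -
  let ?V = "module_by_generators n g"
  note abs = module_gop_by_generators[OF assms]
  have "module_gop ?V (x + y) = module_gop ?V x + module_gop ?V y"
    "module_gop ?V (x * y) = module_gop ?V x * module_gop ?V y"
    "module_gop ?V (yangian_scale c x) = gscale c (module_gop ?V x)" for x y c
  proof -
    obtain x' where [simp]: "x = abs_yangian x'" by (induct x rule: yangian.abs_induct) blast
    obtain y' where [simp]: "y = abs_yangian y'" by (induct y rule: yangian.abs_induct) blast
    show "module_gop ?V (x + y) = module_gop ?V x + module_gop ?V y"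
      "module_gop ?V (x * y) = module_gop ?V x * module_gop ?V y"
      by (simp_all add: plus_yangian.abs_eq times_yangian.abs_eq abs free_action_add free_action_mult)
    have "unit_op n * free_action n g x' = free_action n g x'"
      using free_action_mult[of n g 1 x'] by (simp add: free_action_one)
    then show "module_gop ?V (yangian_scale c x) = gscale c (module_gop ?V x)"
      by (simp add: yangian_scale.abs_eq abs free_action_mult free_action_single word_gop_0 gscale_mult_left)
  qed
  moreover have "module_gop ?V 1 = unit_op n"
    by (simp add: one_yangian_def abs free_action_one)
  ultimately show "is_module ?V" by (simp add: is_module_def yangian_hom_def)
  show "module_gop ?V (yangian_T a i j) = gen_op n g a i j"
    by (simp add: yangian_T.abs_eq abs free_action_T)
qed

lemma is_module_zero:
  assumes "is_module V"
  shows "module_gop V 0 = 0"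
  using assms unfolding is_module_def yangian_hom_def by (metis add_cancel_right_right)

lemma is_module_diff:
  assumes "is_module V"
  shows "module_gop V (x - y) = module_gop V x - module_gop V y"
proof -
  have "module_gop V (x - y) + module_gop V y = module_gop V (x - y + y)"
    using assms unfolding is_module_def yangian_hom_def by metis
  then show ?thesis by (simp add: algebra_simps)
qed

lemma is_module_sum:
  assumes "is_module V"
  shows "module_gop V (sum f A) = (\<Sum>x\<in>A. module_gop V (f x))"
  using assms is_module_zero[OF assms]
  by (induction A rule: infinite_finite_induct) (auto simp: is_module_def yangian_hom_def)

lemma yangian_relation:
  "(yangian_T (Suc r) i j * yangian_T s k l - yangian_T s k l * yangian_T (Suc r) i j)
     - (yangian_T r i j * yangian_T (Suc s) k l - yangian_T (Suc s) k l * yangian_T r i j)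
     - (yangian_T r k j * yangian_T s i l - yangian_T s k j * yangian_T r i l) = 0"
  by transfer (simp add: yangian_eq_def yangian_ideal.relator flip: yangian_relator_def)

text \<open>The converse of \<open>module_by_generators\<close>. It lets the tensor product be
  iterated, as a tensor product is again known only to be a module.\<close>

lemma is_module_rtt:
  assumes V: "is_module V"
  shows "rtt (\<lambda>a i j. module_gop V (yangian_T a i j))"
  unfolding rtt_def
proof (intro allI)
  fix r s i j k l
  have m: "module_gop V x * module_gop V y = module_gop V (x * y)" for x y
    using V by (simp add: is_module_def yangian_hom_def)
  show "module_gop V (yangian_T (Suc r) i j) * module_gop V (yangian_T s k l) -
       module_gop V (yangian_T s k l) * module_gop V (yangian_T (Suc r) i j) -
       (module_gop V (yangian_T r i j) * module_gop V (yangian_T (Suc s) k l) -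
        module_gop V (yangian_T (Suc s) k l) * module_gop V (yangian_T r i j)) -
       (module_gop V (yangian_T r k j) * module_gop V (yangian_T s i l) -
        module_gop V (yangian_T s k j) * module_gop V (yangian_T r i l)) = 0"
    unfolding m is_module_diff[OF V, symmetric] yangian_relation by (rule is_module_zero[OF V])
qed

lemma yangian_T_0: "yangian_T 0 i j = (if i = j then 1 else 0)"
  by transfer (simp add: free_T_def equivp_reflp[OF equivp_yangian_eq])

lemma module_gop_T_0:
  assumes "is_module V"
  shows "module_gop V (yangian_T 0 i j) = (if i = j then unit_op (fst V) else 0)"
  using assms is_module_zero[OF assms] by (simp add: yangian_T_0 is_module_def yangian_hom_def)

lemma unit_module_gop [simp]:
  "unit_op (fst V) * module_gop V x = module_gop V x" "module_gop V x * unit_op (fst V) = module_gop V x"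
  by (simp_all add: module_gop_def)

section \<open>Tensor products of modules\<close>

lift_definition tens :: "nat \<Rightarrow> ('n, 'c::comm_ring_1) gop \<Rightarrow> ('n, 'c) gop \<Rightarrow> ('n, 'c) gop"
  is "\<lambda>p X Y u w. if length u = length w then X (take p u) (take p w) * Y (drop p u) (drop p w) else 0"
  by simp

lemma tens_diff_left: "tens p (X - X') Y = tens p X Y - tens p X' Y"
  and tens_diff_right: "tens p X (Y - Y') = tens p X Y - tens p X Y'"
  and tens_zero_left: "tens p 0 Y = 0"
  and tens_zero_right: "tens p X 0 = 0"
  by (rule gop_eqI, simp add: tens.rep_eq algebra_simps)+

text \<open>An intermediate word splits uniquely at position \<open>p\<close>. If it is shorter than
  \<open>p\<close>, the second part is empty, hence the \<open>min\<close> in the proof.\<close>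

lemma tens_mult: "tens p X Y * tens p X' Y' = tens p (X * X') (Y * Y')"
proof (rule gop_eqI)
  fix u w :: "'a list" assume len: "length u = length w"
  let ?L = "length u"
  have "entry (tens p X Y * tens p X' Y') u w = (\<Sum>m\<in>words ?L.
      (entry X (take p u) (take p m) * entry X' (take p m) (take p w)) *
      (entry Y (drop p u) (drop p m) * entry Y' (drop p m) (drop p w)))"
    unfolding entry_mult by (intro sum.cong refl) (use len in \<open>simp add: tens.rep_eq mult_ac\<close>)
  also have "\<dots> = (\<Sum>(m, m')\<in>words (min ?L p) \<times> words (?L - p).
      (entry X (take p u) m * entry X' m (take p w)) *
      (entry Y (drop p u) m' * entry Y' m' (drop p w)))"
    by (rule sum.reindex_bij_witness[where i = "\<lambda>(m, m'). m @ m'" and j = "\<lambda>m. (take p m, drop p m)"])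
      (auto simp: min_def)
  also have "\<dots> = entry (tens p (X * X') (Y * Y')) u w"
    using len by (simp add: tens.rep_eq entry_mult sum_product sum.cartesian_product min.commute case_prod_unfold)
  finally show "entry (tens p X Y * tens p X' Y') u w = entry (tens p (X * X') (Y * Y')) u w" .
qed

lemma gop_of_op_tensor: "gop_of (p + q) (op_tensor p X Y) = tens p (gop_of p X) (gop_of q Y)"
  by (rule gop_eqI) (auto simp: tens.rep_eq op_tensor_def)

lemma tens_unit: "tens p (unit_op p) (unit_op q) = unit_op (p + q)"
proof (rule gop_eqI)
  fix u w :: "'a list" assume "length u = length w"
  moreover have "take p u = take p w \<and> drop p u = drop p w \<longleftrightarrow> u = w"
    by (metis append_take_drop_id)
  ultimately show "entry (tens p (unit_op p) (unit_op q)) u w = entry (unit_op (p + q)) u w"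
    by (auto simp: tens.rep_eq entry_unit_op min_def)
qed

lemma gop_of_sum: "gop_of n (\<lambda>u w. \<Sum>x\<in>A. f x u w) = (\<Sum>x\<in>A. gop_of n (f x))"
  by (rule gop_eqI) (simp add: entry_sum)

text \<open>T acting in the first tensor factor and T acting in the second are commuting families in
  one ring, and the coproduct is their matrix product, so \<open>rtt_coproduct\<close>
  applies.\<close>

lemma tensor_module:
  assumes V: "is_module V" and W: "is_module W"
  shows "is_module (tensor_module V W)"
    and "module_gop (tensor_module V W) (yangian_T a i j) = (\<Sum>b\<le>a. \<Sum>k\<in>UNIV.
      tens (fst V) (module_gop V (yangian_T b i k)) (module_gop W (yangian_T (a - b) k j)))"
proof -
  let ?p = "fst V" and ?q = "fst W"
  define g where "g = (\<lambda>a i j u w. \<Sum>b\<le>a. \<Sum>k\<in>UNIV.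
        op_tensor ?p (snd V (yangian_T b i k)) (snd W (yangian_T (a - b) k j)) u w)"
  have VW: "tensor_module V W = module_by_generators (?p + ?q) g"
    by (simp add: tensor_module_def g_def)
  let ?A = "\<lambda>a i j. tens ?p (module_gop V (yangian_T a i j)) (unit_op ?q)"
  let ?B = "\<lambda>a i j. tens ?p (unit_op ?p) (module_gop W (yangian_T a i j))"
  have g: "gen_op (?p + ?q) g = (\<lambda>a i j. \<Sum>b\<le>a. \<Sum>k\<in>UNIV.
      tens ?p (module_gop V (yangian_T b i k)) (module_gop W (yangian_T (a - b) k j)))"
  proof (intro ext)
    fix a i j
    show "gen_op (?p + ?q) g a i j = (\<Sum>b\<le>a. \<Sum>k\<in>UNIV.
      tens ?p (module_gop V (yangian_T b i k)) (module_gop W (yangian_T (a - b) k j)))"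
    proof (cases "a = 0")
      case True
      have "(\<Sum>k\<in>UNIV. tens ?p (module_gop V (yangian_T 0 i k)) (module_gop W (yangian_T 0 k j))) =
         (\<Sum>k\<in>UNIV. if k = i then if k = j then unit_op (?p + ?q) else 0 else 0)"
        by (intro sum.cong) (auto simp: module_gop_T_0 V W tens_zero_left tens_zero_right tens_unit)
      then show ?thesis using True by (simp add: gen_op_def)
    next
      case False
      then show ?thesis
        by (simp add: gen_op_def g_def gop_of_sum gop_of_op_tensor module_gop_def)
    qed
  qed
  have "rtt (\<lambda>a i j. \<Sum>b\<le>a. \<Sum>k\<in>UNIV. ?A b i k * ?B (a - b) k j)"
  proof (rule rtt_coproduct)
    show "rtt ?A" using is_module_rtt[OF V]
      by (simp add: rtt_def tens_mult) (simp add: tens_zero_left flip: tens_diff_left)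
    show "rtt ?B" using is_module_rtt[OF W]
      by (simp add: rtt_def tens_mult) (simp add: tens_zero_right flip: tens_diff_right)
  qed (auto simp: tens_mult module_gop_T_0 V W)
  then have "rtt (gen_op (?p + ?q) g)" by (simp add: g tens_mult)
  from module_by_generators[OF this] show "is_module (tensor_module V W)"
    and "module_gop (tensor_module V W) (yangian_T a i j) = (\<Sum>b\<le>a. \<Sum>k\<in>UNIV.
      tens (fst V) (module_gop V (yangian_T b i k)) (module_gop W (yangian_T (a - b) k j)))"
    by (simp_all add: VW g)
qed

lemma trivial_module:
  "is_module (trivial_module :: 'n::finite yangian_module)" (is "is_module ?V")
  "module_gop (trivial_module :: 'n yangian_module) (yangian_T a i j) = (if a = 0 \<and> i = j then unit_op 0 else 0)"
proof -
  define g where "g = (\<lambda>(a::nat) (i::'n) (j::'n) (u::'n list) (w::'n list). 0 :: complex)"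
  have g: "gen_op 0 g = (\<lambda>a i j. if a = 0 \<and> i = j then unit_op 0 else 0)"
    by (intro ext) (auto simp: gen_op_def g_def intro!: gop_eqI)
  have "rtt (gen_op 0 g)"
    unfolding rtt_def g by auto
  note m = module_by_generators[OF this]
  have V: "?V = module_by_generators 0 g" by (simp add: trivial_module_def g_def)
  show "is_module ?V"
    "module_gop ?V (yangian_T a i j) = (if a = 0 \<and> i = j then unit_op 0 else 0)"
    by (simp_all add: V m g)
qed

section \<open>Evaluation modules\<close>

lemma gop_of_matrix_mult:
  "gop_of 1 (op_of_matrix A) * gop_of 1 (op_of_matrix A') = gop_of 1 (op_of_matrix (A ** A'))"
proof (rule gop_eqI)
  fix u w :: "'a list" assume len: "length u = length w"
  show "entry (gop_of 1 (op_of_matrix A) * gop_of 1 (op_of_matrix A')) u w = entry (gop_of 1 (op_of_matrix (A ** A'))) u w"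
  proof (cases "length u = 1")
    case True
    have "(\<Sum>m\<in>words 1. A $ hd u $ hd m * A' $ hd m $ hd w) = (\<Sum>c\<in>UNIV. A $ hd u $ c * A' $ c $ hd w)"
      by (rule sum.reindex_bij_witness[where i = "\<lambda>c. [c]" and j = hd]) (auto simp: length_Suc_conv)
    then show ?thesis using True len by (simp add: entry_mult op_of_matrix_def matrix_matrix_mult_def)
  next
    case False
    then show ?thesis by (simp add: entry_mult)
  qed
qed

text \<open>Serves both kinds of evaluation modules: \<open>S i j\<close> is E_ji or its image under
  sigma, which preserves commutators.\<close>

lemma evaluation_type_module:
  fixes S :: "'n::finite \<Rightarrow> 'n \<Rightarrow> complex^'n^'n"
  assumes "\<And>i j k l. S i j ** S k l - S k l ** S i j = (if i = l then S k j else 0) - (if k = j then S i l else 0)"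
    and V: "V = module_by_generators 1 (\<lambda>a i j u w. - (z ^ (a - 1)) * op_of_matrix (S i j) u w)"
  shows "is_module V"
    and "module_gop V (yangian_T a i j) =
      (if a = 0 then if i = j then unit_op 1 else 0 else gscale (- (z ^ (a - 1))) (gop_of 1 (op_of_matrix (S i j))))"
proof -
  let ?g = "\<lambda>a i j u w. - (z ^ (a - 1)) * op_of_matrix (S i j) u w"
  let ?E = "\<lambda>i j. gop_of 1 (op_of_matrix (S i j))"
  have g: "gen_op 1 ?g = (\<lambda>a i j. if a = 0 then if i = j then unit_op 1 else 0 else gscale (- (z ^ (a - 1))) (?E i j))"
    by (intro ext) (auto simp: gen_op_def intro!: gop_eqI)
  have diff: "gop_of 1 (op_of_matrix A) - gop_of 1 (op_of_matrix A') = gop_of 1 (op_of_matrix (A - A'))"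
    and zero: "gop_of 1 (op_of_matrix 0) = 0" for A A' :: "complex^'n^'n"
    by (rule gop_eqI; simp add: op_of_matrix_def)+
  have "rtt (gen_op 1 ?g)" unfolding g
  proof (rule rtt_evaluation)
    fix i j k l
    have "?E i j * ?E k l - ?E k l * ?E i j = gop_of 1 (op_of_matrix (S i j ** S k l - S k l ** S i j))"
      by (simp only: gop_of_matrix_mult diff)
    then show "?E i j * ?E k l - ?E k l * ?E i j = (if i = l then ?E k j else 0) - (if k = j then ?E i l else 0)"
      by (cases "i = l"; cases "k = j"; simp only: assms(1) if_True if_False simp_thms flip: zero diff)
  qed simp_all
  from module_by_generators[OF this] show "is_module V" and "module_gop V (yangian_T a i j) =
      (if a = 0 then if i = j then unit_op 1 else 0 else gscale (- (z ^ (a - 1))) (gop_of 1 (op_of_matrix (S i j))))"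
    unfolding V g by simp_all
qed

lemma tensor_modules_simps:
  "tensor_modules [] = trivial_module" "tensor_modules (V # Vs) = tensor_module V (tensor_modules Vs)"
  by (simp_all add: tensor_modules_def)

lemma fst_tensor_module: "fst (tensor_module V W) = fst V + fst W"
  by (simp add: tensor_module_def)

lemma is_module_tensor_modules: "(\<And>V. V \<in> set Vs \<Longrightarrow> is_module V) \<Longrightarrow> is_module (tensor_modules Vs)"
  by (induction Vs) (auto simp: tensor_modules_simps trivial_module tensor_module)

lemma fst_tensor_modules: "(\<And>V. V \<in> set Vs \<Longrightarrow> fst V = 1) \<Longrightarrow> fst (tensor_modules Vs) = length Vs"
  by (induction Vs) (auto simp: tensor_modules_simps fst_tensor_module trivial_module_def)

section \<open>Entries of products of Lax operators\<close>

lemma entry_mult_act: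
  assumes "k \<noteq> l" "k < length w" "l < length w"
  shows "entry (Y * act k l X) u w =
    (\<Sum>c\<in>UNIV. \<Sum>d\<in>UNIV. entry Y u (w[k := c, l := d]) * X (c, d) (w ! k, w ! l))"
proof (cases "length u = length w")
  case True
  have "entry (Y * act k l X) u w = (\<Sum>m\<in>words (length w). entry Y u m * entry (act k l X) m w)"
    by (simp add: entry_mult True)
  also have "\<dots> = (\<Sum>m | length m = length w \<and> (\<forall>i<length w. i \<noteq> k \<and> i \<noteq> l \<longrightarrow> w ! i = m ! i).
      entry Y u m * X (m ! k, m ! l) (w ! k, w ! l))"
    by (rule sum.mono_neutral_cong_right) (use assms in \<open>auto simp: entry_act\<close>)
  also have "\<dots> = (\<Sum>c\<in>UNIV. \<Sum>d\<in>UNIV. entry Y u (w[k := c, l := d]) * X (c, d) (w ! k, w ! l))"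
    by (subst sum_two_positions) (use assms in \<open>auto simp: nth_list_update\<close>)
  finally show ?thesis .
qed (simp add: entry_eq_0)

text \<open>Entries of a product of operators that share the auxiliary factor but have separate
  quantum factors: only the auxiliary letter is summed. In \<open>bwd\<close> the operators multiply
  in the reverse order, while the letters are still read from left to right.\<close>

primrec fwd :: "('n \<times> 'n \<Rightarrow> 'n \<times> 'n \<Rightarrow> 'c::comm_ring_1) list \<Rightarrow> 'n \<Rightarrow> 'n \<Rightarrow> 'n list \<Rightarrow> 'n list \<Rightarrow> 'c" where
  "fwd [] i j u w = (if i = j then 1 else 0)"
| "fwd (X # Xs) i j u w = (\<Sum>m\<in>UNIV. X (i, hd u) (m, hd w) * fwd Xs m j (tl u) (tl w))"

primrec bwd :: "('n \<times> 'n \<Rightarrow> 'n \<times> 'n \<Rightarrow> 'c::comm_ring_1) list \<Rightarrow> 'n \<Rightarrow> 'n \<Rightarrow> 'n list \<Rightarrow> 'n list \<Rightarrow> 'c" where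
  "bwd [] i j u w = (if i = j then 1 else 0)"
| "bwd (X # Xs) i j u w = (\<Sum>m\<in>UNIV. bwd Xs i m (tl u) (tl w) * X (m, hd u) (j, hd w))"

text \<open>Agreement on short words is not demanded, since \<open>act\<close> vanishes there.\<close>

definition acts_by :: "nat \<Rightarrow> ('n \<times> 'n \<Rightarrow> 'n \<times> 'n \<Rightarrow> 'c::comm_ring_1) \<Rightarrow> ('n::finite, 'c) gop \<Rightarrow> bool" where
  "acts_by k X Z \<longleftrightarrow> (\<forall>u w. k < length u \<longrightarrow> entry Z u w = entry (act 0 k X) u w)"

lemma acts_by_row:
  assumes "acts_by k X Z" "0 < k" "k < length u"
  shows "entry (Z * Y) u w = (\<Sum>c\<in>UNIV. \<Sum>d\<in>UNIV. X (u ! 0, u ! k) (c, d) * entry Y (u[0 := c, k := d]) w)"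
proof -
  have "entry (Z * Y) u w = entry (act 0 k X * Y) u w"
    using assms by (simp add: entry_mult acts_by_def)
  then show ?thesis using assms by (subst (asm) entry_act_mult) auto
qed

lemma acts_by_column:
  assumes "acts_by k X Z" "0 < k" "k < length w"
  shows "entry (Y * Z) u w = (\<Sum>c\<in>UNIV. \<Sum>d\<in>UNIV. entry Y u (w[0 := c, k := d]) * X (c, d) (w ! 0, w ! k))"
proof (cases "length u = length w")
  case True
  have "entry (Y * Z) u w = entry (Y * act 0 k X) u w"
    using assms True by (simp add: entry_mult acts_by_def)
  then show ?thesis using assms by (subst (asm) entry_mult_act) auto
qed (simp add: entry_eq_0)

text \<open>Downward induction on the number \<open>p\<close> of omitted factors. The prefixes
  \<open>v\<close> and \<open>v'\<close> preserve the positions of the remaining factors, which do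
  not change them.\<close>

lemma entry_forward_product:
  assumes "p \<le> n" "\<And>k. k \<in> {1..n} \<Longrightarrow> acts_by k (X k) (Z k)"
    and "length v = p" "length v' = p" "length u = n - p" "length w = n - p"
  shows "entry (prod_list (map Z [Suc p..<Suc n])) (i # v @ u) (j # v' @ w) =
    (if v = v' then fwd (map X [Suc p..<Suc n]) i j u w else 0)"
  using assms(1,3-)
proof (induction p arbitrary: v v' u w i rule: inc_induct)
  case base
  then show ?case by auto
next
  case (step p)
  then obtain a u' where u: "u = a # u'" by (cases u) auto
  from step obtain b w' where w: "w = b # w'" by (cases w) auto
  have e: "[Suc p..<Suc n] = Suc p # [Suc (Suc p)..<Suc n]"
    using step.hyps by (simp add: upt_conv_Cons)
  have upd: "(i # v @ u)[0 := c, Suc p := d] = c # (v @ [d]) @ u'" for c d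
    using step.prems by (simp add: u list_update_append)
  have "entry (prod_list (map Z [Suc p..<Suc n])) (i # v @ u) (j # v' @ w) =
    (\<Sum>c\<in>UNIV. \<Sum>d\<in>UNIV. X (Suc p) ((i # v @ u) ! 0, (i # v @ u) ! Suc p) (c, d) *
       entry (prod_list (map Z [Suc (Suc p)..<Suc n])) ((i # v @ u)[0 := c, Suc p := d]) (j # v' @ w))"
    unfolding e list.map prod_list.Cons
    by (rule acts_by_row[OF assms(2)]) (use step.hyps step.prems u in auto)
  also have "\<dots> = (\<Sum>c\<in>UNIV. \<Sum>d\<in>UNIV. X (Suc p) (i, a) (c, d) *
       entry (prod_list (map Z [Suc (Suc p)..<Suc n])) (c # (v @ [d]) @ u') (j # (v' @ [b]) @ w'))"
    unfolding upd using step.prems by (simp add: u w nth_append)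
  also have "\<dots> = (\<Sum>c\<in>UNIV. \<Sum>d\<in>UNIV. if d = b then if v = v' then X (Suc p) (i, a) (c, d) *
       fwd (map X [Suc (Suc p)..<Suc n]) c j u' w' else 0 else 0)"
    by (intro sum.cong refl, subst step.IH) (use step.prems u w in auto)
  also have "\<dots> = (if v = v' then fwd (map X [Suc p..<Suc n]) i j u w else 0)"
    unfolding e by (simp add: u w)
  finally show ?case .
qed

lemma entry_backward_product:
  assumes "p \<le> n" "\<And>k. k \<in> {1..n} \<Longrightarrow> acts_by k (X k) (Z k)"
    and "length v = p" "length v' = p" "length u = n - p" "length w = n - p"
  shows "entry (prod_list (map Z (rev [Suc p..<Suc n]))) (i # v @ u) (j # v' @ w) =
    (if v = v' then bwd (map X [Suc p..<Suc n]) i j u w else 0)"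
  using assms(1,3-)
proof (induction p arbitrary: v v' u w j rule: inc_induct)
  case base
  then show ?case by auto
next
  case (step p)
  then obtain a u' where u: "u = a # u'" by (cases u) auto
  from step obtain b w' where w: "w = b # w'" by (cases w) auto
  have e: "[Suc p..<Suc n] = Suc p # [Suc (Suc p)..<Suc n]"
    using step.hyps by (simp add: upt_conv_Cons)
  have upd: "(j # v' @ w)[0 := c, Suc p := d] = c # (v' @ [d]) @ w'" for c d
    using step.prems by (simp add: w list_update_append)
  have "entry (prod_list (map Z (rev [Suc p..<Suc n]))) (i # v @ u) (j # v' @ w) =
    (\<Sum>c\<in>UNIV. \<Sum>d\<in>UNIV.
       entry (prod_list (map Z (rev [Suc (Suc p)..<Suc n]))) (i # v @ u) ((j # v' @ w)[0 := c, Suc p := d])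
       * X (Suc p) (c, d) ((j # v' @ w) ! 0, (j # v' @ w) ! Suc p))"
    unfolding e rev.simps map_append prod_list.append list.map prod_list.Cons prod_list.Nil mult_1_right
    by (rule acts_by_column[OF assms(2)]) (use step.hyps step.prems w in auto)
  also have "\<dots> = (\<Sum>c\<in>UNIV. \<Sum>d\<in>UNIV.
       entry (prod_list (map Z (rev [Suc (Suc p)..<Suc n]))) (i # (v @ [a]) @ u') (c # (v' @ [d]) @ w')
       * X (Suc p) (c, d) (j, b))"
    unfolding upd using step.prems by (simp add: u w nth_append)
  also have "\<dots> = (\<Sum>c\<in>UNIV. \<Sum>d\<in>UNIV. if d = a then if v = v' then
       bwd (map X [Suc (Suc p)..<Suc n]) i c u' w' * X (Suc p) (c, d) (j, b) else 0 else 0)"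
    by (intro sum.cong refl, subst step.IH) (use step.prems u w in auto)
  also have "\<dots> = (if v = v' then bwd (map X [Suc p..<Suc n]) i j u w else 0)"
    unfolding e by (simp add: u w)
  finally show ?case .
qed

section \<open>The generating series of the modules\<close>

definition tser :: "'n::finite yangian_module \<Rightarrow> 'n \<Rightarrow> 'n \<Rightarrow> 'n list \<Rightarrow> 'n list \<Rightarrow> complex fps" where
  "tser V i j u w = Abs_fps (\<lambda>a. entry (module_gop V (yangian_T a i j)) u w)"

text \<open>T(x) on a module of degree 1, read as an operator on the auxiliary factor (first
  components) and the module (second components).\<close>

definition lax :: "'n::finite yangian_module \<Rightarrow> 'n \<times> 'n \<Rightarrow> 'n \<times> 'n \<Rightarrow> complex fps" where
  "lax V p q = tser V (fst p) (fst q) [snd p] [snd q]"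

lemma tser_tensor:
  assumes "is_module V" "is_module W" "fst V = 1" "length u = length w" "u \<noteq> []"
  shows "tser (tensor_module V W) i j u w =
    (\<Sum>k\<in>UNIV. lax V (i, hd u) (k, hd w) * tser W k j (tl u) (tl w))"
proof (rule fps_ext)
  fix a
  have "take 1 u = [hd u]" "take 1 w = [hd w]" "drop 1 u = tl u" "drop 1 w = tl w"
    using assms by (cases u; cases w; simp)+
  then have t: "entry (tens 1 X Y) u w = entry X [hd u] [hd w] * entry Y (tl u) (tl w)"
    for X Y :: "('a, complex) gop"
    using assms(4) by (simp only: tens.rep_eq if_True simp_thms)
  show "fps_nth (tser (tensor_module V W) i j u w) a =
      fps_nth (\<Sum>k\<in>UNIV. lax V (i, hd u) (k, hd w) * tser W k j (tl u) (tl w)) a"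
    by (simp only: tser_def lax_def fps_nth_Abs_fps tensor_module[OF assms(1,2)] assms(3) entry_sum t
        fps_sum_nth fps_mult_nth fst_conv snd_conv atMost_atLeast0)
      (rule sum.swap)
qed

lemma tser_tensor_modules:
  assumes "\<And>V. V \<in> set Vs \<Longrightarrow> is_module V \<and> fst V = 1" "length u = length Vs" "length w = length Vs"
  shows "tser (tensor_modules Vs) i j u w = fwd (map lax Vs) i j u w"
  using assms
proof (induction Vs arbitrary: u w i)
  case Nil
  show ?case
    by (rule fps_ext) (use Nil in \<open>simp add: tensor_modules_simps tser_def trivial_module entry_unit_op\<close>)
next
  case (Cons V Vs)
  have "is_module (tensor_modules Vs)" by (rule is_module_tensor_modules) (use Cons.prems in auto)
  moreover have "u \<noteq> []" using Cons.prems by auto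
  ultimately have "tser (tensor_modules (V # Vs)) i j u w =
    (\<Sum>k\<in>UNIV. lax V (i, hd u) (k, hd w) * tser (tensor_modules Vs) k j (tl u) (tl w))"
    unfolding tensor_modules_simps by (intro tser_tensor) (use Cons.prems in auto)
  then show ?case using Cons.prems by (simp add: Cons.IH)
qed

text \<open>The substitution of \<open>-x\<close> for \<open>x\<close>.\<close>

definition alt :: "complex fps \<Rightarrow> complex fps" where
  "alt f = Abs_fps (\<lambda>a. (- 1) ^ a * fps_nth f a)"

lemma alt_mult: "alt (f * g) = alt f * alt g"
proof (rule fps_ext)
  fix n
  have "(- 1) ^ n * (fps_nth f i * fps_nth g (n - i)) = (- 1) ^ i * fps_nth f i * ((- 1) ^ (n - i) * fps_nth g (n - i))"
    if "i \<le> n" for i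
  proof -
    have "(- 1 :: complex) ^ n = (- 1) ^ i * (- 1) ^ (n - i)" using that by (simp flip: power_add)
    then show ?thesis by simp
  qed
  then show "fps_nth (alt (f * g)) n = fps_nth (alt f * alt g) n"
    unfolding alt_def fps_nth_Abs_fps fps_mult_nth sum_distrib_left by (intro sum.cong) auto
qed

lemma alt_add: "alt (f + g) = alt f + alt g"
  and alt_diff: "alt (f - g) = alt f - alt g"
  and alt_const: "alt (fps_const c) = fps_const c"
  by (rule fps_ext, simp add: alt_def algebra_simps)+

lemma alt_sum: "alt (sum f A) = (\<Sum>x\<in>A. alt (f x))"
  using alt_const[of 0] by (induction A rule: infinite_finite_induct) (auto simp: alt_add)

lemma alt_pole: "alt (pole z) = - pole (- z)"
proof (rule fps_ext)
  fix a
  show "fps_nth (alt (pole z)) a = fps_nth (- pole (- z)) a"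
  proof (cases a)
    case (Suc b)
    have "(- z) ^ b = (- 1) ^ b * z ^ b" by (rule power_minus)
    then show ?thesis by (simp add: alt_def pole_def Suc)
  qed (simp add: alt_def pole_def)
qed

section \<open>The bilinear form in coordinates\<close>

locale form_setup =
  fixes G :: group_type
    and B :: "complex^'n \<Rightarrow> complex^'n \<Rightarrow> complex"
    and us vs :: "'n \<Rightarrow> complex^'n"
  assumes form: "form_of_type G B"
    and bases: "dual_bases B us vs"
begin

definition "gB c d = B (axis c 1) (axis d 1)"
definition "hB a b = (\<Sum>i\<in>UNIV. us i $ a * vs i $ b)"
definition eps :: complex where "eps = (case G of Orth \<Rightarrow> 1 | Symp \<Rightarrow> - 1)"

lemma B_lin_right: "B u (x + y) = B u x + B u y" "B u (c *s x) = c * B u x"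
  and B_lin_left: "B (x + y) v = B x v + B y v" "B (c *s x) v = c * B x v"
  using form unfolding form_of_type_def bilinear_form_def
  by (auto simp: Vector_Spaces.linear_iff)

lemma B_zero: "B u 0 = 0" "B 0 v = 0"
  using B_lin_right(2)[of u 0 0] B_lin_left(2)[of 0 0 v] by simp_all

lemma B_sum_right: "B u (sum f A) = (\<Sum>x\<in>A. B u (f x))"
  and B_sum_left: "B (sum f A) v = (\<Sum>x\<in>A. B (f x) v)"
  by (induction A rule: infinite_finite_induct) (auto simp: B_zero B_lin_left B_lin_right)

lemma vec_expand: "(x :: complex^'n) = (\<Sum>c\<in>UNIV. (x $ c) *s axis c 1)"
  by (simp add: vec_eq_iff axis_def if_distrib cong: if_cong)

lemma B_expand: "B u v = (\<Sum>c\<in>UNIV. \<Sum>d\<in>UNIV. u $ c * v $ d * gB c d)"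
proof -
  have "B u v = B (\<Sum>c\<in>UNIV. (u $ c) *s axis c 1) (\<Sum>d\<in>UNIV. (v $ d) *s axis d 1)"
    by (simp flip: vec_expand)
  then show ?thesis
    by (simp only: B_sum_left B_lin_left(2)) (simp only: B_sum_right B_lin_right(2) gB_def sum_distrib_left mult.assoc)
qed

text \<open>The rows of \<open>U\<close> are the u_i, and \<open>W\<close> pairs the standard basis
  with the v_j, so duality says \<open>U ** W = mat 1\<close>. A one-sided inverse of a square
  matrix is two-sided, and \<open>W ** U = mat 1\<close> is the claim.\<close>

lemma gB_hB: "(\<Sum>d\<in>UNIV. gB a d * hB b d) = (if a = b then 1 else 0)"
proof -
  define U :: "complex^'n^'n" where "U = (\<chi> i c. us i $ c)"
  define W :: "complex^'n^'n" where "W = (\<chi> c j. \<Sum>d\<in>UNIV. gB c d * vs j $ d)"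
  have "U ** W = mat 1"
  proof -
    have "(U ** W) $ i $ j = B (us i) (vs j)" for i j
      by (simp add: U_def W_def matrix_matrix_mult_def B_expand sum_distrib_left mult_ac)
    then show ?thesis using bases by (simp add: vec_eq_iff mat_def dual_bases_def)
  qed
  then have "W ** U = mat 1" by (simp add: matrix_left_right_inverse)
  then have "(W ** U) $ a $ b = (if a = b then 1 else 0)" by (simp add: mat_def)
  moreover have "(W ** U) $ a $ b = (\<Sum>d\<in>UNIV. gB a d * hB b d)"
  proof -
    have "(W ** U) $ a $ b = (\<Sum>i\<in>UNIV. \<Sum>d\<in>UNIV. gB a d * (us i $ b * vs i $ d))"
      by (simp add: U_def W_def matrix_matrix_mult_def sum_distrib_left sum_distrib_right mult_ac)
    also have "\<dots> = (\<Sum>d\<in>UNIV. \<Sum>i\<in>UNIV. gB a d * (us i $ b * vs i $ d))" by (rule sum.swap)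
    finally show ?thesis by (simp add: hB_def sum_distrib_left)
  qed
  ultimately show ?thesis by simp
qed

lemma B_sym: "B v u = eps * B u v"
proof (cases G)
  case Orth
  then have "eps = 1" unfolding eps_def by simp
  moreover have "B v u = B u v" using form Orth by (simp add: form_of_type_def)
  ultimately show ?thesis by simp
next
  case Symp
  then have "B x x = 0" for x using form by (simp add: form_of_type_def)
  from this[of "u + v"] this[of u] this[of v] have "B v u = - B u v"
    by (simp add: B_lin_left B_lin_right eq_neg_iff_add_eq_0 add.commute)
  moreover have "eps = - 1" using Symp unfolding eps_def by simp
  ultimately show ?thesis by simp
qed

sublocale C: dual_tensors gB hB eps
proof
  show g: "gB b a = eps * gB a b" for a b
    unfolding gB_def by (rule B_sym)
  \<comment> \<open>\<open>hB\<close> is the inverse transpose of \<open>gB\<close> and inherits its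
    symmetry: insert the inverse relation once, flip \<open>gB\<close>, and contract on the other
    side.\<close>
  show "hB b a = eps * hB a b" for a b
  proof -
    have "hB b a = (\<Sum>c\<in>UNIV. hB b c * (\<Sum>d\<in>UNIV. gB c d * hB a d))"
      by (simp add: gB_hB if_distrib cong: if_cong)
    also have "\<dots> = (\<Sum>d\<in>UNIV. \<Sum>c\<in>UNIV. hB b c * (gB c d * hB a d))"
      unfolding sum_distrib_left by (rule sum.swap)
    also have "\<dots> = (\<Sum>d\<in>UNIV. \<Sum>c\<in>UNIV. (eps * hB a d) * (gB d c * hB b c))"
    proof (intro sum.cong refl)
      fix c d
      have e: "gB c d = eps * gB d c" by (rule g)
      show "hB b c * (gB c d * hB a d) = (eps * hB a d) * (gB d c * hB b c)"
        by (simp only: e mult_ac)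
    qed
    also have "\<dots> = eps * hB a b"
      unfolding sum_distrib_left[symmetric] gB_hB by (simp add: if_distrib cong: if_cong)
    finally show ?thesis .
  qed
  show "eps * eps = 1" unfolding eps_def by (simp split: group_type.split)
qed (rule gB_hB)

lemma hB_gB: "(\<Sum>p\<in>UNIV. hB p a * gB p b) = (if a = b then 1 else 0)"
proof -
  have "hB p a * gB p b = gB b p * hB a p" for p
  proof -
    have "hB p a * gB p b = (eps * eps) * (hB a p * gB b p)"
      by (simp only: C.g_sym[of p b] C.h_sym[of p a] mult_ac)
    then show ?thesis by (simp add: C.eps)
  qed
  then show ?thesis by (auto simp: gB_hB)
qed

text \<open>In coordinates conjugation is matrix transposition twisted by the Gram matrix and its
  inverse. Nondegeneracy supplies the uniqueness behind \<open>THE\<close>.\<close>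

lemma conjugate_op_entry:
  "conjugate_op B A $ a $ b = (\<Sum>m\<in>UNIV. \<Sum>i\<in>UNIV. hB i a * A $ m $ i * gB m b)"
proof -
  define C :: "complex^'n^'n" where "C = (\<chi> a b. \<Sum>m\<in>UNIV. \<Sum>i\<in>UNIV. hB i a * A $ m $ i * gB m b)"
  have C: "B (A *v u) v = B u (C *v v)" for u v
  proof -
    have "B u (C *v v) = (\<Sum>e\<in>UNIV. \<Sum>a\<in>UNIV. \<Sum>b\<in>UNIV. \<Sum>m\<in>UNIV. \<Sum>i\<in>UNIV.
        u $ e * gB e a * hB i a * A $ m $ i * gB m b * v $ b)"
      by (simp add: B_expand C_def matrix_vector_mult_def sum_distrib_left sum_distrib_right mult_ac)
    also have "\<dots> = (\<Sum>e\<in>UNIV. \<Sum>b\<in>UNIV. \<Sum>m\<in>UNIV. \<Sum>i\<in>UNIV. \<Sum>a\<in>UNIV.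
        u $ e * gB e a * hB i a * A $ m $ i * gB m b * v $ b)"
      by (rule sum.cong[OF refl], rule trans[OF sum.swap], rule sum.cong[OF refl],
          rule trans[OF sum.swap], rule sum.cong[OF refl], rule sum.swap)
    also have "\<dots> = (\<Sum>e\<in>UNIV. \<Sum>b\<in>UNIV. \<Sum>m\<in>UNIV. \<Sum>i\<in>UNIV.
        (u $ e * A $ m $ i * gB m b * v $ b) * (\<Sum>a\<in>UNIV. gB e a * hB i a))"
      by (simp add: sum_distrib_left mult_ac)
    also have "\<dots> = (\<Sum>e\<in>UNIV. \<Sum>b\<in>UNIV. \<Sum>m\<in>UNIV. u $ e * A $ m $ e * gB m b * v $ b)"
      by (simp add: gB_hB if_distrib cong: if_cong)
    also have "\<dots> = (\<Sum>b\<in>UNIV. \<Sum>m\<in>UNIV. \<Sum>e\<in>UNIV. u $ e * A $ m $ e * gB m b * v $ b)"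
      by (rule trans[OF sum.swap], rule sum.cong[OF refl], rule sum.swap)
    also have "\<dots> = (\<Sum>m\<in>UNIV. \<Sum>b\<in>UNIV. \<Sum>e\<in>UNIV. u $ e * A $ m $ e * gB m b * v $ b)"
      by (rule sum.swap)
    also have "\<dots> = B (A *v u) v"
      by (simp add: B_expand matrix_vector_mult_def sum_distrib_left sum_distrib_right mult_ac)
    finally show ?thesis by simp
  qed
  have "conjugate_op B A = C"
    unfolding conjugate_op_def
  proof (rule the_equality)
    fix A' assume A': "\<forall>u v. B (A *v u) v = B u (A' *v v)"
    have "A' *v v = C *v v" for v
    proof -
      have "B u (A' *v v - C *v v) = 0" for u
      proof -
        have "B u (A' *v v) = B u ((A' *v v - C *v v) + C *v v)" by simp
        also have "\<dots> = B u (A' *v v - C *v v) + B u (C *v v)" by (rule B_lin_right)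
        finally show ?thesis using A' C by simp
      qed
      then have "A' *v v - C *v v = 0"
        using form unfolding form_of_type_def nondegenerate_def by blast
      then show ?thesis by simp
    qed
    then show "A' = C" by (simp add: matrix_eq)
  qed (use C in blast)
  then show ?thesis by (simp add: C_def)
qed

lemma conjugate_matrix_unit: "conjugate_op B (matrix_unit m i) $ a $ b = hB i a * gB m b"
proof -
  have "conjugate_op B (matrix_unit m i) $ a $ b =
    (\<Sum>m'\<in>UNIV. \<Sum>i'\<in>UNIV. if i' = i then if m' = m then hB i' a * gB m' b else 0 else 0)"
    unfolding conjugate_op_entry by (intro sum.cong refl) (simp add: matrix_unit_def)
  then show ?thesis by simp
qed

end

section \<open>Lax operators of the evaluation modules\<close>

text \<open>On words that have position \<open>k\<close> the identity, too, can be read as acting in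
  the factors 0 and \<open>k\<close>, so each Lax operator has the shape that \<open>fwd\<close> and
  \<open>bwd\<close> multiply.\<close>

lemma acts_by_delta_plus:
  assumes "0 < k"
  shows "acts_by k (\<lambda>p q. (if p = q then 1 else 0) + c * X p q) (1 + gscale c (act 0 k X))"
  unfolding acts_by_def
proof (intro allI impI)
  fix u w :: "'a list" assume k: "k < length u"
  show "entry (1 + gscale c (act 0 k X)) u w = entry (act 0 k (\<lambda>p q. (if p = q then 1 else 0) + c * X p q)) u w"
  proof (cases "agree_off {0, k} u w")
    case True
    then have len: "length u = length w" by (simp add: agree_off_def)
    have "u = w \<longleftrightarrow> u ! 0 = w ! 0 \<and> u ! k = w ! k" (is "_ \<longleftrightarrow> ?A")
    proof
      assume A: ?A
      show "u = w"
      proof (rule nth_equalityI[OF len])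
        fix m assume "m < length u"
        then show "u ! m = w ! m" using True A len by (cases "m = 0 \<or> m = k") (auto simp: agree_off_def)
      qed
    qed simp
    then show ?thesis using True k by (auto simp: entry_act_agree)
  next
    case False
    then have "u \<noteq> w" by (auto simp: agree_off_def)
    then show ?thesis using False by (simp add: entry_act_agree)
  qed
qed

lemma matrix_unit_mult: "matrix_unit a b ** matrix_unit c d = (if b = c then matrix_unit a d else 0)"
proof -
  have "(\<Sum>k\<in>UNIV. matrix_unit a b $ i $ k * matrix_unit c d $ k $ j) =
    (\<Sum>k\<in>UNIV. if k = b then if b = c \<and> i = a \<and> j = d then 1 else 0 else 0)" for i j
    by (intro sum.cong refl) (auto simp: matrix_unit_def)
  then show ?thesis by (auto simp: matrix_matrix_mult_def vec_eq_iff matrix_unit_def)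
qed

lemma evaluation_module:
  "is_module (evaluation_module z)" "fst (evaluation_module z) = 1"
  "lax (evaluation_module z) p q = (if p = q then 1 else 0) + (- pole z) * P_sq p q"
proof -
  note ev = evaluation_type_module[OF _ evaluation_module_def, of z]
  have gl: "matrix_unit j i ** matrix_unit l k - matrix_unit l k ** matrix_unit j i =
    (if i = l then matrix_unit j k else 0) - (if k = j then matrix_unit l i else 0)" for i j k l :: "'n::finite"
    by (auto simp: matrix_unit_mult)
  show "is_module (evaluation_module z)" by (rule ev) (rule gl)
  show "fst (evaluation_module z) = 1" by (simp add: evaluation_module_def)
  show "lax (evaluation_module z) p q = (if p = q then 1 else 0) + (- pole z) * P_sq p q"
  proof (rule fps_ext)
    fix a
    have "fps_nth (lax (evaluation_module z) p q) a = entry (module_gop (evaluation_module z) (yangian_T a (fst p) (fst q))) [snd p] [snd q]"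
      by (simp add: lax_def tser_def)
    also have "\<dots> = fps_nth ((if p = q then 1 else 0) + (- pole z) * P_sq p q) a"
      by (subst ev(2)[OF gl]) (auto simp: pole_def P_sq_def op_of_matrix_def matrix_unit_def entry_unit_op prod_eq_iff)
    finally show "fps_nth (lax (evaluation_module z) p q) a = fps_nth ((if p = q then 1 else 0) + (- pole z) * P_sq p q) a" .
  qed
qed

lemma sum_words_Suc: "(\<Sum>m\<in>words (Suc n). f m) = (\<Sum>k\<in>UNIV. \<Sum>m\<in>words n. f (k # m))"
  for f :: "'n::finite list \<Rightarrow> 'd::comm_monoid_add"
proof -
  have "(\<Sum>m\<in>words (Suc n). f m) = (\<Sum>(k, m)\<in>UNIV \<times> words n. f (k # m))"
    by (rule sum.reindex_bij_witness[where i = "\<lambda>(k, m). k # m" and j = "\<lambda>m. (hd m, tl m)"])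
      (auto simp: length_Suc_conv)
  then show ?thesis by (simp add: sum.cartesian_product)
qed

context form_setup
begin

definition "gF a b = fps_const (gB a b)"
definition "hF a b = fps_const (hB a b)"

sublocale F: lax_setup gF hF "fps_const eps" z for z
proof unfold_locales
  show "(\<Sum>d\<in>UNIV. gF a d * hF b d) = (if a = b then 1 else 0)" for a b
    by (simp add: gF_def hF_def gB_hB flip: fps_const_sum)
  show "gF b a = fps_const eps * gF a b" for a b by (simp add: gF_def C.g_sym[of b a])
  show "hF b a = fps_const eps * hF a b" for a b by (simp add: hF_def C.h_sym[of b a])
  show "fps_const eps * fps_const eps = 1" by (simp add: C.eps)
qed

abbreviation "Lsq z \<equiv> \<lambda>p q. (if p = q then 1 else 0) + (- pole z) * P_sq p q"
abbreviation "Msq z \<equiv> \<lambda>p q. (if p = q then 1 else 0) + pole (- z) * Q_sq hF gF p q"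

lemma L_acts: "0 < k \<Longrightarrow> acts_by k (Lsq (z k)) (F.L z k)"
  unfolding F.factors_as_sums by (rule acts_by_delta_plus)

lemma M_acts: "0 < k \<Longrightarrow> acts_by k (Msq (z k)) (F.M z k)"
  unfolding F.factors_as_sums by (rule acts_by_delta_plus)

lemma hF_gF: "(\<Sum>p\<in>UNIV. hF p a * gF p b) = (if a = b then 1 else 0)"
  by (simp add: gF_def hF_def hB_gB flip: fps_const_sum)

lemma hF_gF_sym: "hF a i * gF b k = hF i a * gF k b"
proof -
  have "hF a i * gF b k = (fps_const eps * fps_const eps) * (hF i a * gF k b)"
    by (simp only: F.g_sym[of b k] F.h_sym[of a i] mult_ac)
  then show ?thesis by (simp add: C.eps)
qed

lemma twisted_evaluation_module:
  "is_module (twisted_evaluation_module B z)" "fst (twisted_evaluation_module B z) = 1"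
  "lax (twisted_evaluation_module B z) p q = Msq z p q"
proof -
  note ev = evaluation_type_module[OF _ twisted_evaluation_module_def, of B z]
  have sig: "sigma B (matrix_unit j i) $ a $ b = - (hB i a * gB j b)" for i j a b
    by (simp add: sigma_def conjugate_matrix_unit)
  have mm: "(sigma B (matrix_unit j i) ** sigma B (matrix_unit l k)) $ a $ b = (if j = k then hB i a * gB l b else 0)"
    for i j k l a b
  proof -
    have "(sigma B (matrix_unit j i) ** sigma B (matrix_unit l k)) $ a $ b =
      (\<Sum>c\<in>UNIV. gB j c * hB k c) * (hB i a * gB l b)"
      by (simp add: matrix_matrix_mult_def sig sum_distrib_left sum_distrib_right mult_ac)
    then show ?thesis by (simp add: gB_hB)
  qed
  have gl: "sigma B (matrix_unit j i) ** sigma B (matrix_unit l k) - sigma B (matrix_unit l k) ** sigma B (matrix_unit j i) =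
    (if i = l then sigma B (matrix_unit j k) else 0) - (if k = j then sigma B (matrix_unit l i) else 0)" for i j k l
    by (auto simp: vec_eq_iff mm sig)
  show "is_module (twisted_evaluation_module B z)" by (rule ev) (rule gl)
  show "fst (twisted_evaluation_module B z) = 1" by (simp add: twisted_evaluation_module_def)
  show "lax (twisted_evaluation_module B z) p q = Msq z p q"
  proof (rule fps_ext)
    fix a
    have "fps_nth (lax (twisted_evaluation_module B z) p q) a =
        entry (module_gop (twisted_evaluation_module B z) (yangian_T a (fst p) (fst q))) [snd p] [snd q]"
      by (simp add: lax_def tser_def)
    also have "\<dots> = fps_nth (Msq z p q) a"
      by (subst ev(2)[OF gl]) (auto simp: pole_def Q_sq_def hF_def gF_def op_of_matrix_def sig entry_unit_op prod_eq_iff)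
    finally show "fps_nth (lax (twisted_evaluation_module B z) p q) a = fps_nth (Msq z p q) a" .
  qed
qed

text \<open>The entry of T~ at \<open>i\<close>, \<open>k\<close>: conjugation sends E_pq to the
  matrix with entry \<open>hB q i * gB p k\<close> there, and \<open>alt\<close> substitutes
  \<open>- x\<close>.\<close>

definition tilde_ser :: "'n yangian_module \<Rightarrow> 'n \<Rightarrow> 'n \<Rightarrow> 'n list \<Rightarrow> 'n list \<Rightarrow> complex fps" where
  "tilde_ser V i k u w = (\<Sum>p\<in>UNIV. \<Sum>q\<in>UNIV. (hF q i * gF p k) * alt (tser V p q u w))"

definition tilde_lax :: "'n yangian_module \<Rightarrow> 'n \<times> 'n \<Rightarrow> 'n \<times> 'n \<Rightarrow> complex fps" where
  "tilde_lax V p q = tilde_ser V (fst p) (fst q) [snd p] [snd q]"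

lemma contraction:
  "(\<Sum>m\<in>UNIV. (\<Sum>p\<in>UNIV. gF p m * x p) * (\<Sum>q\<in>UNIV. hF q m * y q)) = (\<Sum>p\<in>UNIV. x p * y p)"
proof -
  have "(\<Sum>m\<in>UNIV. (\<Sum>p\<in>UNIV. gF p m * x p) * (\<Sum>q\<in>UNIV. hF q m * y q)) =
    (\<Sum>m\<in>UNIV. \<Sum>p\<in>UNIV. \<Sum>q\<in>UNIV. (x p * y q) * (gF p m * hF q m))"
    by (simp add: sum_product mult_ac)
  also have "\<dots> = (\<Sum>p\<in>UNIV. \<Sum>q\<in>UNIV. \<Sum>m\<in>UNIV. (x p * y q) * (gF p m * hF q m))"
    by (rule trans[OF sum.swap], rule sum.cong[OF refl], rule sum.swap)
  also have "\<dots> = (\<Sum>p\<in>UNIV. \<Sum>q\<in>UNIV. if p = q then x p * y q else 0)"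
    by (simp add: F.gh if_distrib cong: if_cong flip: sum_distrib_left)
  finally show ?thesis by simp
qed

text \<open>Conjugation reverses products, so in contrast to \<open>tser_tensor\<close> the factor
  of \<open>V\<close> comes last. The intermediate index is created by contracting \<open>gF\<close>
  with \<open>hF\<close>.\<close>

lemma tilde_ser_tensor:
  assumes "is_module V" "is_module W" "fst V = 1" "length u = length w" "u \<noteq> []"
  shows "tilde_ser (tensor_module V W) i k u w =
    (\<Sum>m\<in>UNIV. tilde_ser W i m (tl u) (tl w) * tilde_lax V (m, hd u) (k, hd w))"
proof -
  define x where "x = (\<lambda>p q. alt (lax V (p, hd u) (q, hd w)))"
  define y where "y = (\<lambda>p q. alt (tser W p q (tl u) (tl w)))"
  have tl: "tilde_lax V (m, hd u) (k, hd w) = (\<Sum>q\<in>UNIV. hF q m * (\<Sum>p\<in>UNIV. gF p k * x p q))" for m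
    unfolding tilde_lax_def tilde_ser_def x_def lax_def
    by (subst sum.swap) (simp add: sum_distrib_left mult.assoc)
  have tw: "tilde_ser W i m (tl u) (tl w) = (\<Sum>p\<in>UNIV. gF p m * (\<Sum>q\<in>UNIV. hF q i * y p q))" for m
    unfolding tilde_ser_def y_def by (simp add: sum_distrib_left mult_ac)
  have "tilde_ser (tensor_module V W) i k u w = (\<Sum>p\<in>UNIV. \<Sum>q\<in>UNIV. \<Sum>m\<in>UNIV. (hF q i * y m q) * (gF p k * x p m))"
    unfolding tilde_ser_def tser_tensor[OF assms] alt_sum alt_mult x_def y_def by (simp add: sum_distrib_left mult_ac)
  also have "\<dots> = (\<Sum>m\<in>UNIV. \<Sum>q\<in>UNIV. \<Sum>p\<in>UNIV. (hF q i * y m q) * (gF p k * x p m))"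
    by (subst sum.swap) (rule trans[OF sum.cong[OF refl sum.swap] sum.swap])
  also have "\<dots> = (\<Sum>m\<in>UNIV. (\<Sum>q\<in>UNIV. hF q i * y m q) * (\<Sum>p\<in>UNIV. gF p k * x p m))"
    by (simp add: sum_product)
  also have "\<dots> = (\<Sum>m\<in>UNIV. tilde_ser W i m (tl u) (tl w) * tilde_lax V (m, hd u) (k, hd w))"
    unfolding tl tw by (rule contraction[symmetric])
  finally show ?thesis .
qed

lemma tilde_ser_tensor_modules:
  assumes "\<And>V. V \<in> set Vs \<Longrightarrow> is_module V \<and> fst V = 1" "length u = length Vs" "length w = length Vs"
  shows "tilde_ser (tensor_modules Vs) i j u w = bwd (map tilde_lax Vs) i j u w"
  using assms
proof (induction Vs arbitrary: u w j)
  case Nil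
  have "tser (tensor_modules []) p q u w = (if p = q then 1 else 0)" for p q
    by (rule fps_ext) (use Nil in \<open>simp add: tensor_modules_simps tser_def trivial_module entry_unit_op\<close>)
  then have "tilde_ser (tensor_modules []) i j u w = (\<Sum>p\<in>UNIV. \<Sum>q\<in>UNIV. if q = p then hF p i * gF p j else 0)"
    unfolding tilde_ser_def by (intro sum.cong refl) (use alt_const[of 1] alt_const[of 0] in auto)
  then show ?case by (simp add: hF_gF)
next
  case (Cons V Vs)
  have "is_module (tensor_modules Vs)" by (rule is_module_tensor_modules) (use Cons.prems in auto)
  moreover have "u \<noteq> []" using Cons.prems by auto
  ultimately have "tilde_ser (tensor_modules (V # Vs)) i j u w =
    (\<Sum>m\<in>UNIV. tilde_ser (tensor_modules Vs) i m (tl u) (tl w) * tilde_lax V (m, hd u) (j, hd w))"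
    unfolding tensor_modules_simps by (intro tilde_ser_tensor) (use Cons.prems in auto)
  then show ?case using Cons.prems by (simp add: Cons.IH)
qed

lemma alt_delta: "alt (if P then 1 else 0) = (if P then 1 else 0)"
  using alt_const[of 1] alt_const[of 0] by simp

text \<open>Conjugating P in the auxiliary factor gives Q, and the substitution turns 1/(x - z) into
  -1/(x + z); so L becomes M.\<close>

lemma tilde_lax_evaluation: "tilde_lax (evaluation_module z) = Msq z"
proof (intro ext)
  fix x y :: "'n \<times> 'n"
  obtain i a k b where xy: "x = (i, a)" "y = (k, b)" by (cases x; cases y)
  have e: "alt (tser (evaluation_module z) p q [a] [b]) =
      (if q = p then if a = b then 1 else 0 else 0) + (if q = a then if p = b then pole (- z) else 0 else 0)" for p q
  proof -
    have "tser (evaluation_module z) p q [a] [b] =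
        (if p = q \<and> a = b then 1 else 0) - pole z * (if p = b \<and> a = q then 1 else 0)"
      using evaluation_module(3)[of z "(p, a)" "(q, b)"] by (simp add: lax_def P_sq_def)
    then show ?thesis
      by (simp only: alt_diff alt_mult alt_delta alt_pole) auto
  qed
  have "tilde_lax (evaluation_module z) x y = (\<Sum>p\<in>UNIV. \<Sum>q\<in>UNIV.
      (if q = p then if a = b then hF p i * gF p k else 0 else 0)
      + (if q = a then if p = b then hF a i * gF b k * pole (- z) else 0 else 0))"
    unfolding tilde_lax_def tilde_ser_def xy fst_conv snd_conv e by (intro sum.cong refl) (auto simp: algebra_simps)
  also have "\<dots> = (if a = b then \<Sum>p\<in>UNIV. hF p i * gF p k else 0) + hF a i * gF b k * pole (- z)"
    by (simp add: sum.distrib)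
  also have "\<dots> = Msq z x y"
    by (simp add: hF_gF hF_gF_sym[of a i] Q_sq_def xy)
  finally show "tilde_lax (evaluation_module z) x y = Msq z x y" .
qed

text \<open>Conjugation and the sign change are involutions, so M returns to L. Hence T and T~ trade
  their operators between the two kinds of modules.\<close>

lemma tilde_lax_twisted_evaluation: "tilde_lax (twisted_evaluation_module B z) = Lsq z"
proof (intro ext)
  fix x y :: "'n \<times> 'n"
  obtain i a k b where xy: "x = (i, a)" "y = (k, b)" by (cases x; cases y)
  have e: "alt (tser (twisted_evaluation_module B z) p q [a] [b]) =
      (if q = p then if a = b then 1 else 0 else 0) - pole z * (hF p a * gF q b)" for p q
  proof -
    have "tser (twisted_evaluation_module B z) p q [a] [b] = (if p = q \<and> a = b then 1 else 0) + pole (- z) * fps_const (hB p a * gB q b)"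
      using twisted_evaluation_module(3)[of z "(p, a)" "(q, b)"]
      by (simp add: lax_def Q_sq_def hF_def gF_def)
    then show ?thesis
      by (simp only: alt_add alt_mult alt_delta alt_pole alt_const) (simp add: hF_def gF_def)
  qed
  have "tilde_lax (twisted_evaluation_module B z) x y = (\<Sum>p\<in>UNIV. \<Sum>q\<in>UNIV.
      (if q = p then if a = b then hF p i * gF p k else 0 else 0)
      - pole z * ((hF p a * gF p k) * (hF q i * gF q b)))"
    unfolding tilde_lax_def tilde_ser_def xy fst_conv snd_conv e by (intro sum.cong refl) (auto simp: algebra_simps)
  also have "\<dots> = (if a = b then \<Sum>p\<in>UNIV. hF p i * gF p k else 0)
     - pole z * ((\<Sum>p\<in>UNIV. hF p a * gF p k) * (\<Sum>q\<in>UNIV. hF q i * gF q b))"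
  proof -
    have e: "(\<Sum>p\<in>UNIV. \<Sum>q\<in>UNIV. pole z * ((hF p a * gF p k) * (hF q i * gF q b))) =
      pole z * ((\<Sum>p\<in>UNIV. hF p a * gF p k) * (\<Sum>q\<in>UNIV. hF q i * gF q b))"
      by (subst sum_product) (simp only: sum_distrib_left)
    have "(\<Sum>p\<in>UNIV. \<Sum>q\<in>UNIV. if q = p then if a = b then hF p i * gF p k else 0 else 0) =
      (if a = b then \<Sum>p\<in>UNIV. hF p i * gF p k else 0)" by simp
    then show ?thesis unfolding sum_subtractf e by (rule arg_cong)
  qed
  also have "\<dots> = Lsq z x y"
  proof -
    have "(if P then if Q then 1 else 0 else 0) - c * ((if R then 1 else 0) * (if S then 1 else 0)) =
      (if Q \<and> P then 1 else 0) + (- c) * (if S \<and> R then 1 else 0)" for P Q R S and c :: "complex fps"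
      by simp
    then show ?thesis unfolding hF_gF P_sq_def xy prod.inject fst_conv snd_conv .
  qed
  finally show "tilde_lax (twisted_evaluation_module B z) x y = Lsq z x y" .
qed

lemma T_tilde_action:
  assumes V: "is_module V"
  shows "entry (module_gop V (fps_nth (T_tilde_series B $ i $ k) b)) u w = fps_nth (tilde_ser V i k u w) b"
proof -
  have sc: "module_gop V (yangian_scale c x) = gscale c (module_gop V x)" for c x
    using V by (simp add: is_module_def yangian_hom_def)
  show ?thesis
    by (simp add: T_tilde_series_def is_module_sum[OF V] sc entry_sum tilde_ser_def fps_sum_nth
        conjugate_matrix_unit hF_def gF_def alt_def tser_def mult_ac)
qed

lemma generator_action:
  assumes V: "is_module V"
  shows "entry (module_gop V (fps_nth ((T_tilde_series B ** T_series) $ i $ j) a)) u w =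
    fps_nth (\<Sum>k\<in>UNIV. \<Sum>m\<in>words (length u). tilde_ser V i k u m * tser V k j m w) a"
proof -
  have mu: "module_gop V (x * y) = module_gop V x * module_gop V y" for x y
    using V by (simp add: is_module_def yangian_hom_def)
  have "fps_nth ((T_tilde_series B ** T_series) $ i $ j) a =
    (\<Sum>k\<in>UNIV. \<Sum>b=0..a. fps_nth (T_tilde_series B $ i $ k) b * yangian_T (a - b) k j)"
    by (simp add: matrix_matrix_mult_def fps_sum_nth fps_mult_nth T_series_def)
  then have "entry (module_gop V (fps_nth ((T_tilde_series B ** T_series) $ i $ j) a)) u w =
    (\<Sum>k\<in>UNIV. \<Sum>b=0..a. \<Sum>m\<in>words (length u). fps_nth (tilde_ser V i k u m) b * fps_nth (tser V k j m w) (a - b))"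
    by (simp add: is_module_sum[OF V] mu entry_sum entry_mult T_tilde_action[OF V] tser_def)
  also have "\<dots> = (\<Sum>k\<in>UNIV. \<Sum>m\<in>words (length u). \<Sum>b=0..a. fps_nth (tilde_ser V i k u m) b * fps_nth (tser V k j m w) (a - b))"
    by (rule sum.cong[OF refl], rule sum.swap)
  finally show ?thesis by (simp add: fps_sum_nth fps_mult_nth)
qed

text \<open>T~ T becomes a matrix product over the auxiliary letter and the intermediate quantum
  word, that is, over one word of length n + 1. \<open>Z\<close> and \<open>Z'\<close> are kept
  general because L and M exchange their roles between source and target.\<close>

lemma generator_entry:
  assumes mods: "\<And>k. is_module (V k) \<and> fst (V k) = 1"
    and X: "\<And>k. k \<in> {1..n} \<Longrightarrow> acts_by k (lax (V k)) (Z k)"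
    and Y: "\<And>k. k \<in> {1..n} \<Longrightarrow> acts_by k (tilde_lax (V k)) (Z' k)"
    and len: "length u = n" "length w = n"
  shows "entry (module_gop (tensor_modules (map V [1..<Suc n]))
      (fps_nth ((T_tilde_series B ** T_series) $ i $ j) a)) u w =
    fps_nth (entry (prod_list (map Z' (rev [1..<Suc n])) * prod_list (map Z [1..<Suc n])) (i # u) (j # w)) a"
proof -
  let ?V = "tensor_modules (map V [1..<Suc n])"
  have "is_module ?V" by (rule is_module_tensor_modules) (use mods in auto)
  note ga = generator_action[OF this]
  have t1: "tser ?V k j m w = entry (prod_list (map Z [1..<Suc n])) (k # m) (j # w)" if "length m = n" for k m
  proof -
    have "tser ?V k j m w = fwd (map lax (map V [1..<Suc n])) k j m w"
      by (rule tser_tensor_modules) (use mods that len in auto)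
    then show ?thesis
      using entry_forward_product[where p = 0 and v = "[]" and v' = "[]" and X = "\<lambda>k. lax (V k)" and Z = Z and n = n and u = m and w = w and i = k and j = j] X that len by (simp add: comp_def)
  qed
  have t2: "tilde_ser ?V i k u m = entry (prod_list (map Z' (rev [1..<Suc n]))) (i # u) (k # m)" if "length m = n" for k m
  proof -
    have "tilde_ser ?V i k u m = bwd (map tilde_lax (map V [1..<Suc n])) i k u m"
      by (rule tilde_ser_tensor_modules) (use mods that len in auto)
    then show ?thesis
      using entry_backward_product[where p = 0 and v = "[]" and v' = "[]" and X = "\<lambda>k. tilde_lax (V k)" and Z = Z' and n = n and u = u and w = m and i = i and j = k] Y that len by (simp add: comp_def)
  qed
  have "(\<Sum>k\<in>UNIV. \<Sum>m\<in>words (length u). tilde_ser ?V i k u m * tser ?V k j m w) =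
    (\<Sum>k\<in>UNIV. \<Sum>m\<in>words n. entry (prod_list (map Z' (rev [1..<Suc n]))) (i # u) (k # m)
       * entry (prod_list (map Z [1..<Suc n])) (k # m) (j # w))"
    by (intro sum.cong) (use len t1 t2 in auto)
  also have "\<dots> = entry (prod_list (map Z' (rev [1..<Suc n])) * prod_list (map Z [1..<Suc n])) (i # u) (j # w)"
    unfolding entry_mult using len by (simp add: sum_words_Suc)
  finally show ?thesis unfolding ga by simp
qed

end

section \<open>The operator F as a product in the ring\<close>

lemma ordered_pairs_upt:
  "ordered_pairs [a..<b] = concat (map (\<lambda>k. map (Pair k) [Suc k..<b]) [a..<b])"
proof (induction "b - a" arbitrary: a)
  case (Suc d)
  then have "[a..<b] = a # [Suc a..<b]" by (simp add: upt_conv_Cons)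
  then show ?case using Suc by simp
qed simp

lemma lex_pairs_eq: "lex_pairs n = ordered_pairs [1..<Suc n]"
  unfolding lex_pairs_def ordered_pairs_upt by (simp add: Pair_def)

text \<open>The operator \<open>Y\<close> is \<open>X\<close> in the quantum factors, tensored with the identity of the auxiliary one.\<close>

definition lifts :: "nat \<Rightarrow> 'n tensor_op \<Rightarrow> ('n::finite, complex fps) gop \<Rightarrow> bool" where
  "lifts n X Y \<longleftrightarrow> (\<forall>i j u w. length u = n \<longrightarrow> length w = n \<longrightarrow>
     entry Y (i # u) (j # w) = (if i = j then fps_const (X u w) else 0))"

lemma lifts_id: "lifts n op_id 1"
  by (simp add: lifts_def op_id_def)

lemma lifts_left:
  assumes "lifts n X Y" "length u = n"
  shows "entry (Y * Z) (i # u) v = (\<Sum>m\<in>words n. fps_const (X u m) * entry Z (i # m) v)"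
proof -
  have "entry (Y * Z) (i # u) v = (\<Sum>k\<in>UNIV. \<Sum>m\<in>words n. entry Y (i # u) (k # m) * entry Z (k # m) v)"
    using assms by (simp add: entry_mult sum_words_Suc)
  also have "\<dots> = (\<Sum>k\<in>UNIV. if k = i then \<Sum>m\<in>words n. fps_const (X u m) * entry Z (k # m) v else 0)"
    by (intro sum.cong refl) (use assms in \<open>auto simp: lifts_def intro!: sum.cong\<close>)
  finally show ?thesis by simp
qed

lemma lifts_right:
  assumes "lifts n X Y" "length w = n" "length v = Suc n"
  shows "entry (Z * Y) v (j # w) = (\<Sum>m\<in>words n. entry Z v (j # m) * fps_const (X m w))"
proof -
  have "entry (Z * Y) v (j # w) = (\<Sum>k\<in>UNIV. \<Sum>m\<in>words n. entry Z v (k # m) * entry Y (k # m) (j # w))"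
    using assms by (simp add: entry_mult sum_words_Suc)
  also have "\<dots> = (\<Sum>k\<in>UNIV. if k = j then \<Sum>m\<in>words n. entry Z v (j # m) * fps_const (X m w) else 0)"
    by (intro sum.cong refl) (use assms in \<open>auto simp: lifts_def intro!: sum.cong\<close>)
  finally show ?thesis by simp
qed

lemma lifts_mult:
  assumes "lifts n X Y" "lifts n X' Y'"
  shows "lifts n (op_mult n X X') (Y * Y')"
  unfolding lifts_def
proof (intro allI impI)
  fix i j :: 'a and u w :: "'a list" assume "length u = n" "length w = n"
  then have "entry (Y * Y') (i # u) (j # w) = (\<Sum>m\<in>words n. fps_const (X u m) * (if i = j then fps_const (X' m w) else 0))"
    using assms(2) by (simp add: lifts_left[OF assms(1)] lifts_def)
  then show "entry (Y * Y') (i # u) (j # w) = (if i = j then fps_const (op_mult n X X' u w) else 0)"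
    by (simp add: op_mult_def fps_const_sum)
qed

lemma lifts_factor:
  assumes "lifts n X Y"
  shows "lifts n (op_factor X c) (1 - gscale (fps_const (1 / c)) Y)"
  using assms by (auto simp: lifts_def op_factor_def op_id_def simp flip: fps_const_sub)

text \<open>\<open>act_in_factors\<close> numbers factors from 1 but list positions from 0. The
  auxiliary first letter shifts positions by one, so the same \<open>k\<close> and \<open>l\<close>
  appear in \<open>act\<close>.\<close>

lemma lifts_act:
  assumes "k \<in> {1..n}" "l \<in> {1..n}"
  shows "lifts n (act_in_factors k l X) (act k l (\<lambda>p q. fps_const (X p q)))"
  unfolding lifts_def
proof (intro allI impI)
  fix i j :: 'a and u w :: "'a list" assume len: "length u = n" "length w = n"
  obtain k' l' where kl: "k = Suc k'" "l = Suc l'" using assms by (cases k; cases l) auto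
  define E where "E \<longleftrightarrow> (\<forall>m<n. m \<noteq> k' \<and> m \<noteq> l' \<longrightarrow> u ! m = w ! m)"
  have E: "(\<forall>m<Suc n. m \<noteq> k \<and> m \<noteq> l \<longrightarrow> (i # u) ! m = (j # w) ! m) \<longleftrightarrow> i = j \<and> E"
    unfolding E_def using kl by (auto simp: All_less_Suc2)
  have "entry (act k l (\<lambda>p q. fps_const (X p q))) (i # u) (j # w) =
      (if i = j \<and> E then fps_const (X (u ! k', u ! l') (w ! k', w ! l')) else 0)"
    unfolding E[symmetric] using len assms kl by (auto simp: entry_act)
  moreover have "act_in_factors k l X u w = (if E then X (u ! k', u ! l') (w ! k', w ! l') else 0)"
    unfolding E_def act_in_factors_def using len kl by auto
  ultimately show "entry (act k l (\<lambda>p q. fps_const (X p q))) (i # u) (j # w) =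
      (if i = j then fps_const (act_in_factors k l X u w) else 0)"
    by simp
qed

lemma lifts_ordered_prod:
  assumes "\<And>x. x \<in> set xs \<Longrightarrow> lifts n (X x) (Y x)"
  shows "lifts n (ordered_prod n (map X xs)) (prod_list (map Y xs))"
  using assms by (induction xs) (auto simp: ordered_prod_def lifts_id lifts_mult)

lemma set_lex_pairs: "(k, l) \<in> set (lex_pairs n) \<Longrightarrow> 1 \<le> k \<and> k < l \<and> l \<le> n"
  by (auto simp: lex_pairs_def)

section \<open>Passage to the limit\<close>

text \<open>Continuity at 0 for each power of 1/x separately; a coefficient of a product is then a
  finite sum of products, and no topology on series is needed.\<close>

definition coeff_cont :: "(complex \<Rightarrow> ('n::finite, complex fps) gop) \<Rightarrow> bool" where
  "coeff_cont X \<longleftrightarrow> (\<forall>u w a. ((\<lambda>s. fps_nth (entry (X s) u w) a) \<longlongrightarrow> fps_nth (entry (X 0) u w) a) (at 0))"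

lemma coeff_cont_mult:
  assumes "coeff_cont X" "coeff_cont Y"
  shows "coeff_cont (\<lambda>s. X s * Y s)"
  using assms unfolding coeff_cont_def entry_mult fps_sum_nth fps_mult_nth
  by (intro allI tendsto_sum tendsto_mult) auto

lemma coeff_cont_prod_list:
  assumes "\<And>x. x \<in> set xs \<Longrightarrow> coeff_cont (\<lambda>s. X s x)"
  shows "coeff_cont (\<lambda>s. prod_list (map (X s) xs))"
  using assms
proof (induction xs)
  case Nil
  then show ?case by (simp add: coeff_cont_def)
qed (simp add: coeff_cont_mult)

lemma coeff_cont_affine:
  assumes "\<And>a. ((\<lambda>s. fps_nth (f s) a) \<longlongrightarrow> fps_nth (f 0) a) (at 0)"
  shows "coeff_cont (\<lambda>s. C + gscale (f s) Y)"
  unfolding coeff_cont_def entry_simps entry_gscale fps_add_nth fps_mult_nth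
  by (intro allI tendsto_add tendsto_sum tendsto_mult tendsto_const assms)

lemma tendsto_pole:
  assumes "(g \<longlongrightarrow> g 0) (at (0::complex))"
  shows "((\<lambda>s. fps_nth (pole (g s)) a) \<longlongrightarrow> fps_nth (pole (g 0)) a) (at 0)"
  by (cases a) (auto simp: pole_def intro!: tendsto_power assms)

lemma eventually_affine_nonzero:
  assumes "a \<noteq> 0 \<or> b \<noteq> (0::complex)"
  shows "\<forall>\<^sub>F s in at 0. a + s * b \<noteq> 0"
proof (cases "a = 0")
  case True
  then show ?thesis using assms by (auto simp: eventually_at_filter)
next
  case False
  have "((\<lambda>s. a + s * b) \<longlongrightarrow> a + 0 * b) (at 0)" by (intro tendsto_intros)
  then show ?thesis using False by (intro tendsto_imp_eventually_ne) auto
qed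

lemma tendsto_polynomial_fun:
  assumes "polynomial_fun p" "\<And>k. ((\<lambda>s. t s k) \<longlongrightarrow> t0 k) F"
  shows "((\<lambda>s. p (t s)) \<longlongrightarrow> p t0) F"
  using assms(1) by induction (auto intro!: tendsto_intros assms(2))

text \<open>Near the point \<open>q\<close> does not vanish, so on the path \<open>f\<close> is
  \<open>p / q\<close>. Any path within \<open>S\<close> thus computes the value, which also makes
  it unique once such a path exists.\<close>

lemma tendsto_regular_value:
  assumes "regular_value S f t0 y" "\<And>k. ((\<lambda>s. t s k) \<longlongrightarrow> t0 k) F" "\<forall>\<^sub>F s in F. t s \<in> S"
  shows "((\<lambda>s. f (t s)) \<longlongrightarrow> y) F"
proof -
  obtain p q where pq: "polynomial_fun p" "polynomial_fun q" "q t0 \<noteq> 0" "\<forall>t\<in>S. f t * q t = p t" "y = p t0 / q t0"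
    using assms(1) unfolding regular_value_def by blast
  have q: "((\<lambda>s. q (t s)) \<longlongrightarrow> q t0) F" using pq(2) assms(2) by (rule tendsto_polynomial_fun)
  have "((\<lambda>s. p (t s) / q (t s)) \<longlongrightarrow> y) F"
    unfolding pq(5) by (rule tendsto_divide[OF tendsto_polynomial_fun[OF pq(1) assms(2)] q pq(3)])
  moreover have "\<forall>\<^sub>F s in F. p (t s) / q (t s) = f (t s)"
    using assms(3) tendsto_imp_eventually_ne[OF q pq(3)]
  proof eventually_elim
    case (elim s)
    have "f (t s) * q (t s) = p (t s)" using pq(4) elim(1) by blast
    then show ?case using elim(2) by (simp add: divide_eq_eq)
  qed
  ultimately show ?thesis by (rule Lim_transform_eventually)
qed

context form_setup
begin

lemma Q_sq_eq: "Q_sq hF gF = (\<lambda>p q. fps_const (Q_square B us vs p q))"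
  by (intro ext) (auto simp: Q_sq_def Q_square_def hF_def gF_def hB_def gB_def mult.commute split: prod.splits)

lemma P_sq_eq: "P_sq = (\<lambda>p q. fps_const (P_square p q))"
  by (intro ext) (auto simp: P_sq_def P_square_def split: prod.splits)

text \<open>\<open>F\<close> does not touch the auxiliary letter and has no x in its entries, so the
  ring identity separates into one identity for each pair of auxiliary letters and each power of
  1/x.\<close>

lemma generic_intertwining:
  fixes z :: "nat \<Rightarrow> complex"
  assumes Q: "\<And>k l. 1 \<le> k \<Longrightarrow> k < l \<Longrightarrow> l \<le> n \<Longrightarrow> Q_denominator CARD('n) M D \<Omega> t k l = z k + z l + of_nat CARD('n)"
    and P: "\<And>k l. 1 \<le> k \<Longrightarrow> k < l \<Longrightarrow> l \<le> n \<Longrightarrow> P_denominator D \<Omega> t k l = z k - z l"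
    and t: "t \<in> F_domain G CARD('n) M n D \<Omega>"
    and len: "length u = n" "length w = n"
  defines "ks \<equiv> [1..<Suc n]"
  shows "(\<Sum>m\<in>words n. F_function B us vs M n D \<Omega> t u m *
        fps_nth (entry (prod_list (map (F.L z) (rev ks)) * prod_list (map (F.M z) ks)) (i # m) (j # w)) a) =
    (\<Sum>m\<in>words n. fps_nth (entry (prod_list (map (F.M z) (rev ks)) * prod_list (map (F.L z) ks)) (i # u) (j # m)) a
        * F_function B us vs M n D \<Omega> t m w)"
proof -
  have nz: "z k + z l + of_nat CARD('n) \<noteq> 0" "z k - z l \<noteq> 0" if "1 \<le> k" "k < l" "l \<le> n" for k l
    using t Q[OF that] P[OF that] that unfolding F_domain_def by fastforce+
  interpret T: twisted_setup gF hF "fps_const eps" z n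
  proof
    fix k l assume kl: "k \<in> {1..n}" "l \<in> {1..n}" "k \<noteq> l"
    show "z k - z l \<noteq> 0"
      using nz(2)[of k l] nz(2)[of l k] kl by (cases "k < l") auto
    show "z k + z l + of_nat CARD('n) \<noteq> 0"
      using nz(1)[of k l] nz(1)[of l k] kl by (cases "k < l") (auto simp: add.commute)
  qed
  let ?F = "T.Qprod ks * T.Rprod ks"
  have F: "lifts n (F_function B us vs M n D \<Omega> t) ?F"
    unfolding F_function_def T.Qprod_def T.Rprod_def ks_def lex_pairs_eq[symmetric]
  proof (intro lifts_mult lifts_ordered_prod)
    fix x assume "x \<in> set (lex_pairs n)"
    moreover obtain k l where x: "x = (k, l)" by (cases x)
    ultimately have kl: "1 \<le> k" "k < l" "l \<le> n" using set_lex_pairs by blast+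
    then have kl': "k \<in> {1..n}" "l \<in> {1..n}" by auto
    show "lifts n (case x of (k, l) \<Rightarrow> op_factor (act_in_factors k l (Q_square B us vs)) (Q_denominator CARD('n) M D \<Omega> t k l))
        (case x of (k, l) \<Rightarrow> F.q z k l)"
      unfolding x prod.case F.q_def Q[OF kl] Q_sq_eq by (intro lifts_factor lifts_act kl')
    show "lifts n (case x of (k, l) \<Rightarrow> op_factor (act_in_factors k l P_square) (P_denominator D \<Omega> t k l))
        (case x of (k, l) \<Rightarrow> F.r z k l)"
      unfolding x prod.case F.r_def P[OF kl] P_sq_eq by (intro lifts_factor lifts_act kl')
  qed
  have "?F * (T.Lb ks * T.Mf ks) = (T.Mb ks * T.Lf ks) * ?F"
    by (rule T.Qprod_Rprod_intertwines) (auto simp: ks_def)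
  then have "fps_nth (entry (?F * (T.Lb ks * T.Mf ks)) (i # u) (j # w)) a =
      fps_nth (entry ((T.Mb ks * T.Lf ks) * ?F) (i # u) (j # w)) a"
    by simp
  then show ?thesis
    using len by (simp add: lifts_left[OF F] lifts_right[OF F] fps_sum_nth)
qed

lemma coeff_cont_Lax:
  assumes "\<And>k. ((\<lambda>s. z s k) \<longlongrightarrow> z 0 k) (at 0)"
  shows "coeff_cont (\<lambda>s. F.L (z s) k)" "coeff_cont (\<lambda>s. F.M (z s) k)"
proof -
  have L: "((\<lambda>s. fps_nth (- pole (z s k)) a) \<longlongrightarrow> fps_nth (- pole (z 0 k)) a) (at 0)" for a
    unfolding fps_neg_nth by (rule tendsto_minus[OF tendsto_pole[where g = "\<lambda>s. z s k"]]) (rule assms)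
  have M: "((\<lambda>s. fps_nth (pole (- z s k)) a) \<longlongrightarrow> fps_nth (pole (- z 0 k)) a) (at 0)" for a
    by (rule tendsto_pole[where g = "\<lambda>s. - z s k"]) (rule tendsto_minus, rule assms)
  show "coeff_cont (\<lambda>s. F.L (z s) k)" "coeff_cont (\<lambda>s. F.M (z s) k)"
    unfolding F.factors_as_sums by (rule coeff_cont_affine, rule L) (rule coeff_cont_affine, rule M)
qed

text \<open>The elements whose actions are intertwined by \<open>F\<close> form a unital subalgebra,
  so the coefficients of T~ T suffice.\<close>

lemma intertwining_from_generators:
  assumes V: "is_module V" and W: "is_module W" and n: "fst V = n" "fst W = n"
    and gen: "\<And>i j a u w. length u = n \<Longrightarrow> length w = n \<Longrightarrow>
      (\<Sum>m\<in>words n. F u m * entry (module_gop V (fps_nth ((T_tilde_series B ** T_series) $ i $ j) a)) m w) =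
      (\<Sum>m\<in>words n. entry (module_gop W (fps_nth ((T_tilde_series B ** T_series) $ i $ j) a)) u m * F m w)"
  shows "intertwining (twisted_yangian B) V W F"
proof -
  let ?F = "gop_of n F"
  have "?F * module_gop V x = module_gop W x * ?F" if "x \<in> twisted_yangian B" for x
    using that
  proof induction
    case (generator i j a)
    show ?case
    proof (rule gop_eqI)
      fix u w :: "'n list" assume len: "length u = length w"
      show "entry (?F * module_gop V (fps_nth ((T_tilde_series B ** T_series) $ i $ j) a)) u w =
        entry (module_gop W (fps_nth ((T_tilde_series B ** T_series) $ i $ j) a) * ?F) u w"
      proof (cases "length u = n")
        case True
        then show ?thesis using gen[of u w] len by (simp add: entry_mult)
      next
        case False
        then show ?thesis using len by (simp add: entry_mult module_gop_def n)
      qed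
    qed
  next
    case one
    show ?case using V W by (simp add: is_module_def yangian_hom_def n)
  next
    case (scale x c)
    then show ?case using V W by (simp add: is_module_def yangian_hom_def gscale_mult_left gscale_mult_right)
  next
    case (add x y)
    then show ?case using V W by (simp add: is_module_def yangian_hom_def algebra_simps)
  next
    case (mult x y)
    have "?F * (module_gop V x * module_gop V y) = module_gop W x * module_gop W y * ?F"
      by (metis mult.IH mult.assoc)
    then show ?case using V W by (simp add: is_module_def yangian_hom_def)
  qed
  then have *: "gop_of n (op_mult n F (snd V x)) = gop_of n (op_mult n (snd W x) F)" if "x \<in> twisted_yangian B" for x
    using that by (simp add: gop_of_mult module_gop_def n)
  show ?thesis
    unfolding intertwining_def n
  proof (intro ballI)
    fix x and u w :: "'n list" assume "x \<in> twisted_yangian B" "u \<in> words n" "w \<in> words n"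
    then have "entry (gop_of n (op_mult n F (snd V x))) u w = entry (gop_of n (op_mult n (snd W x) F)) u w"
      using * by simp
    then show "op_mult n F (snd V x) u w = op_mult n (snd W x) F u w"
      using \<open>u \<in> words n\<close> \<open>w \<in> words n\<close> by simp
  qed
qed

end

section \<open>The special point as a limit along a line\<close>

theorem proposition1p7:
  fixes G :: group_type
    and B :: "complex^'N \<Rightarrow> complex^'N \<Rightarrow> complex"
    and us vs :: "'N \<Rightarrow> complex^'N"
    and M n :: nat
    and lam mu :: "nat \<Rightarrow> nat"
    and \<Omega> :: "nat \<times> nat \<Rightarrow> nat"
  assumes form: "form_of_type G B"
    and bases: "dual_bases B us vs"
    and even: "G = Symp \<Longrightarrow> even CARD('N) \<and> even M"
    and lam: "is_partition lam"
    and mu: "is_partition mu"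
    and le: "\<And>i. 1 \<le> i \<Longrightarrow> mu i \<le> lam i"
    and lam_adm: "admissible G (CARD('N) + M) lam"
    and mu_adm: "admissible G M mu"
    and n: "n = card (skew_diagram lam mu)"
    and tableau: "standard_tableau (skew_diagram lam mu) n \<Omega>"
  shows "intertwining (twisted_yangian B)
    (tensor_modules (map (\<lambda>k. twisted_evaluation_module B (d_param G M (skew_diagram lam mu) \<Omega> k))
                       [1..<Suc n]))
    (tensor_modules (map (\<lambda>k. evaluation_module (d_param G M (skew_diagram lam mu) \<Omega> k))
                       [1..<Suc n]))
    (F_op G B us vs M n (skew_diagram lam mu) \<Omega>)"
proof -
  interpret form_setup G B us vs by unfold_locales (rule form bases)+
  let ?D = "skew_diagram lam mu"
  let ?N = "CARD('N)"
  let ?S = "F_domain G ?N M n ?D \<Omega>"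
  let ?f = "F_function B us vs M n ?D \<Omega>"
  let ?F = "F_op G B us vs M n ?D \<Omega>"
  define z0 where "z0 = d_param G M ?D \<Omega>"
  define e where "e k = (of_nat (case G of Orth \<Rightarrow> snd (box ?D \<Omega> k) | Symp \<Rightarrow> fst (box ?D \<Omega> k)) :: complex)" for k
  define z where "z s k = z0 k + s * e k" for s k
  \<comment> \<open>The direction \<open>e\<close> is constant on columns (rows), so the line stays in the constraint space; it
    separates different columns (rows), and boxes in the same one have different contents.\<close>
  define t where "t s k = half_shift G + s * e k" for s k
  have box: "box ?D \<Omega> k \<in> ?D" "\<Omega> (box ?D \<Omega> k) = k" if "k \<in> {1..n}" for k
    using tableau that unfolding standard_tableau_def bij_betw_def box_def
    by (auto intro: inv_into_into f_inv_into_f)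
  \<comment> \<open>Each of the two parameters contributes half of \<open>M\<close>, and the half
    shift is already part of \<open>z0\<close>.\<close>
  have Qden: "Q_denominator ?N M ?D \<Omega> (t s) k l = z s k + z s l + of_nat ?N" for s k l
    by (simp add: Q_denominator_def t_def z_def z0_def d_param_def)
  have Pden: "P_denominator ?D \<Omega> (t s) k l = z s k - z s l" for s k l
    by (simp add: P_denominator_def t_def z_def z0_def d_param_def)
  have dom: "\<forall>\<^sub>F s in at 0. t s \<in> ?S"
  proof -
    have "\<forall>\<^sub>F s in at 0. \<forall>(k, l)\<in>{(k, l). 1 \<le> k \<and> k < l \<and> l \<le> n}.
       Q_denominator ?N M ?D \<Omega> (t s) k l \<noteq> 0 \<and> P_denominator ?D \<Omega> (t s) k l \<noteq> 0"
    proof (rule eventually_ball_finite)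
      have "{(k, l). 1 \<le> k \<and> k < l \<and> l \<le> n} \<subseteq> {..n} \<times> {..n}" by auto
      then show "finite {(k, l). 1 \<le> k \<and> k < l \<and> l \<le> n}" by (rule finite_subset) simp
      show "\<forall>x\<in>{(k, l). 1 \<le> k \<and> k < l \<and> l \<le> n}. \<forall>\<^sub>F s in at 0. case x of (k, l) \<Rightarrow>
         Q_denominator ?N M ?D \<Omega> (t s) k l \<noteq> 0 \<and> P_denominator ?D \<Omega> (t s) k l \<noteq> 0"
      proof clarify
        fix k l assume kl: "1 \<le> k" "k < l" "l \<le> n"
        \<comment> \<open>Rows and columns are numbered from 1, so both summands are positive and
          the Q-denominator is not constant along the line.\<close>
        have "e k + e l \<noteq> 0"
        proof -
          have "0 < fst (box ?D \<Omega> k)" "0 < snd (box ?D \<Omega> k)"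
            using box(1)[of k] kl by (auto simp: skew_diagram_def case_prod_unfold)
          then have "0 < (case G of Orth \<Rightarrow> snd (box ?D \<Omega> k) | Symp \<Rightarrow> fst (box ?D \<Omega> k))"
            by (cases G) auto
          then show ?thesis unfolding e_def of_nat_add[symmetric] of_nat_eq_0_iff by simp
        qed
        then have "\<forall>\<^sub>F s in at 0. (z0 k + z0 l + of_nat ?N) + s * (e k + e l) \<noteq> 0"
          by (intro eventually_affine_nonzero) simp
        moreover have "z0 k - z0 l \<noteq> 0 \<or> e k - e l \<noteq> 0"
        proof (rule ccontr)
          assume "\<not> (z0 k - z0 l \<noteq> 0 \<or> e k - e l \<noteq> 0)"
          then have "content ?D \<Omega> k = content ?D \<Omega> l" "e k = e l"
            by (simp_all add: z0_def d_param_def)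
          \<comment> \<open>The content together with the column (for O) or the row (for Sp)
            determines the box, and different numbers occupy different boxes.\<close>
          then have "box ?D \<Omega> k = box ?D \<Omega> l"
            unfolding content_def e_def by (intro prod_eqI) (cases G; simp)+
          then show False using box(2)[of k] box(2)[of l] kl by simp
        qed
        then have "\<forall>\<^sub>F s in at 0. (z0 k - z0 l) + s * (e k - e l) \<noteq> 0"
          by (rule eventually_affine_nonzero)
        ultimately show "\<forall>\<^sub>F s in at 0. Q_denominator ?N M ?D \<Omega> (t s) k l \<noteq> 0 \<and> P_denominator ?D \<Omega> (t s) k l \<noteq> 0"
          unfolding Qden Pden z_def by eventually_elim (simp add: algebra_simps)
      qed
    qed
    moreover have "t s \<in> constraint_space G n ?D \<Omega>" for s
      unfolding constraint_space_def t_def e_def by (cases G) auto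
    ultimately show ?thesis
      unfolding F_domain_def by (auto elim!: eventually_mono)
  qed
  have t_lim: "((\<lambda>s. t s k) \<longlongrightarrow> half_shift G) (at 0)" for k
    unfolding t_def by (auto intro!: tendsto_eq_intros)
  have z_lim: "((\<lambda>s. z s k) \<longlongrightarrow> z 0 k) (at 0)" for k
    unfolding z_def by (auto intro!: tendsto_eq_intros)
  let ?reg = "\<forall>u\<in>words n. \<forall>w\<in>words n. \<exists>y. regular_value ?S (\<lambda>t. ?f t u w) (\<lambda>_. half_shift G) y"
  have F_lim: "((\<lambda>s. ?f (t s) u w) \<longlongrightarrow> ?F u w) (at 0)" if reg: ?reg and uw: "length u = n" "length w = n" for u w
  proof -
    have lim: "((\<lambda>s. ?f (t s) u w) \<longlongrightarrow> y) (at 0)"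
      if "regular_value ?S (\<lambda>t. ?f t u w) (\<lambda>_. half_shift G) y" for y
      using tendsto_regular_value[OF that t_lim dom] .
    obtain y where y: "regular_value ?S (\<lambda>t. ?f t u w) (\<lambda>_. half_shift G) y"
      using reg uw by force
    \<comment> \<open>All regular values are limits of the same function along the line, so
      \<open>y\<close> is the only one.\<close>
    have "(THE y. regular_value ?S (\<lambda>t. ?f t u w) (\<lambda>_. half_shift G) y) = y"
      using y tendsto_unique[OF _ lim lim] by (intro the_equality) auto
    then have "?F u w = y" using reg unfolding F_op_def Let_def by simp
    then show ?thesis using lim[OF y] by simp
  qed
  let ?ks = "[1..<Suc n]"
  let ?Lf = "\<lambda>s. prod_list (map (F.L (z s)) ?ks)" and ?Lb = "\<lambda>s. prod_list (map (F.L (z s)) (rev ?ks))"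
    and ?Mf = "\<lambda>s. prod_list (map (F.M (z s)) ?ks)" and ?Mb = "\<lambda>s. prod_list (map (F.M (z s)) (rev ?ks))"
  have z00: "z 0 = z0" by (simp add: z_def fun_eq_iff)
  have lax_ev: "lax (evaluation_module x) = Lsq x" and lax_tw: "lax (twisted_evaluation_module B x) = Msq x" for x
    by (intro ext, rule evaluation_module twisted_evaluation_module)+
  show ?thesis
  proof (rule intertwining_from_generators[where n = n])
    fix i j a and u w :: "'N list" assume len: "length u = n" "length w = n"
    have V: "entry (module_gop (tensor_modules (map (\<lambda>k. twisted_evaluation_module B (d_param G M ?D \<Omega> k)) ?ks))
        (fps_nth ((T_tilde_series B ** T_series) $ i $ j) a)) u w = fps_nth (entry (?Lb 0 * ?Mf 0) (i # u) (j # w)) a"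
      if "length u = n" "length w = n" for u w
      unfolding z00 z0_def[symmetric]
    proof (rule generator_entry)
      show "acts_by k (lax (twisted_evaluation_module B (z0 k))) (F.M z0 k)"
        "acts_by k (tilde_lax (twisted_evaluation_module B (z0 k))) (F.L z0 k)" if "k \<in> {1..n}" for k
        unfolding lax_tw tilde_lax_twisted_evaluation by (rule L_acts M_acts; use that in simp)+
    qed (use that in \<open>simp_all add: twisted_evaluation_module\<close>)
    have W: "entry (module_gop (tensor_modules (map (\<lambda>k. evaluation_module (d_param G M ?D \<Omega> k)) ?ks))
        (fps_nth ((T_tilde_series B ** T_series) $ i $ j) a)) u w = fps_nth (entry (?Mb 0 * ?Lf 0) (i # u) (j # w)) a"
      if "length u = n" "length w = n" for u w
      unfolding z00 z0_def[symmetric]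
    proof (rule generator_entry)
      show "acts_by k (lax (evaluation_module (z0 k))) (F.L z0 k)"
        "acts_by k (tilde_lax (evaluation_module (z0 k))) (F.M z0 k)" if "k \<in> {1..n}" for k
        unfolding lax_ev tilde_lax_evaluation by (rule L_acts M_acts; use that in simp)+
    qed (use that in \<open>simp_all add: evaluation_module\<close>)
    show "(\<Sum>m\<in>words n. ?F u m * entry (module_gop (tensor_modules (map (\<lambda>k. twisted_evaluation_module B (d_param G M ?D \<Omega> k)) ?ks)) (fps_nth ((T_tilde_series B ** T_series) $ i $ j) a)) m w) =
      (\<Sum>m\<in>words n. entry (module_gop (tensor_modules (map (\<lambda>k. evaluation_module (d_param G M ?D \<Omega> k)) ?ks)) (fps_nth ((T_tilde_series B ** T_series) $ i $ j) a)) u m * ?F m w)"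
      (is "?lhs = ?rhs")
    proof (cases ?reg)
      case False
      \<comment> \<open>the conventional value 0 of \<open>F_op\<close> at a point where F is not regular\<close>
      then have "?F = (\<lambda>u w. 0)" unfolding F_op_def Let_def by (simp only: if_False)
      then show ?thesis by simp
    next
      case reg: True
      let ?l = "\<lambda>s. \<Sum>m\<in>words n. ?f (t s) u m * fps_nth (entry (?Lb s * ?Mf s) (i # m) (j # w)) a"
      let ?r = "\<lambda>s. \<Sum>m\<in>words n. fps_nth (entry (?Mb s * ?Lf s) (i # u) (j # m)) a * ?f (t s) m w"
      have "coeff_cont (\<lambda>s. ?Lb s * ?Mf s)" "coeff_cont (\<lambda>s. ?Mb s * ?Lf s)"
        by (intro coeff_cont_mult coeff_cont_prod_list coeff_cont_Lax z_lim)+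
      then have cc: "((\<lambda>s. fps_nth (entry (?Lb s * ?Mf s) u w) a) \<longlongrightarrow> fps_nth (entry (?Lb 0 * ?Mf 0) u w) a) (at 0)"
        "((\<lambda>s. fps_nth (entry (?Mb s * ?Lf s) u w) a) \<longlongrightarrow> fps_nth (entry (?Mb 0 * ?Lf 0) u w) a) (at 0)" for u w a
        unfolding coeff_cont_def by blast+
      have "(?l \<longlongrightarrow> (\<Sum>m\<in>words n. ?F u m * fps_nth (entry (?Lb 0 * ?Mf 0) (i # m) (j # w)) a)) (at 0)"
        by (intro tendsto_sum tendsto_mult cc F_lim[OF reg]) (use len in auto)
      then have l: "(?l \<longlongrightarrow> ?lhs) (at 0)" using V len by (simp del: upt_Suc)
      have "(?r \<longlongrightarrow> (\<Sum>m\<in>words n. fps_nth (entry (?Mb 0 * ?Lf 0) (i # u) (j # m)) a * ?F m w)) (at 0)"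
        by (intro tendsto_sum tendsto_mult cc F_lim[OF reg]) (use len in auto)
      then have r: "(?r \<longlongrightarrow> ?rhs) (at 0)" using W len by (simp del: upt_Suc)
      have "\<forall>\<^sub>F s in at 0. ?l s = ?r s"
        using dom by eventually_elim (rule generic_intertwining[OF Qden Pden _ len])
      \<comment> \<open>For small nonzero \<open>s\<close> both sides are equal by
        \<open>generic_intertwining\<close>, so \<open>?r\<close> has the limit of \<open>?l\<close>
        as well as its own, and uniqueness of limits identifies the two.\<close>
      then have "(?r \<longlongrightarrow> ?lhs) (at 0)" by (rule Lim_transform_eventually[OF l])
      from this r show ?thesis by (intro tendsto_unique[of "at 0" ?r]) auto
    qed
  next
    show "is_module (tensor_modules (map (\<lambda>k. twisted_evaluation_module B (d_param G M ?D \<Omega> k)) ?ks))"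
      "is_module (tensor_modules (map (\<lambda>k. evaluation_module (d_param G M ?D \<Omega> k) :: 'N yangian_module) ?ks))"
      by (rule is_module_tensor_modules, auto simp: evaluation_module twisted_evaluation_module)+
    show "fst (tensor_modules (map (\<lambda>k. twisted_evaluation_module B (d_param G M ?D \<Omega> k)) ?ks)) = n"
      "fst (tensor_modules (map (\<lambda>k. evaluation_module (d_param G M ?D \<Omega> k) :: 'N yangian_module) ?ks)) = n"
      by (subst fst_tensor_modules; auto simp: evaluation_module twisted_evaluation_module simp del: One_nat_def)+
  qed
qed

end
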